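(* Let $\{\boldsymbol u_\eta\}$ and $\{\eta\,\mathrm{curl}\,\boldsymbol u_\eta\}$ be two uniformly bounded sequences in $L^2(\Omega;\mathbb{R}^3)$. Then there exist a subsequence $\{\boldsymbol u_{\eta_k}\}$ and a function $\boldsymbol u_0\in L^2(\Omega,\mathcal H_\sharp(\mathrm{curl}_{\mathbf R},Y^m))$ such that, as $\eta_k\to0$, in the sense of weak two-scale convergence for the matrix $\mathbf R$, $$\boldsymbol u_{\eta_k}\rightharpoonup\boldsymbol u_0(\boldsymbol x,\boldsymbol y),\qquad \eta_k\,\mathrm{curl}\,\boldsymbol u_{\eta_k}\rightharpoonup\mathrm{curl}_{\mathbf R}\,\boldsymbol u_0(\boldsymbol x,\boldsymbol y).$$
   Context: $\Omega\subset\mathbb{R}^3$ is a bounded open set with Lipschitz boundary; $\eta>0$ is a parameter tending to $0$. $\mathbf R$ is a real matrix with $m$ rows and $3$ columns, $m>3$, satisfying $\mathbf R^T\boldsymbol k\neq\boldsymbol 0$ for all $\boldsymbol k\in\mathbb{Z}^m\setminus\{\boldsymbol 0\}$. $Y^m=]0,1[^m$; the subscript $\sharp$ denotes $Y^m$-periodicity in $\boldsymbol y$. Weak two-scale convergence for $\mathbf R$: $(u_\eta)\subset L^2(\Omega)$ converges to $u_0\in L^2(\Omega\times Y^m)$ if $\lim_{\eta\to0}\int_\Omega u_\eta(\boldsymbol x)\varphi(\boldsymbol x,\mathbf R\boldsymbol x/\eta)\,d\boldsymbol x=\int\!\!\int_{\Omega\times Y^m}u_0\varphi\,d\boldsymbol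 x\,d\boldsymbol y$ for every $\varphi\in L^2(\Omega,C_\sharp(Y^m))$ (componentwise for vector fields). $\mathrm{curl}_{\mathbf R}\,\boldsymbol u=(\mathbf R^T\nabla_{\boldsymbol y})\times\boldsymbol u$, and $\mathcal H_\sharp(\mathrm{curl}_{\mathbf R},Y^m)=\{\boldsymbol u\in L^2_\sharp(Y^m;\mathbb{R}^3):\mathrm{curl}_{\mathbf R}\,\boldsymbol u\in L^2_\sharp(Y^m;\mathbb{R}^3)\}$. *)

theory Defs
  imports "HOL-Analysis.Analysis"
begin

text \<open>Near every boundary point, in suitable Cartesian coordinates, the set is the
  region strictly above the graph of a Lipschitz function.\<close>

definition lipschitz_boundary :: "(real^3) set \<Rightarrow> bool" where
  "lipschitz_boundary \<Omega> \<longleftrightarrow>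
     (\<forall>p \<in> frontier \<Omega>. \<exists>U L. \<exists>T :: real^3 \<Rightarrow> real^3. \<exists>\<gamma> :: real^2 \<Rightarrow> real.
        open U \<and> p \<in> U \<and> orthogonal_transformation T \<and> L-lipschitz_on UNIV \<gamma> \<and>
        \<Omega> \<inter> U = {x \<in> U. \<gamma> (vector [T x $ 1, T x $ 2]) < T x $ 3})"

text \<open>Elements of \<open>L\<^sup>2\<close> are represented by functions.\<close>

definition L2_on :: "'a::euclidean_space set \<Rightarrow> ('a \<Rightarrow> 'b::euclidean_space) set" where
  "L2_on S = {f \<in> borel_measurable (lebesgue_on S).
                integrable (lebesgue_on S) (\<lambda>x. (norm (f x))\<^sup>2)}"

definition L2_norm :: "'a::euclidean_space set \<Rightarrow> ('a \<Rightarrow> 'b::euclidean_space) \<Rightarrow> real" where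
  "L2_norm S f = sqrt (\<integral>x. (norm (f x))\<^sup>2 \<partial>lebesgue_on S)"

text \<open>The Bochner space \<open>L\<^sup>2(\<Omega>, V)\<close> for a space \<open>V\<close> of functions with (semi)norm \<open>N\<close>:
  strongly measurable maps, i.e. a.e. limits in \<open>V\<close> of simple maps, with square-integrable norm.\<close>

definition L2_Bochner ::
  "'a::euclidean_space set \<Rightarrow> ('b \<Rightarrow> 'c::real_vector) set \<Rightarrow> (('b \<Rightarrow> 'c) \<Rightarrow> real)
    \<Rightarrow> ('a \<Rightarrow> 'b \<Rightarrow> 'c) set" where
  "L2_Bochner \<Omega> V N =
     {u. (AE x in lebesgue_on \<Omega>. u x \<in> V) \<and>
         (\<exists>s. (\<forall>n. simple_function (lebesgue_on \<Omega>) (s n) \<and> s n ` \<Omega> \<subseteq> V) \<and>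
              (AE x in lebesgue_on \<Omega>. (\<lambda>n::nat. N (\<lambda>y. s n x y - u x y)) \<longlonglongrightarrow> 0)) \<and>
         integrable (lebesgue_on \<Omega>) (\<lambda>x. (N (u x))\<^sup>2)}"

definition integer_vec :: "real^'n \<Rightarrow> bool" where
  "integer_vec k \<longleftrightarrow> (\<forall>i. k $ i \<in> \<int>)"

definition Y_cell :: "(real^'m) set" where
  "Y_cell = {y. \<forall>i. 0 < y $ i \<and> y $ i < 1}"

definition Y_periodic :: "(real^'m \<Rightarrow> 'b) \<Rightarrow> bool" where
  "Y_periodic f \<longleftrightarrow> (\<forall>y k. integer_vec k \<longrightarrow> f (y + k) = f y)"

definition C_per :: "(real^'m \<Rightarrow> real) set" where
  "C_per = {f. continuous_on UNIV f \<and> Y_periodic f}"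

definition sup_norm :: "(real^'m \<Rightarrow> real) \<Rightarrow> real" where
  "sup_norm f = (SUP y. \<bar>f y\<bar>)"

text \<open>Periodicity is required everywhere rather than almost everywhere; every class of almost
  everywhere periodic functions has such a representative.\<close>

definition L2_per :: "(real^'m \<Rightarrow> real^3) set" where
  "L2_per = {f \<in> L2_on Y_cell. Y_periodic f}"

definition partial :: "'n \<Rightarrow> (real^'n::finite \<Rightarrow> real^3) \<Rightarrow> real^'n \<Rightarrow> real^3" where
  "partial i f x = frechet_derivative f (at x) (axis i 1)"

primrec iter_partial :: "'n list \<Rightarrow> (real^'n::finite \<Rightarrow> real^3) \<Rightarrow> real^'n \<Rightarrow> real^3" where
  "iter_partial [] f = f"
| "iter_partial (i # is) f = partial i (iter_partial is f)"

text \<open>\<open>C\<^sup>\<infinity>\<close>: all iterated partial derivatives exist and are (totally) differentiable.\<close>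

definition C_infinity :: "(real^'n::finite \<Rightarrow> real^3) \<Rightarrow> bool" where
  "C_infinity f \<longleftrightarrow> (\<forall>is x. iter_partial is f differentiable (at x))"

text \<open>Classical curls: the formal cross products of \<open>\<nabla>\<close>, respectively of
  \<open>R\<^sup>T \<nabla>\<^sub>y\<close> with components \<open>\<Sum>\<^sub>i R\<^sub>i\<^sub>j \<partial>/\<partial>y\<^sub>i\<close>, with the field.\<close>

definition curl :: "(real^3 \<Rightarrow> real^3) \<Rightarrow> real^3 \<Rightarrow> real^3" where
  "curl f x = (\<Sum>j\<in>UNIV. cross3 (axis j 1) (partial j f x))"

definition curl_R :: "real^3^'m \<Rightarrow> (real^'m \<Rightarrow> real^3) \<Rightarrow> real^'m \<Rightarrow> real^3" where
  "curl_R R f y = (\<Sum>j\<in>UNIV. cross3 (axis j 1) (\<Sum>i\<in>UNIV. R $ i $ j *\<^sub>R partial i f y))"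

definition test_fields :: "(real^3) set \<Rightarrow> (real^3 \<Rightarrow> real^3) set" where
  "test_fields \<Omega> = {\<phi>. C_infinity \<phi> \<and> (\<exists>K. compact K \<and> K \<subseteq> \<Omega> \<and> (\<forall>x. x \<notin> K \<longrightarrow> \<phi> x = 0))}"

text \<open>\<open>v \<in> L\<^sup>2\<close> is the curl of \<open>u \<in> L\<^sup>2\<close> in the sense of distributions on \<open>\<Omega>\<close>.
  There is no sign because the curl is formally self-adjoint.\<close>

definition has_weak_curl ::
  "(real^3) set \<Rightarrow> (real^3 \<Rightarrow> real^3) \<Rightarrow> (real^3 \<Rightarrow> real^3) \<Rightarrow> bool" where
  "has_weak_curl \<Omega> u v \<longleftrightarrow> u \<in> L2_on \<Omega> \<and> v \<in> L2_on \<Omega> \<and>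
     (\<forall>\<phi> \<in> test_fields \<Omega>.
        (\<integral>x. v x \<bullet> \<phi> x \<partial>lebesgue_on \<Omega>) = (\<integral>x. u x \<bullet> curl \<phi> x \<partial>lebesgue_on \<Omega>))"

text \<open>Likewise for periodic fields, with periodic test fields (distributions on the torus).\<close>

definition has_weak_curl_R ::
  "real^3^'m \<Rightarrow> (real^'m \<Rightarrow> real^3) \<Rightarrow> (real^'m \<Rightarrow> real^3) \<Rightarrow> bool" where
  "has_weak_curl_R R u w \<longleftrightarrow> u \<in> L2_per \<and> w \<in> L2_per \<and>
     (\<forall>\<psi>. C_infinity \<psi> \<and> Y_periodic \<psi> \<longrightarrow>
        (\<integral>y. w y \<bullet> \<psi> y \<partial>lebesgue_on Y_cell) = (\<integral>y. u y \<bullet> curl_R R \<psi> y \<partial>lebesgue_on Y_cell))"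

definition H_curl_R :: "real^3^'m \<Rightarrow> (real^'m \<Rightarrow> real^3) set" where
  "H_curl_R R = {u. \<exists>w. has_weak_curl_R R u w}"

text \<open>The graph norm. The choice of representative is immaterial, since the weak curl is
  unique up to null sets.\<close>

definition H_curl_R_norm :: "real^3^'m \<Rightarrow> (real^'m \<Rightarrow> real^3) \<Rightarrow> real" where
  "H_curl_R_norm R u =
     sqrt ((L2_norm Y_cell u)\<^sup>2 + (L2_norm Y_cell (SOME w. has_weak_curl_R R u w))\<^sup>2)"

definition weak_two_scale ::
  "(real^3) set \<Rightarrow> real^3^'m \<Rightarrow> (nat \<Rightarrow> real) \<Rightarrow> (nat \<Rightarrow> real^3 \<Rightarrow> real)
    \<Rightarrow> (real^3 \<Rightarrow> real^'m \<Rightarrow> real) \<Rightarrow> bool" where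
  "weak_two_scale \<Omega> R \<eta> u u0 \<longleftrightarrow>
     (\<forall>n. u n \<in> L2_on \<Omega>) \<and> (\<lambda>(x, y). u0 x y) \<in> L2_on (\<Omega> \<times> Y_cell) \<and>
     (\<forall>\<phi> \<in> L2_Bochner \<Omega> C_per sup_norm.
        (\<lambda>n. \<integral>x. u n x * \<phi> x ((1 / \<eta> n) *\<^sub>R (R *v x)) \<partial>lebesgue_on \<Omega>)
          \<longlonglongrightarrow> (\<integral>(x, y). u0 x y * \<phi> x y \<partial>lebesgue_on (\<Omega> \<times> Y_cell)))"

definition weak_two_scale_vec ::
  "(real^3) set \<Rightarrow> real^3^'m \<Rightarrow> (nat \<Rightarrow> real) \<Rightarrow> (nat \<Rightarrow> real^3 \<Rightarrow> real^3)
    \<Rightarrow> (real^3 \<Rightarrow> real^'m \<Rightarrow> real^3) \<Rightarrow> bool" where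
  "weak_two_scale_vec \<Omega> R \<eta> u u0 \<longleftrightarrow>
     (\<forall>i. weak_two_scale \<Omega> R \<eta> (\<lambda>n x. u n x $ i) (\<lambda>x y. u0 x y $ i))"

end

theory Submission
  imports Defs "HOL-Library.Diagonal_Subsequence"
begin

text \<open>The matrix enters only through its frequencies: along \<open>R x / \<eta>\<close> the wave \<open>cos (2 \<pi> k \<bullet> y)\<close>
  oscillates with frequency \<open>2 \<pi> R\<^sup>T k / \<eta>\<close>, which tends to infinity unless \<open>k = 0\<close>. By the
  Riemann-Lebesgue lemma all waves but the constant one average out over any set of finite
  measure. Hence for a function \<open>\<phi> (x, y)\<close> that is a step function in \<open>x\<close> and a trigonometric
  polynomial in \<open>y\<close>, the integral of \<open>\<phi> (x, R x / \<eta>)\<close> over \<open>\<Omega>\<close> tends to the integral of \<open>\<phi>\<close> over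
  the product of \<open>\<Omega>\<close> and the cell (step_waves_average).

  Two-scale compactness is weak compactness seen through these functions. Countably many of them
  span a dense subspace of the test functions, by Stone-Weierstrass on the torus
  (Bochner_test_approx), so a diagonal subsequence makes the integrals of \<open>u\<^sub>\<eta> (x) \<phi> (x, R x / \<eta>)\<close>
  converge on the whole span. By Cauchy-Schwarz the square of the limit functional is at most a
  constant times the limit of the integrals of \<open>\<phi> (x, R x / \<eta>)\<^sup>2\<close>. As \<open>\<phi>\<^sup>2\<close> is a function of the
  same kind, this limit is the squared norm of \<open>\<phi>\<close> on the product. Riesz representation on the
  span, obtained by minimising a quadratic functional, yields the limit \<open>u0\<close>, and density extends
  the convergence to all test functions (two_scale_limit_exists).

  For the curl, test the weak curl of \<open>u\<^sub>\<eta>\<close> with \<open>\<eta> \<theta> (x) \<psi> (R x / \<eta>)\<close>. By the chain rule the curl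
  of this field is \<open>\<theta> curl_R \<psi>\<close> up to a term of order \<open>\<eta>\<close>. So the limits \<open>u0\<close> of \<open>u\<^sub>\<eta>\<close> and \<open>w0\<close> of
  \<open>\<eta> curl u\<^sub>\<eta>\<close> satisfy \<open>\<integral>\<integral> \<theta> w0 \<bullet> \<psi> = \<integral>\<integral> \<theta> u0 \<bullet> curl_R \<psi>\<close> (two_scale_limit_of_curl). When \<open>\<theta>\<close>
  tends to the indicator of an open set, this gives \<open>\<integral> w0 \<bullet> \<psi> = \<integral> u0 \<bullet> curl_R \<psi>\<close> for almost every
  \<open>x\<close>, with an exceptional set that depends on \<open>\<psi>\<close>. But the pairs of \<open>\<psi>\<close> and \<open>curl_R \<psi>\<close> form a
  separable subset of \<open>L\<^sup>2\<close>, so countably many \<open>\<psi>\<close> suffice, and \<open>w0 (x, \<cdot>)\<close> is the weak curl of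
  \<open>u0 (x, \<cdot>)\<close> for almost every \<open>x\<close> (curl_section_AE).

  It remains to see that \<open>u0\<close> is strongly measurable with values in the graph space. The weak curl
  is unique up to null sets, so the graph norm of a field is the \<open>L\<^sup>2\<close> norm of the pair of the
  field and its curl; in this norm the graph space is separable. The nearest among the first
  members of a countable dense sequence then gives simple functions that converge to \<open>u0\<close> almost
  everywhere (periodic_section_Bochner).\<close>

section \<open>Square integrable functions: Cauchy-Schwarz, completeness, Riesz representation\<close>

text \<open>The measure is arbitrary, so that the same lemmas serve the domain, the cell and their product.\<close>

definition square_integrable :: "'a measure \<Rightarrow> ('a \<Rightarrow> 'b::euclidean_space) \<Rightarrow> bool" where
  "square_integrable M f \<longleftrightarrow> f \<in> borel_measurable M \<and> integrable M (\<lambda>x. (norm (f x))\<^sup>2)"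

text \<open>The square of the L2 seminorm. Working with squares keeps the triangle inequality quadratic,
  with a factor 2, which is enough for every density argument below.\<close>

definition energy :: "'a measure \<Rightarrow> ('a \<Rightarrow> 'b::euclidean_space) \<Rightarrow> real" where
  "energy M f = (\<integral>x. (norm (f x))\<^sup>2 \<partial>M)"

lemma square_integrable_measurable: "square_integrable M f \<Longrightarrow> f \<in> borel_measurable M"
  by (simp add: square_integrable_def)

lemma energy_nonneg [simp]: "0 \<le> energy M f"
  by (simp add: energy_def)

lemma power2_norm_add_le: "(norm (x + y))\<^sup>2 \<le> 2 * (norm x)\<^sup>2 + 2 * (norm (y::'b::real_inner))\<^sup>2"
proof -
  have "(norm (x + y))\<^sup>2 + (norm (x - y))\<^sup>2 = 2 * (norm x)\<^sup>2 + 2 * (norm y)\<^sup>2"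
    by (simp add: power2_norm_eq_inner inner_add_left inner_add_right inner_diff_left inner_diff_right inner_commute)
  thus ?thesis using zero_le_power2[of "norm (x - y)"] by linarith
qed

lemma inner_le_squares: "\<bar>x \<bullet> y\<bar> \<le> (norm x)\<^sup>2 + (norm (y::'b::real_inner))\<^sup>2"
proof -
  have "\<bar>x \<bullet> y\<bar> \<le> norm x * norm y" by (rule Cauchy_Schwarz_ineq2)
  moreover have "2 * (norm x * norm y) \<le> (norm x)\<^sup>2 + (norm y)\<^sup>2"
    using sum_squares_bound[of "norm x" "norm y"] by simp
  moreover have "0 \<le> norm x * norm y" by simp
  ultimately show ?thesis by linarith
qed

lemma square_integrable_bound:
  assumes "f \<in> borel_measurable M" "integrable M g" "AE x in M. (norm (f x))\<^sup>2 \<le> g x"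
  shows "square_integrable M f"
  unfolding square_integrable_def
proof
  show "integrable M (\<lambda>x. (norm (f x))\<^sup>2)"
    by (rule Bochner_Integration.integrable_bound[OF assms(2)]) (use assms in \<open>auto elim!: eventually_mono\<close>)
qed (rule assms)

lemma square_integrable_dominated:
  fixes b :: "'a \<Rightarrow> real"
  assumes f: "f \<in> borel_measurable M" and b: "square_integrable M b" and le: "AE x in M. norm (f x) \<le> b x"
  shows "square_integrable M f" "energy M f \<le> energy M b"
proof -
  have ib: "integrable M (\<lambda>x. (norm (b x))\<^sup>2)" using b by (simp add: square_integrable_def)
  have le2: "AE x in M. (norm (f x))\<^sup>2 \<le> (norm (b x))\<^sup>2"
    using le by eventually_elim (intro power_mono, auto)
  show s: "square_integrable M f" by (rule square_integrable_bound[OF f ib le2])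
  show "energy M f \<le> energy M b"
    unfolding energy_def by (rule integral_mono_AE) (use s ib le2 in \<open>auto simp: square_integrable_def\<close>)
qed

lemma square_integrable_add:
  assumes "square_integrable M f" "square_integrable M g"
  shows "square_integrable M (\<lambda>x. f x + g x)"
  by (rule square_integrable_bound[where g="\<lambda>x. 2 * (norm (f x))\<^sup>2 + 2 * (norm (g x))\<^sup>2"])
     (use assms in \<open>auto simp: square_integrable_def intro!: power2_norm_add_le\<close>)

lemma square_integrable_scaleR:
  assumes "square_integrable M f" shows "square_integrable M (\<lambda>x. c *\<^sub>R f x)"
  using assms by (auto simp: square_integrable_def power_mult_distrib)

lemma square_integrable_uminus:
  assumes "square_integrable M f" shows "square_integrable M (\<lambda>x. - f x)"
  using square_integrable_scaleR[OF assms, of "-1"] by simp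

lemma square_integrable_diff:
  assumes "square_integrable M f" "square_integrable M g"
  shows "square_integrable M (\<lambda>x. f x - g x)"
  using square_integrable_add[OF assms(1) square_integrable_uminus[OF assms(2)]] by simp

lemma square_integrable_sum:
  assumes "\<And>i. i \<in> I \<Longrightarrow> square_integrable M (f i)"
  shows "square_integrable M (\<lambda>x. \<Sum>i\<in>I. f i x)"
  using assms
proof (induction I rule: infinite_finite_induct)
  case (insert i I)
  then show ?case by (simp add: square_integrable_add)
qed (auto simp: square_integrable_def)

lemma energy_add_le:
  assumes "square_integrable M f" "square_integrable M g"
  shows "energy M (\<lambda>x. f x + g x) \<le> 2 * energy M f + 2 * energy M g"
proof -
  have "energy M (\<lambda>x. f x + g x) \<le> (\<integral>x. 2 * (norm (f x))\<^sup>2 + 2 * (norm (g x))\<^sup>2 \<partial>M)"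
    unfolding energy_def
    by (rule integral_mono) (use assms square_integrable_add[OF assms] in \<open>auto simp: square_integrable_def intro: power2_norm_add_le\<close>)
  also have "\<dots> = 2 * energy M f + 2 * energy M g"
    unfolding energy_def using assms by (simp add: square_integrable_def)
  finally show ?thesis .
qed

lemma energy_minus_commute: "energy M (\<lambda>x. f x - g x) = energy M (\<lambda>x. g x - f x)"
  by (simp add: energy_def norm_minus_commute)

lemma energy_triangle_le:
  assumes "square_integrable M f" "square_integrable M g" "square_integrable M h"
  shows "energy M (\<lambda>x. f x - h x) \<le> 2 * energy M (\<lambda>x. f x - g x) + 2 * energy M (\<lambda>x. g x - h x)"
  using energy_add_le[OF square_integrable_diff[OF assms(1,2)] square_integrable_diff[OF assms(2,3)]] by simp

lemma integrable_inner:
  assumes "square_integrable M f" "square_integrable M g"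
  shows "integrable M (\<lambda>x. f x \<bullet> g x)"
proof (rule Bochner_Integration.integrable_bound)
  show "integrable M (\<lambda>x. (norm (f x))\<^sup>2 + (norm (g x))\<^sup>2)"
    using assms by (auto simp: square_integrable_def)
  show "(\<lambda>x. f x \<bullet> g x) \<in> borel_measurable M"
    using assms by (auto simp: square_integrable_def)
  show "AE x in M. norm (f x \<bullet> g x) \<le> norm ((norm (f x))\<^sup>2 + (norm (g x))\<^sup>2)"
    using inner_le_squares[of "f _" "g _"] by (intro AE_I2) (simp add: order_trans[OF _ abs_ge_self])
qed

lemma integrable_mult:
  fixes f g :: "'a \<Rightarrow> real"
  assumes "square_integrable M f" "square_integrable M g"
  shows "integrable M (\<lambda>x. f x * g x)"
  using integrable_inner[OF assms] by simp

text \<open>Expanding the square; the quadratic polynomial in t drives both Cauchy-Schwarz and the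
  Euler-Lagrange equation of the Riesz functional.\<close>

lemma energy_add_scaled:
  assumes "square_integrable M f" "square_integrable M g"
  shows "energy M (\<lambda>x. f x + t *\<^sub>R g x) = energy M f + 2 * t * (\<integral>x. f x \<bullet> g x \<partial>M) + t\<^sup>2 * energy M g"
proof -
  have "(norm (f x + t *\<^sub>R g x))\<^sup>2 = (norm (f x))\<^sup>2 + 2 * t * (f x \<bullet> g x) + t\<^sup>2 * (norm (g x))\<^sup>2" for x
    unfolding power2_norm_eq_inner
    by (simp add: inner_add_left inner_add_right inner_commute algebra_simps power2_eq_square)
  hence "energy M (\<lambda>x. f x + t *\<^sub>R g x) = (\<integral>x. (norm (f x))\<^sup>2 + 2 * t * (f x \<bullet> g x) + t\<^sup>2 * (norm (g x))\<^sup>2 \<partial>M)"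
    by (simp add: energy_def)
  also have "\<dots> = energy M f + 2 * t * (\<integral>x. f x \<bullet> g x \<partial>M) + t\<^sup>2 * energy M g"
    using assms integrable_inner[OF assms] by (simp add: energy_def square_integrable_def)
  finally show ?thesis .
qed

text \<open>For c nonzero evaluate at the vertex t = - b / c; for c = 0 the polynomial is affine and can
  only be bounded below if b = 0.\<close>

lemma quadratic_nonneg_imp_discriminant:
  fixes a b c :: real
  assumes "\<And>t. 0 \<le> a + 2 * t * b + t\<^sup>2 * c" "0 \<le> c"
  shows "b\<^sup>2 \<le> a * c"
proof (cases "c = 0")
  case True
  have "b = 0"
  proof (rule ccontr)
    assume "b \<noteq> 0"
    have "0 \<le> a + 2 * (- (\<bar>a\<bar> + 1) / (2 * b)) * b" using assms(1)[of "- (\<bar>a\<bar> + 1) / (2 * b)"] True by simp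
    also have "\<dots> = a - (\<bar>a\<bar> + 1)" using \<open>b \<noteq> 0\<close> by (simp add: field_simps)
    finally show False by simp
  qed
  thus ?thesis using True by simp
next
  case False
  hence c: "c > 0" using assms(2) by simp
  have "0 \<le> a + 2 * (- b / c) * b + (- b / c)\<^sup>2 * c" by (rule assms(1))
  also have "\<dots> = a - b\<^sup>2 / c" using c by (simp add: field_simps power2_eq_square)
  finally show ?thesis using c by (simp add: field_simps)
qed

lemma Cauchy_Schwarz_integral:
  assumes "square_integrable M f" "square_integrable M g"
  shows "(\<integral>x. f x \<bullet> g x \<partial>M)\<^sup>2 \<le> energy M f * energy M g"
proof (rule quadratic_nonneg_imp_discriminant)
  show "0 \<le> energy M f + 2 * t * (\<integral>x. f x \<bullet> g x \<partial>M) + t\<^sup>2 * energy M g" for t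
    using energy_add_scaled[OF assms, of t] by (metis energy_nonneg)
qed simp

lemma Cauchy_Schwarz_integral_real:
  fixes f g :: "'a \<Rightarrow> real"
  assumes "square_integrable M f" "square_integrable M g"
  shows "\<bar>\<integral>x. f x * g x \<partial>M\<bar> \<le> sqrt (energy M f) * sqrt (energy M g)"
proof -
  have "\<bar>\<integral>x. f x * g x \<partial>M\<bar> = sqrt ((\<integral>x. f x \<bullet> g x \<partial>M)\<^sup>2)" by simp
  also have "\<dots> \<le> sqrt (energy M f * energy M g)"
    by (rule real_sqrt_le_mono, rule Cauchy_Schwarz_integral[OF assms])
  finally show ?thesis by (simp add: real_sqrt_mult)
qed

lemma integral_inner_tendsto:
  assumes f: "\<And>n. square_integrable M (f n)" "square_integrable M g" "square_integrable M h"
    and lim: "(\<lambda>n. energy M (\<lambda>x. f n x - g x)) \<longlonglongrightarrow> 0"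
  shows "(\<lambda>n. \<integral>x. f n x \<bullet> h x \<partial>M) \<longlonglongrightarrow> (\<integral>x. g x \<bullet> h x \<partial>M)"
proof -
  have "(\<lambda>n. sqrt (energy M (\<lambda>x. f n x - g x) * energy M h)) \<longlonglongrightarrow> sqrt (0 * energy M h)"
    by (intro tendsto_intros lim)
  hence l0: "(\<lambda>n. sqrt (energy M (\<lambda>x. f n x - g x) * energy M h)) \<longlonglongrightarrow> 0" by simp
  have "norm ((\<integral>x. f n x \<bullet> h x \<partial>M) - (\<integral>x. g x \<bullet> h x \<partial>M)) \<le> sqrt (energy M (\<lambda>x. f n x - g x) * energy M h)" for n
  proof -
    have "(\<integral>x. f n x \<bullet> h x \<partial>M) - (\<integral>x. g x \<bullet> h x \<partial>M) = (\<integral>x. (f n x - g x) \<bullet> h x \<partial>M)"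
      using integrable_inner[OF f(1) f(3)] integrable_inner[OF f(2) f(3)] by (simp add: inner_diff_left)
    moreover have "(\<integral>x. (f n x - g x) \<bullet> h x \<partial>M)\<^sup>2 \<le> energy M (\<lambda>x. f n x - g x) * energy M h"
      by (rule Cauchy_Schwarz_integral[OF square_integrable_diff[OF f(1) f(2)] f(3)])
    ultimately show ?thesis using real_le_rsqrt[of "\<bar>\<integral>x. (f n x - g x) \<bullet> h x \<partial>M\<bar>"] by simp
  qed
  hence "(\<lambda>n. (\<integral>x. f n x \<bullet> h x \<partial>M) - (\<integral>x. g x \<bullet> h x \<partial>M)) \<longlonglongrightarrow> 0"
    by (intro Lim_null_comparison[OF _ l0]) simp
  thus ?thesis by (simp add: LIM_zero_iff)
qed

lemma energy_eq_nn_integral: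
  assumes "square_integrable M f"
  shows "ennreal (energy M f) = (\<integral>\<^sup>+x. ennreal ((norm (f x))\<^sup>2) \<partial>M)"
  using assms unfolding energy_def square_integrable_def
  by (subst nn_integral_eq_integral) auto

lemma square_integrable_of_nn_integral_le:
  assumes "f \<in> borel_measurable M" "(\<integral>\<^sup>+x. ennreal ((norm (f x))\<^sup>2) \<partial>M) \<le> ennreal c" "0 \<le> c"
  shows "square_integrable M f \<and> energy M f \<le> c"
proof -
  have sq: "square_integrable M f"
    unfolding square_integrable_def
  proof
    show "integrable M (\<lambda>x. (norm (f x))\<^sup>2)"
    proof (rule integrableI_bounded)
      show "(\<integral>\<^sup>+x. ennreal (norm ((norm (f x))\<^sup>2)) \<partial>M) < \<infinity>"
        using assms(2) by (auto simp: top_unique intro: le_less_trans)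
    qed (use assms(1) in measurable)
  qed (rule assms)
  moreover have "ennreal (energy M f) \<le> ennreal c"
    using assms(2) energy_eq_nn_integral[OF sq] by simp
  ultimately show ?thesis using assms(3) by (simp add: ennreal_le_iff)
qed

text \<open>Fatou's lemma.\<close>

lemma energy_limit_le:
  fixes f :: "nat \<Rightarrow> 'a \<Rightarrow> 'b::euclidean_space"
  assumes "\<And>n. square_integrable M (f n)" "g \<in> borel_measurable M"
    and "AE x in M. (\<lambda>n. f n x) \<longlonglongrightarrow> g x"
    and "eventually (\<lambda>n. energy M (f n) \<le> c) sequentially" "0 \<le> c"
  shows "square_integrable M g \<and> energy M g \<le> c"
proof (rule square_integrable_of_nn_integral_le)
  have "(\<integral>\<^sup>+x. ennreal ((norm (g x))\<^sup>2) \<partial>M) = (\<integral>\<^sup>+x. liminf (\<lambda>n. ennreal ((norm (f n x))\<^sup>2)) \<partial>M)"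
  proof (rule nn_integral_cong_AE)
    show "AE x in M. ennreal ((norm (g x))\<^sup>2) = liminf (\<lambda>n. ennreal ((norm (f n x))\<^sup>2))"
      using assms(3)
    proof eventually_elim
      case (elim x)
      have "(\<lambda>n. ennreal ((norm (f n x))\<^sup>2)) \<longlonglongrightarrow> ennreal ((norm (g x))\<^sup>2)"
        by (intro tendsto_ennrealI tendsto_intros elim)
      thus ?case using lim_imp_Liminf[OF sequentially_bot] by metis
    qed
  qed
  also have "\<dots> \<le> liminf (\<lambda>n. \<integral>\<^sup>+x. ennreal ((norm (f n x))\<^sup>2) \<partial>M)"
    by (rule nn_integral_liminf) (use assms(1) in \<open>auto simp: square_integrable_def\<close>)
  also have "\<dots> \<le> liminf (\<lambda>n. ennreal c)"
    by (rule Liminf_mono) (use assms(4) in \<open>auto simp: energy_eq_nn_integral[OF assms(1), symmetric] elim!: eventually_mono intro: ennreal_leI\<close>)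
  also have "\<dots> = ennreal c" by (simp add: Liminf_const)
  finally show "(\<integral>\<^sup>+x. ennreal ((norm (g x))\<^sup>2) \<partial>M) \<le> ennreal c" .
qed fact+

text \<open>By monotone convergence the increments, squared and weighted with 2^n, have a finite sum almost
  everywhere, and this makes the increments themselves summable.\<close>

lemma fast_Cauchy_AE_convergent:
  fixes f :: "nat \<Rightarrow> 'a \<Rightarrow> 'b::euclidean_space"
  assumes sq: "\<And>n. square_integrable M (f n)"
    and fast: "\<And>n. energy M (\<lambda>x. f (Suc n) x - f n x) \<le> (1/4)^n"
  shows "AE x in M. convergent (\<lambda>n. f n x)"
proof -
  define d where "d = (\<lambda>n x. (norm (f (Suc n) x - f n x))\<^sup>2)"
  have sqd: "square_integrable M (\<lambda>x. f (Suc n) x - f n x)" for n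
    by (intro square_integrable_diff sq)
  have meas: "(\<lambda>x. ennreal (2^n * d n x)) \<in> borel_measurable M" for n
    using square_integrable_measurable[OF sqd[of n]] by (simp add: d_def)
  have "(\<integral>\<^sup>+x. (\<Sum>n. ennreal (2^n * d n x)) \<partial>M) = (\<Sum>n. \<integral>\<^sup>+x. ennreal (2^n * d n x) \<partial>M)"
    by (rule nn_integral_suminf) (rule meas)
  also have "\<dots> \<le> (\<Sum>n. ennreal ((1/2)^n))"
  proof (rule suminf_le)
    fix n
    have "(\<integral>\<^sup>+x. ennreal (2^n * d n x) \<partial>M) = ennreal (\<integral>x. 2^n * d n x \<partial>M)"
      using sqd[of n] by (intro nn_integral_eq_integral) (auto simp: square_integrable_def d_def)
    also have "(\<integral>x. 2^n * d n x \<partial>M) = 2^n * energy M (\<lambda>x. f (Suc n) x - f n x)"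
      by (simp add: energy_def d_def)
    also have "\<dots> \<le> 2^n * (1/4)^n" using fast by (intro mult_left_mono) auto
    also have "\<dots> = (1/2::real)^n" by (simp add: power_mult_distrib[symmetric])
    finally show "(\<integral>\<^sup>+x. ennreal (2^n * d n x) \<partial>M) \<le> ennreal ((1/2)^n)" by (simp add: ennreal_leI)
  qed auto
  also have "\<dots> = ennreal (\<Sum>n. (1/2)^n)"
    by (rule suminf_ennreal2) (auto intro!: summable_geometric)
  finally have fin: "(\<integral>\<^sup>+x. (\<Sum>n. ennreal (2^n * d n x)) \<partial>M) \<noteq> \<infinity>"
    by (auto simp: top_unique)
  have "AE x in M. (\<Sum>n. ennreal (2^n * d n x)) \<noteq> \<infinity>"
    by (rule nn_integral_PInf_AE[OF _ fin]) (use meas in measurable)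
  thus ?thesis
  proof eventually_elim
    case (elim x)
    have "summable (\<lambda>n. 2^n * d n x)"
      using elim by (intro summable_suminf_not_top) (auto simp: d_def)
    hence s1: "summable (\<lambda>n. (1/2)^n + 2^n * d n x)"
      by (intro summable_add summable_geometric) auto
    have "summable (\<lambda>n. f (Suc n) x - f n x)"
    proof (rule summable_comparison_test'[OF s1])
      fix n :: nat
      \<comment> \<open>2 d \<le> 2^(-n) + 2^n d^2: this replaces Minkowski's inequality\<close>
      have "0 \<le> ((1/2)^n - norm (f (Suc n) x - f n x))\<^sup>2 * 2^n" by simp
      also have "\<dots> = (1/2)^n - 2 * norm (f (Suc n) x - f n x) + 2^n * d n x"
        by (simp add: d_def power2_eq_square algebra_simps power_divide)
      finally have "2 * norm (f (Suc n) x - f n x) \<le> (1/2)^n + 2^n * d n x" by simp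
      thus "norm (f (Suc n) x - f n x) \<le> (1/2)^n + 2^n * d n x" using norm_ge_zero[of "f (Suc n) x - f n x"] by linarith
    qed
    hence "convergent (\<lambda>n. \<Sum>i<n. f (Suc i) x - f i x)" by (simp add: summable_iff_convergent)
    hence "convergent (\<lambda>n. f n x - f 0 x)" by (subst (asm) sum_lessThan_telescope)
    hence "convergent (\<lambda>n. (f n x - f 0 x) + f 0 x)" by (intro convergent_add convergent_const)
    thus ?case by simp
  qed
qed

text \<open>A fast subsequence converges almost everywhere; Fatou's lemma then bounds the distance from the
  whole sequence to its pointwise limit.\<close>

theorem square_integrable_complete:
  fixes f :: "nat \<Rightarrow> 'a \<Rightarrow> 'b::euclidean_space"
  assumes sq: "\<And>n. square_integrable M (f n)"
    and Cauchy: "\<And>e. e > 0 \<Longrightarrow> \<exists>N. \<forall>m\<ge>N. \<forall>n\<ge>N. energy M (\<lambda>x. f m x - f n x) \<le> e"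
  obtains g where "square_integrable M g" "(\<lambda>n. energy M (\<lambda>x. f n x - g x)) \<longlonglongrightarrow> 0"
proof -
  have "\<forall>k. \<exists>N. \<forall>m\<ge>N. \<forall>n\<ge>N. energy M (\<lambda>x. f m x - f n x) \<le> (1/4)^k"
    using Cauchy by simp
  then obtain N where N: "\<And>k m n. m \<ge> N k \<Longrightarrow> n \<ge> N k \<Longrightarrow> energy M (\<lambda>x. f m x - f n x) \<le> (1/4)^k"
    by metis
  \<comment> \<open>increasing and above every N k\<close>
  define r where "r k = k + (\<Sum>i\<le>k. N i)" for k
  have rN: "N k \<le> r k" for k
    unfolding r_def by (metis atMost_iff finite_atMost le_add2 member_le_sum order_refl order_trans zero_le)
  have rS: "r k \<le> r (Suc k)" for k unfolding r_def by simp
  have rk: "k \<le> r k" for k unfolding r_def by simp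
  have conv: "AE x in M. convergent (\<lambda>k. f (r k) x)"
    by (rule fast_Cauchy_AE_convergent) (use rN rS in \<open>auto intro!: sq N intro: order_trans\<close>)
  define g where "g x = lim (\<lambda>k. f (r k) x)" for x
  have gm: "g \<in> borel_measurable M"
    unfolding g_def using square_integrable_measurable[OF sq] by (intro borel_measurable_lim_metric)
  have lim: "AE x in M. (\<lambda>k. f (r k) x) \<longlonglongrightarrow> g x"
    using conv by eventually_elim (simp add: g_def convergent_LIMSEQ_iff)
  have key: "square_integrable M (\<lambda>x. f m x - g x) \<and> energy M (\<lambda>x. f m x - g x) \<le> e"
    if e: "e > 0" and m: "\<And>n. n \<ge> L \<Longrightarrow> energy M (\<lambda>x. f m x - f n x) \<le> e" for m L e
  proof (rule energy_limit_le)
    show "square_integrable M (\<lambda>x. f m x - f (r k) x)" for k by (intro square_integrable_diff sq)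
    show "(\<lambda>x. f m x - g x) \<in> borel_measurable M" using gm square_integrable_measurable[OF sq] by measurable
    show "AE x in M. (\<lambda>k. f m x - f (r k) x) \<longlonglongrightarrow> f m x - g x"
      using lim by eventually_elim (intro tendsto_intros)
    show "eventually (\<lambda>k. energy M (\<lambda>x. f m x - f (r k) x) \<le> e) sequentially"
      using eventually_ge_at_top[of L] by eventually_elim (use rk m in \<open>meson order_trans\<close>)
  qed (use e in simp)
  have "square_integrable M (\<lambda>x. f (N 0) x - g x)"
    using key[of 1 "N 0" "N 0"] N[of 0 "N 0"] by simp
  from square_integrable_diff[OF sq[of "N 0"] this] have g: "square_integrable M g" by simp
  have "(\<lambda>n. energy M (\<lambda>x. f n x - g x)) \<longlonglongrightarrow> 0"
  proof (rule LIMSEQ_I)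
    fix e :: real assume "e > 0"
    then obtain L where L: "\<forall>m\<ge>L. \<forall>n\<ge>L. energy M (\<lambda>x. f m x - f n x) \<le> e/2" using Cauchy[of "e/2"] by auto
    show "\<exists>no. \<forall>n\<ge>no. norm (energy M (\<lambda>x. f n x - g x) - 0) < e"
    proof (intro exI[of _ L] allI impI)
      fix n assume "L \<le> n"
      hence "energy M (\<lambda>x. f n x - g x) \<le> e/2" using key[of "e/2" L n] L \<open>e > 0\<close> by auto
      thus "norm (energy M (\<lambda>x. f n x - g x) - 0) < e" using \<open>e > 0\<close> by simp
    qed
  qed
  with g show thesis by (rule that)
qed

text \<open>The quadratic functional energy f - 2 Lambda f is bounded below on V. By the parallelogram law a
  minimising sequence is Cauchy, and its limit g satisfies the Euler-Lagrange equation. The limit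
  need not belong to V, so V can be any span, not only a closed subspace.\<close>

theorem Riesz_on_subspace:
  fixes V :: "('a \<Rightarrow> real) set" and \<Lambda> :: "('a \<Rightarrow> real) \<Rightarrow> real"
  assumes V: "\<And>f. f \<in> V \<Longrightarrow> square_integrable M f" and ne: "V \<noteq> {}"
    and add: "\<And>f g. f \<in> V \<Longrightarrow> g \<in> V \<Longrightarrow> (\<lambda>x. f x + g x) \<in> V"
    and scale: "\<And>f c. f \<in> V \<Longrightarrow> (\<lambda>x. c * f x) \<in> V"
    and Ladd: "\<And>f g. f \<in> V \<Longrightarrow> g \<in> V \<Longrightarrow> \<Lambda> (\<lambda>x. f x + g x) = \<Lambda> f + \<Lambda> g"
    and Lscale: "\<And>f c. f \<in> V \<Longrightarrow> \<Lambda> (\<lambda>x. c * f x) = c * \<Lambda> f"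
    and bound: "\<And>f. f \<in> V \<Longrightarrow> (\<Lambda> f)\<^sup>2 \<le> C * energy M f"
  obtains g where "square_integrable M g" "\<And>f. f \<in> V \<Longrightarrow> \<Lambda> f = (\<integral>x. g x * f x \<partial>M)"
proof -
  define J where "J f = energy M f - 2 * \<Lambda> f" for f
  have lower: "- \<bar>C\<bar> \<le> J f" if "f \<in> V" for f
  proof -
    let ?e = "energy M f"
    have "(\<Lambda> f)\<^sup>2 \<le> \<bar>C\<bar> * ?e"
      using bound[OF that] mult_right_mono[OF abs_ge_self[of C] energy_nonneg[of M f]] by linarith
    moreover have "4 * (\<bar>C\<bar> * ?e) \<le> (\<bar>C\<bar> + ?e)\<^sup>2"
      using zero_le_power2[of "\<bar>C\<bar> - ?e"] by (simp add: power2_eq_square algebra_simps)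
    ultimately have "(2 * \<Lambda> f)\<^sup>2 \<le> (\<bar>C\<bar> + ?e)\<^sup>2" by (simp add: power_mult_distrib)
    hence "\<bar>2 * \<Lambda> f\<bar> \<le> \<bar>C\<bar> + ?e" by (subst (asm) power2_le_iff_abs_le) simp_all
    thus ?thesis unfolding J_def by linarith
  qed
  define m where "m = Inf (J ` V)"
  have bdd: "bdd_below (J ` V)" using lower by (auto intro!: bdd_belowI)
  have mle: "m \<le> J f" if "f \<in> V" for f unfolding m_def using bdd that by (intro cInf_lower) auto
  have "\<exists>f\<in>V. J f < m + inverse (real (Suc n))" for n
  proof -
    have "m < m + inverse (real (Suc n))" by simp
    thus ?thesis unfolding m_def using cInf_lessD[of "J ` V" "Inf (J ` V) + inverse (real (Suc n))"] ne by auto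
  qed
  then obtain F where F: "\<And>n. F n \<in> V" "\<And>n. J (F n) < m + inverse (real (Suc n))" by metis
  have pert: "J (\<lambda>x. f x + t * h x) = J f + 2 * t * ((\<integral>x. f x * h x \<partial>M) - \<Lambda> h) + t\<^sup>2 * energy M h"
    if "f \<in> V" "h \<in> V" for f h t
    using energy_add_scaled[OF V[OF that(1)] V[OF that(2)], of t] Ladd[OF that(1) scale[OF that(2)], of t] Lscale[OF that(2)]
    by (simp add: J_def algebra_simps)
  \<comment> \<open>the midpoint of f and h has J at least m\<close>
  have par: "energy M (\<lambda>x. f x - h x) \<le> 2 * (J f - m) + 2 * (J h - m)" if "f \<in> V" "h \<in> V" for f h
  proof -
    have d: "(\<lambda>x. h x - f x) \<in> V" using add[OF that(2) scale[OF that(1), of "-1"]] by simp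
    have mid: "(\<lambda>x. f x + (1/2) * (h x - f x)) \<in> V" using add[OF that(1) scale[OF d, of "1/2"]] .
    have "J h = J f + 2 * ((\<integral>x. f x * (h x - f x) \<partial>M) - \<Lambda> (\<lambda>x. h x - f x)) + energy M (\<lambda>x. h x - f x)"
      using pert[OF that(1) d, of 1] by simp
    moreover have "m \<le> J f + ((\<integral>x. f x * (h x - f x) \<partial>M) - \<Lambda> (\<lambda>x. h x - f x)) + (1/4) * energy M (\<lambda>x. h x - f x)"
      using mle[OF mid] pert[OF that(1) d, of "1/2"] by (simp add: power2_eq_square)
    moreover have "energy M (\<lambda>x. f x - h x) = energy M (\<lambda>x. h x - f x)" by (rule energy_minus_commute)
    ultimately show ?thesis by (simp add: algebra_simps)
  qed
  have Cau: "\<exists>N. \<forall>j\<ge>N. \<forall>k\<ge>N. energy M (\<lambda>x. F j x - F k x) \<le> e" if "e > 0" for e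
  proof -
    from \<open>e > 0\<close> obtain N where N: "inverse (real (Suc N)) < e / 4" using reals_Archimedean[of "e/4"] by auto
    have *: "J (F j) - m \<le> e / 4" if "j \<ge> N" for j
    proof -
      have "inverse (real (Suc j)) \<le> inverse (real (Suc N))" using that by (intro le_imp_inverse_le) auto
      thus ?thesis using F(2)[of j] N by linarith
    qed
    show ?thesis
    proof (intro exI[of _ N] allI impI)
      fix j k assume "j \<ge> N" "k \<ge> N"
      have "energy M (\<lambda>x. F j x - F k x) \<le> 2 * (J (F j) - m) + 2 * (J (F k) - m)" by (rule par[OF F(1) F(1)])
      also have "\<dots> \<le> 2 * (e / 4) + 2 * (e / 4)"
        by (intro add_mono mult_left_mono *) (use \<open>j \<ge> N\<close> \<open>k \<ge> N\<close> in auto)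
      finally show "energy M (\<lambda>x. F j x - F k x) \<le> e" by simp
    qed
  qed
  obtain g where g: "square_integrable M g" "(\<lambda>n. energy M (\<lambda>x. F n x - g x)) \<longlonglongrightarrow> 0"
    using square_integrable_complete[of M F] V[OF F(1)] Cau by blast
  have "\<Lambda> h = (\<integral>x. g x * h x \<partial>M)" if h: "h \<in> V" for h
  proof -
    define a where "a n = (\<integral>x. F n x * h x \<partial>M) - \<Lambda> h" for n
    define b where "b = (\<integral>x. g x * h x \<partial>M) - \<Lambda> h"
    have ab: "a \<longlonglongrightarrow> b"
      unfolding a_def b_def using integral_inner_tendsto[OF V[OF F(1)] g(1) V[OF h] g(2)]
      by (intro tendsto_intros) simp
    \<comment> \<open>no perturbation of F n lowers J below m\<close>
    have "0 \<le> 0 + 2 * t * b + t\<^sup>2 * energy M h" for t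
    proof (rule LIMSEQ_le_const)
      show "(\<lambda>n. inverse (real (Suc n)) + 2 * t * a n + t\<^sup>2 * energy M h) \<longlonglongrightarrow> 0 + 2 * t * b + t\<^sup>2 * energy M h"
        by (intro tendsto_intros ab LIMSEQ_inverse_real_of_nat)
      have "0 \<le> inverse (real (Suc n)) + 2 * t * a n + t\<^sup>2 * energy M h" for n
        using mle[OF add[OF F(1) scale[OF h, of t]], of n] pert[OF F(1) h, of n t] F(2)[of n] unfolding a_def by simp
      thus "\<exists>N. \<forall>n\<ge>N. 0 \<le> inverse (real (Suc n)) + 2 * t * a n + t\<^sup>2 * energy M h" by blast
    qed
    hence "b\<^sup>2 \<le> 0 * energy M h" by (rule quadratic_nonneg_imp_discriminant) simp
    thus ?thesis unfolding b_def by simp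
  qed
  with g(1) show thesis by (rule that)
qed

section \<open>Approximation by open sets and separability of square integrable functions\<close>

lemma sets_lebesgue_on_iff: "S \<in> sets lebesgue \<Longrightarrow> A \<in> sets (lebesgue_on S) \<longleftrightarrow> A \<in> sets lebesgue \<and> A \<subseteq> S"
  by (subst sets_restrict_space_iff) auto

lemma integral_lebesgue_on:
  fixes f :: "'a::euclidean_space \<Rightarrow> real"
  assumes "S \<in> sets lebesgue"
  shows "(\<integral>x. f x \<partial>lebesgue_on S) = (\<integral>x. indicator S x * f x \<partial>lebesgue)"
  using assms by (simp add: integral_restrict_space)

text \<open>Finite unions of members of a countable basis: outer regularity reduces a measurable set to an
  open set, and an open set of finite measure is exhausted by such unions.\<close>

lemma countable_approximating_family:
  obtains \<B> :: "'a::euclidean_space set set" where "countable \<B>"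
    "\<And>B. B \<in> \<B> \<Longrightarrow> open B"
    "\<And>A e. A \<in> lmeasurable \<Longrightarrow> e > 0 \<Longrightarrow>
       \<exists>B\<in>\<B>. (A - B) \<union> (B - A) \<in> lmeasurable \<and> measure lebesgue ((A - B) \<union> (B - A)) < e"
proof -
  obtain \<C> :: "'a set set" where \<C>: "countable \<C>" "topological_basis \<C>"
    using ex_countable_basis by blast
  define \<B> where "\<B> = Union ` {F. finite F \<and> F \<subseteq> \<C>}"
  have cB: "countable \<B>" unfolding \<B>_def
    using countable_Collect_finite_subset[OF \<C>(1)] by (intro countable_image) (simp add: conj_commute)
  have oB: "open B" if "B \<in> \<B>" for B
    using that topological_basis_open[OF \<C>(2)] unfolding \<B>_def by auto
  have "\<exists>B\<in>\<B>. (A - B) \<union> (B - A) \<in> lmeasurable \<and> measure lebesgue ((A - B) \<union> (B - A)) < e"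
    if A: "A \<in> lmeasurable" and e: "e > 0" for A e
  proof -
    obtain T where T: "open T" "A \<subseteq> T" "T - A \<in> lmeasurable" "emeasure lebesgue (T - A) < ennreal (e/2)"
      using sets_lebesgue_outer_open[of A "e/2"] A e by auto
    have TA: "measure lebesgue (T - A) < e/2"
      using T(3,4) e by (simp add: emeasure_eq_measure2 ennreal_less_iff)
    have Tm: "T \<in> lmeasurable" using T(2,3) A by (meson fmeasurable_Diff_D)
    obtain \<C>' where C': "\<C>' \<subseteq> \<C>" "\<Union>\<C>' = T"
      using \<C>(2) T(1) unfolding topological_basis_def by blast
    define F where "F = from_nat_into (insert {} \<C>')"
    have ctb: "countable (insert {} \<C>')" using C'(1) \<C>(1) by (simp add: countable_subset)
    have rF: "range F = insert {} \<C>'" unfolding F_def by (rule range_from_nat_into) (use ctb in auto)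
    \<comment> \<open>the empty set, added so that the enumeration is never vacuous, need not be in the basis\<close>
    define Bn where "Bn n = \<Union>((F ` {..<n}) - {{}})" for n :: nat
    have BnB: "Bn n \<in> \<B>" for n
      unfolding \<B>_def Bn_def using rF C'(1) by (intro imageI) auto
    have UBn: "(\<Union>n. Bn n) = T"
    proof -
      have "(\<Union>n. Bn n) = \<Union>(range F)" unfolding Bn_def by auto
      thus ?thesis using rF C'(2) by auto
    qed
    have "(\<lambda>n. measure lebesgue (Bn n)) \<longlonglongrightarrow> measure lebesgue (\<Union>n. Bn n)"
    proof (rule Lim_measure_incseq)
      show "range Bn \<subseteq> sets lebesgue" using oB[OF BnB] by auto
      show "incseq Bn" unfolding Bn_def incseq_def by (intro allI impI Union_mono) auto
      show "emeasure lebesgue (\<Union>n. Bn n) \<noteq> \<infinity>" using Tm unfolding UBn by (auto simp: fmeasurable_def)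
    qed
    hence "\<exists>n. \<bar>measure lebesgue (Bn n) - measure lebesgue T\<bar> < e/2"
      using LIMSEQ_D[of "\<lambda>n. measure lebesgue (Bn n)" _ "e/2"] e unfolding UBn real_norm_def by (meson half_gt_zero order_refl)
    then obtain n where n: "\<bar>measure lebesgue (Bn n) - measure lebesgue T\<bar> < e/2" ..
    have sub: "Bn n \<subseteq> T" using UBn by auto
    have Bm: "Bn n \<in> lmeasurable" by (rule fmeasurableI2[OF Tm sub]) (use oB[OF BnB] in auto)
    have TB: "measure lebesgue (T - Bn n) < e/2"
      using measurable_measure_Diff[OF Tm _ sub] Bm n measure_mono_fmeasurable[OF sub _ Tm] by (auto simp: fmeasurable_def)
    have m1: "(A - Bn n) \<union> (Bn n - A) \<in> lmeasurable" using A Bm by (auto intro!: fmeasurable.Un fmeasurable_Diff)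
    have "measure lebesgue ((A - Bn n) \<union> (Bn n - A)) \<le> measure lebesgue ((T - A) \<union> (T - Bn n))"
      by (rule measure_mono_fmeasurable) (use T(2,3) sub m1 Tm Bm in \<open>auto intro!: fmeasurable.Un fmeasurable_Diff\<close>)
    also have "\<dots> \<le> measure lebesgue (T - A) + measure lebesgue (T - Bn n)"
      by (rule measure_Un_le) (use T Tm Bm in \<open>auto\<close>)
    also have "\<dots> < e" using TA TB by simp
    finally show ?thesis using BnB m1 by blast
  qed
  with cB oB show thesis using that by blast
qed

lemma energy_indicator:
  assumes "S \<in> sets lebesgue" "A \<in> lmeasurable"
  shows "energy (lebesgue_on S) (\<lambda>x. c * indicator A x :: real) \<le> c\<^sup>2 * measure lebesgue A"
    and "square_integrable (lebesgue_on S) (\<lambda>x. c * indicator A x :: real)"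
proof -
  have m: "S \<inter> A \<in> lmeasurable" using assms by (simp add: fmeasurable_Int_fmeasurable inf_commute)
  have eq: "indicator S x * (norm (c * indicator A x :: real))\<^sup>2 = c\<^sup>2 * indicator (S \<inter> A) x" for x
    by (auto simp: indicator_def)
  have "energy (lebesgue_on S) (\<lambda>x. c * indicator A x :: real) = c\<^sup>2 * measure lebesgue (S \<inter> A)"
    unfolding energy_def integral_lebesgue_on[OF assms(1)] eq using m by simp
  also have "\<dots> \<le> c\<^sup>2 * measure lebesgue A"
    by (intro mult_left_mono measure_mono_fmeasurable) (use assms m in auto)
  finally show "energy (lebesgue_on S) (\<lambda>x. c * indicator A x :: real) \<le> c\<^sup>2 * measure lebesgue A" .
  show "square_integrable (lebesgue_on S) (\<lambda>x. c * indicator A x :: real)"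
    unfolding square_integrable_def
  proof
    have "A \<in> sets lebesgue" using assms(2) by auto
    hence "(\<lambda>x. c * indicator A x :: real) \<in> borel_measurable lebesgue"
      by (intro borel_measurable_times borel_measurable_indicator) auto
    thus "(\<lambda>x. c * indicator A x :: real) \<in> borel_measurable (lebesgue_on S)"
      by (rule measurable_restrict_space1)
    show "integrable (lebesgue_on S) (\<lambda>x. (norm (c * indicator A x :: real))\<^sup>2)"
    proof (subst integrable_restrict_space)
      show "integrable lebesgue (\<lambda>x. indicator S x *\<^sub>R (norm (c * indicator A x :: real))\<^sup>2)"
        unfolding real_scaleR_def eq using m by (simp add: lmeasurable_iff_integrable)
    qed (use assms(1) in simp)
  qed
qed

text \<open>The simple approximations of f are pointwise bounded by twice the norm of f, so dominated
  convergence applies.\<close>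

lemma square_integrable_simple_approx:
  fixes f :: "'a \<Rightarrow> 'b::euclidean_space"
  assumes f: "square_integrable M f" and e: "e > 0"
  obtains s where "simple_function M s" "square_integrable M s" "energy M (\<lambda>x. f x - s x) < e"
proof -
  have fm[measurable]: "f \<in> borel_measurable M" using f by (simp add: square_integrable_def)
  obtain F where F: "\<And>i. simple_function M (F i)" "\<And>x. x \<in> space M \<Longrightarrow> (\<lambda>i. F i x) \<longlonglongrightarrow> f x"
    "\<And>i x. x \<in> space M \<Longrightarrow> norm (F i x) \<le> 2 * norm (f x)"
    using borel_measurable_implies_sequence_metric[OF fm, of 0] unfolding dist_0_norm dist_norm diff_zero by blast
  have Fm[measurable]: "F i \<in> borel_measurable M" for i using F(1) by (rule borel_measurable_simple_function)
  have intf: "integrable M (\<lambda>x. (norm (f x))\<^sup>2)" using f by (simp add: square_integrable_def)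
  have "(\<lambda>i. energy M (\<lambda>x. f x - F i x)) \<longlonglongrightarrow> (\<integral>x. 0 \<partial>M)"
    unfolding energy_def
  proof (rule integral_dominated_convergence)
    show "integrable M (\<lambda>x. 9 * (norm (f x))\<^sup>2)" using intf by simp
    show "AE x in M. (\<lambda>i. (norm (f x - F i x))\<^sup>2) \<longlonglongrightarrow> 0"
    proof (rule AE_I2)
      fix x assume "x \<in> space M"
      have "(\<lambda>i. (norm (f x - F i x))\<^sup>2) \<longlonglongrightarrow> (norm (f x - f x))\<^sup>2"
        by (intro tendsto_intros F(2)) fact
      thus "(\<lambda>i. (norm (f x - F i x))\<^sup>2) \<longlonglongrightarrow> 0" by simp
    qed
    show "AE x in M. norm ((norm (f x - F i x))\<^sup>2) \<le> 9 * (norm (f x))\<^sup>2" for i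
    proof (rule AE_I2)
      fix x assume "x \<in> space M"
      hence "norm (f x - F i x) \<le> 3 * norm (f x)" using F(3)[of x i] norm_triangle_ineq4[of "f x" "F i x"] by linarith
      hence "(norm (f x - F i x))\<^sup>2 \<le> (3 * norm (f x))\<^sup>2" by (intro power_mono) auto
      thus "norm ((norm (f x - F i x))\<^sup>2) \<le> 9 * (norm (f x))\<^sup>2" by (simp add: power_mult_distrib)
    qed
  qed auto
  hence "(\<lambda>i. energy M (\<lambda>x. f x - F i x)) \<longlonglongrightarrow> 0" by simp
  from order_tendstoD(2)[OF this e] obtain i where i: "energy M (\<lambda>x. f x - F i x) < e"
    by (auto simp: eventually_sequentially)
  have "square_integrable M (F i)"
  proof (rule square_integrable_bound[OF Fm])
    show "integrable M (\<lambda>x. 4 * (norm (f x))\<^sup>2)" using intf by simp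
    show "AE x in M. (norm (F i x))\<^sup>2 \<le> 4 * (norm (f x))\<^sup>2"
    proof (rule AE_I2)
      fix x assume "x \<in> space M"
      hence "(norm (F i x))\<^sup>2 \<le> (2 * norm (f x))\<^sup>2" using F(3) by (intro power_mono) auto
      thus "(norm (F i x))\<^sup>2 \<le> 4 * (norm (f x))\<^sup>2" by (simp add: power_mult_distrib)
    qed
  qed
  with F(1) i show thesis using that by blast
qed

lemma energy_scaleR_basis:
  assumes "b \<in> Basis" shows "energy M (\<lambda>x. f x *\<^sub>R b) = energy M f" 
  using assms by (simp add: energy_def)

lemma energy_cong: "(\<And>x. x \<in> space M \<Longrightarrow> f x = g x) \<Longrightarrow> energy M f = energy M g"
  unfolding energy_def by (rule Bochner_Integration.integral_cong) auto

lemma square_integrable_cong: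
  assumes "\<And>x. x \<in> space M \<Longrightarrow> f x = g x" "square_integrable M f" shows "square_integrable M g"
proof -
  have "f \<in> borel_measurable M \<longleftrightarrow> g \<in> borel_measurable M" by (rule measurable_cong) fact
  moreover have "integrable M (\<lambda>x. (norm (f x))\<^sup>2) \<longleftrightarrow> integrable M (\<lambda>x. (norm (g x))\<^sup>2)"
    by (rule Bochner_Integration.integrable_cong) (use assms in auto)
  ultimately show ?thesis using assms(2) by (simp add: square_integrable_def)
qed

lemma square_integrable_scaleR_const:
  fixes f :: "'a \<Rightarrow> real"
  assumes f: "square_integrable M f" shows "square_integrable M (\<lambda>x. f x *\<^sub>R b)"
  unfolding square_integrable_def
proof
  show "(\<lambda>x. f x *\<^sub>R b) \<in> borel_measurable M"
    using square_integrable_measurable[OF f] by (intro borel_measurable_scaleR borel_measurable_const)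
  show "integrable M (\<lambda>x. (norm (f x *\<^sub>R b))\<^sup>2)"
    using f by (simp add: square_integrable_def power_mult_distrib)
qed

text \<open>The members of Q are finite sums of vectors of the basis with rational coefficients, restricted
  to sets from a countable approximating family. The functions that Q approximates are closed
  under addition and contain multiples of indicators, hence all simple functions.\<close>

lemma L2_countable_dense:
  assumes S: "S \<in> lmeasurable"
  obtains Q :: "('a::euclidean_space \<Rightarrow> 'b::euclidean_space) set" where "countable Q"
    "\<And>g. g \<in> Q \<Longrightarrow> square_integrable (lebesgue_on S) g"
    "\<And>f e. square_integrable (lebesgue_on S) f \<Longrightarrow> e > 0 \<Longrightarrow> \<exists>g\<in>Q. energy (lebesgue_on S) (\<lambda>x. f x - g x) < e"
proof -
  let ?M = "lebesgue_on S"
  have SL: "S \<in> sets lebesgue" using S by auto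
  obtain \<B> :: "'a set set" where B: "countable \<B>" "\<And>B. B \<in> \<B> \<Longrightarrow> open B"
    "\<And>A e. A \<in> lmeasurable \<Longrightarrow> e > 0 \<Longrightarrow>
       \<exists>B\<in>\<B>. (A - B) \<union> (B - A) \<in> lmeasurable \<and> measure lebesgue ((A - B) \<union> (B - A)) < e"
    using countable_approximating_family by blast
  define piece :: "rat \<times> 'a set \<times> 'b \<Rightarrow> 'a \<Rightarrow> 'b"
    where "piece = (\<lambda>(c, B, b) x. (of_rat c * indicator (B \<inter> S) x) *\<^sub>R b)"
  define P where "P l x = sum_list (map (\<lambda>t. piece t x) l)" for l x
  define Q where "Q = P ` lists (UNIV \<times> \<B> \<times> Basis)"
  have cQ: "countable Q" unfolding Q_def using B(1)
    by (intro countable_image countable_lists countable_SIGMA) (auto intro: countable_finite)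
  have Qadd: "(\<lambda>x. f x + g x) \<in> Q" if fg: "f \<in> Q" "g \<in> Q" for f g
  proof -
    obtain l1 where l1: "l1 \<in> lists (UNIV \<times> \<B> \<times> Basis)" "f = P l1" using fg(1) unfolding Q_def by blast
    obtain l2 where l2: "l2 \<in> lists (UNIV \<times> \<B> \<times> Basis)" "g = P l2" using fg(2) unfolding Q_def by blast
    have "(\<lambda>x. f x + g x) = P (l1 @ l2)" unfolding l1(2) l2(2) by (rule ext) (simp add: P_def)
    moreover have "l1 @ l2 \<in> lists (UNIV \<times> \<B> \<times> Basis)" using l1(1) l2(1) by (simp only: append_in_lists_conv)
    ultimately show ?thesis unfolding Q_def by blast
  qed
  have Q0: "(\<lambda>x. 0) \<in> Q"
    unfolding Q_def by (rule image_eqI[where x="[]"]) (auto simp: P_def)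
  have BS: "B \<inter> S \<in> lmeasurable" if "B \<in> \<B>" for B
    by (subst Int_commute, rule fmeasurable_Int_fmeasurable[OF S]) (use B(2)[OF that] in auto)
  have piece_sq: "square_integrable ?M (piece t)" if t: "t \<in> UNIV \<times> \<B> \<times> Basis" for t
  proof -
    obtain c B b where tt: "t = (c,B,b)" "B \<in> \<B>" "b \<in> Basis" using t by auto
    have "square_integrable ?M (\<lambda>x. of_rat c * indicator (B \<inter> S) x :: real)"
      using energy_indicator(2)[OF SL BS[OF tt(2)]] .
    moreover have "piece t = (\<lambda>x. (of_rat c * indicator (B \<inter> S) x) *\<^sub>R b)"
      unfolding tt(1) piece_def by simp
    ultimately show ?thesis by (simp only: square_integrable_scaleR_const)
  qed
  have Qsq: "square_integrable ?M g" if gQ: "g \<in> Q" for g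
  proof -
    obtain l where l: "l \<in> lists (UNIV \<times> \<B> \<times> Basis)" "g = P l" using gQ unfolding Q_def by auto
    have "square_integrable ?M (P l)" using l(1)
    proof (induction l)
      case Nil then show ?case by (simp add: P_def square_integrable_def)
    next
      case (Cons a l)
      have "P (a # l) = (\<lambda>x. piece a x + P l x)" by (rule ext) (simp add: P_def)
      then show ?case using square_integrable_add[OF piece_sq[of a] Cons.IH] Cons.hyps by simp
    qed
    with l show ?thesis by simp
  qed
  define Cl where "Cl = {f. square_integrable ?M f \<and> (\<forall>e>0. \<exists>g\<in>Q. energy ?M (\<lambda>x. f x - g x) < e)}"
  have Cl_add: "(\<lambda>x. f x + g x) \<in> Cl" if fg: "f \<in> Cl" "g \<in> Cl" for f g
  proof -
    have sq: "square_integrable ?M f" "square_integrable ?M g" using fg by (auto simp: Cl_def)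
    have "\<exists>h\<in>Q. energy ?M (\<lambda>x. f x + g x - h x) < e" if e: "e > 0" for e
    proof -
      have e4: "e/4 > 0" using e by simp
      obtain h1 where h1: "h1 \<in> Q" "energy ?M (\<lambda>x. f x - h1 x) < e/4"
        using fg(1) e4 unfolding Cl_def by blast
      obtain h2 where h2: "h2 \<in> Q" "energy ?M (\<lambda>x. g x - h2 x) < e/4"
        using fg(2) e4 unfolding Cl_def by blast
      note h = h1 h2
      have "energy ?M (\<lambda>x. (f x - h1 x) + (g x - h2 x)) \<le> 2 * energy ?M (\<lambda>x. f x - h1 x) + 2 * energy ?M (\<lambda>x. g x - h2 x)"
        by (intro energy_add_le square_integrable_diff sq Qsq h)
      hence "energy ?M (\<lambda>x. f x + g x - (h1 x + h2 x)) < e" using h by (simp add: algebra_simps)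
      thus ?thesis using Qadd[OF h(1,3)] by (rule bexI)
    qed
    thus ?thesis unfolding Cl_def using square_integrable_add[OF sq] by blast
  qed
  have Cl0: "(\<lambda>x. 0) \<in> Cl" unfolding Cl_def
  proof (intro CollectI conjI allI impI)
    fix e :: real assume "e > 0"
    thus "\<exists>g\<in>Q. energy ?M (\<lambda>x. 0 - g x) < e" using Q0 by (auto simp: energy_def intro!: bexI[of _ "\<lambda>x. 0"])
  qed (simp add: square_integrable_def)
  have Cl_sum: "(\<lambda>x. \<Sum>i\<in>I. f i x) \<in> Cl" if "finite I" "\<And>i. i \<in> I \<Longrightarrow> f i \<in> Cl" for I :: "'b set" and f
    using that by (induction I rule: finite_induct) (auto simp: Cl0 Cl_add)
  have Cl_base: "(\<lambda>x. (c * indicator A x) *\<^sub>R b) \<in> Cl"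
    if A: "A \<in> sets ?M" and b: "b \<in> Basis" for A b and c :: real
  proof -
    have AS: "A \<subseteq> S" "A \<in> lmeasurable"
      using A S SL by (auto simp: sets_lebesgue_on_iff intro: fmeasurableI2)
    have sqA: "square_integrable ?M (\<lambda>x. c * indicator A x)" by (rule energy_indicator(2)[OF SL AS(2)])
    have "\<exists>g\<in>Q. energy ?M (\<lambda>x. (c * indicator A x) *\<^sub>R b - g x) < e" if e: "e > 0" for e
    proof -
      let ?mS = "measure lebesgue S"
      define d where "d = min 1 (e / (4 * (?mS + 1)))"
      have mS: "0 \<le> ?mS" by simp
      hence "4 * (?mS + 1) > 0" by (intro mult_pos_pos add_nonneg_pos) auto
      hence d: "d > 0" using e unfolding d_def by (simp only: min_less_iff_conj divide_pos_pos zero_less_one simp_thms)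
      have "c - d < c + d" using d by simp
      then obtain q where "c - d < of_rat q" "of_rat q < c + d" using of_rat_dense by blast
      hence q: "\<bar>c - of_rat q\<bar> < d" by (simp add: abs_less_iff)
      have q2: "(c - of_rat q)\<^sup>2 \<le> d"
      proof -
        have "(c - of_rat q)\<^sup>2 \<le> d\<^sup>2" using power_mono[of "\<bar>c - of_rat q\<bar>" d 2] q by simp
        also have "\<dots> \<le> d * 1" unfolding power2_eq_square using d by (intro mult_left_mono) (auto simp: d_def)
        finally show ?thesis by simp
      qed
      have "4 * (c\<^sup>2 + 1) > 0" by (simp add: add_nonneg_pos)
      hence "e / (4 * (c\<^sup>2 + 1)) > 0" using e by (rule divide_pos_pos[rotated])
      then obtain B where Bb: "B \<in> \<B>" "(A - B) \<union> (B - A) \<in> lmeasurable"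
        "measure lebesgue ((A - B) \<union> (B - A)) < e / (4 * (c\<^sup>2 + 1))"
        using B(3)[OF AS(2)] by blast
      let ?D = "((A - B) \<union> (B - A)) \<inter> S"
      have Dm: "?D \<in> lmeasurable" using Bb(2) SL by (rule fmeasurable_Int_fmeasurable)
      define s where "s x = (indicator A x - indicator (B \<inter> S) x :: real)" for x
      have sq1: "square_integrable ?M (\<lambda>x. (c - of_rat q) * indicator (B \<inter> S) x :: real)"
        by (rule energy_indicator(2)[OF SL BS[OF Bb(1)]])
      have sq2: "square_integrable ?M (\<lambda>x. c * s x)"
        unfolding s_def right_diff_distrib
        by (intro square_integrable_diff energy_indicator(2)[OF SL] AS BS Bb)
      have e2: "energy ?M (\<lambda>x. c * s x) = energy ?M (\<lambda>x. c * indicator ?D x)"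
        unfolding energy_def using AS(1)
        by (intro Bochner_Integration.integral_cong) (auto simp: s_def indicator_def)
      have "energy ?M (\<lambda>x. (c * indicator A x) *\<^sub>R b - piece (q, B, b) x)
          = energy ?M (\<lambda>x. ((c - of_rat q) * indicator (B \<inter> S) x + c * s x) *\<^sub>R b)"
        unfolding energy_def piece_def s_def by (simp add: algebra_simps)
      also have "\<dots> = energy ?M (\<lambda>x. (c - of_rat q) * indicator (B \<inter> S) x + c * s x)"
        by (rule energy_scaleR_basis[OF b])
      also have "\<dots> \<le> 2 * energy ?M (\<lambda>x. (c - of_rat q) * indicator (B \<inter> S) x) + 2 * energy ?M (\<lambda>x. c * s x)"
        by (intro energy_add_le sq1 sq2)
      also have "\<dots> \<le> 2 * ((c - of_rat q)\<^sup>2 * measure lebesgue (B \<inter> S)) + 2 * (c\<^sup>2 * measure lebesgue ?D)"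
        unfolding e2 by (intro add_mono mult_left_mono energy_indicator(1)[OF SL] BS Bb Dm) auto
      also have "\<dots> \<le> 2 * (d * ?mS) + 2 * (c\<^sup>2 * measure lebesgue ((A - B) \<union> (B - A)))"
        by (intro add_mono mult_left_mono mult_mono q2 measure_mono_fmeasurable) (use S Bb Dm BS d in auto)
      also have "\<dots> < e"
      proof -
        have "d * ?mS \<le> (e / (4 * (?mS + 1))) * ?mS" by (intro mult_right_mono) (auto simp: d_def)
        also have "\<dots> = e / 4 * (?mS / (?mS + 1))" by simp
        also have "\<dots> \<le> e / 4 * 1"
        proof (rule mult_left_mono)
          show "?mS / (?mS + 1) \<le> 1" using mS by (subst divide_le_eq_1_pos) linarith+
        qed (use e in simp)
        also have "\<dots> = e / 4" by simp
        finally have 1: "d * ?mS \<le> e / 4" .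
        have "c\<^sup>2 * measure lebesgue ((A - B) \<union> (B - A)) \<le> c\<^sup>2 * (e / (4 * (c\<^sup>2 + 1)))"
          using Bb(3) by (intro mult_left_mono) auto
        also have "\<dots> < e / 4"
        proof -
          have "c\<^sup>2 / (c\<^sup>2 + 1) < 1" by (simp add: add_nonneg_pos)
          hence "e / 4 * (c\<^sup>2 / (c\<^sup>2 + 1)) < e / 4 * 1" using e by (intro mult_strict_left_mono) auto
          thus ?thesis by (simp add: mult_ac)
        qed
        finally show ?thesis using 1 by linarith
      qed
      finally have fin: "energy ?M (\<lambda>x. (c * indicator A x) *\<^sub>R b - piece (q, B, b) x) < e" .
      have "piece (q, B, b) \<in> Q" unfolding Q_def
        by (rule image_eqI[where x="[(q,B,b)]"]) (use Bb b in \<open>auto simp: P_def\<close>)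
      with fin show ?thesis by (rule bexI)
    qed
    moreover have "square_integrable ?M (\<lambda>x. (c * indicator A x) *\<^sub>R b)"
      by (rule square_integrable_scaleR_const[OF sqA])
    ultimately show ?thesis unfolding Cl_def by blast
  qed
  have "\<exists>g\<in>Q. energy ?M (\<lambda>x. f x - g x) < e" if f: "square_integrable ?M f" and e: "e > 0" for f e
  proof -
    obtain s where s: "simple_function ?M s" "square_integrable ?M s" "energy ?M (\<lambda>x. f x - s x) < e/4"
      using square_integrable_simple_approx[OF f, of "e/4"] e by auto
    define h where "h x = (\<Sum>z\<in>s ` space ?M. \<Sum>b\<in>Basis. ((z \<bullet> b) * indicator (s -` {z} \<inter> space ?M) x) *\<^sub>R b)" for x
    have "h \<in> Cl" unfolding h_def
      using simple_functionD[OF s(1)] by (intro Cl_sum Cl_base) auto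
    then obtain g where g: "g \<in> Q" "energy ?M (\<lambda>x. h x - g x) < e/4" using e unfolding Cl_def
      by (auto dest!: spec[of _ "e/4"])
    have sh: "s x = h x" if x: "x \<in> space ?M" for x
    proof -
      have "h x = (\<Sum>z\<in>s ` space ?M. if z = s x then (\<Sum>b\<in>Basis. (z \<bullet> b) *\<^sub>R b) else 0)"
        unfolding h_def by (rule sum.cong) (use x in \<open>auto simp: indicator_def\<close>)
      also have "\<dots> = s x" using simple_functionD(1)[OF s(1)] x by (simp add: euclidean_representation)
      finally show ?thesis by simp
    qed
    have "energy ?M (\<lambda>x. f x - g x) \<le> 2 * energy ?M (\<lambda>x. f x - s x) + 2 * energy ?M (\<lambda>x. s x - g x)"
      by (intro energy_triangle_le f s Qsq g)
    moreover have "energy ?M (\<lambda>x. s x - g x) = energy ?M (\<lambda>x. h x - g x)"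
      by (rule energy_cong) (simp add: sh)
    ultimately show ?thesis using s(3) g by (intro bexI[of _ g]) auto
  qed
  with cQ Qsq show thesis using that by blast
qed

text \<open>A subset of a separable metric space is separable: for each g in a dense set Q and each n pick a
  member of X within distance 1 / (n + 1) of g, if there is one.\<close>

theorem L2_subset_separable:
  fixes X :: "('a::euclidean_space \<Rightarrow> 'b::euclidean_space) set"
  assumes S: "S \<in> lmeasurable" and X: "\<And>f. f \<in> X \<Longrightarrow> square_integrable (lebesgue_on S) f"
  obtains X0 where "countable X0" "X0 \<subseteq> X"
    "\<And>f e. f \<in> X \<Longrightarrow> e > 0 \<Longrightarrow> \<exists>g\<in>X0. energy (lebesgue_on S) (\<lambda>x. f x - g x) < e"
proof -
  let ?M = "lebesgue_on S"
  obtain Q :: "('a \<Rightarrow> 'b) set" where Q: "countable Q" "\<And>g. g \<in> Q \<Longrightarrow> square_integrable ?M g"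
    "\<And>f e. square_integrable ?M f \<Longrightarrow> e > 0 \<Longrightarrow> \<exists>g\<in>Q. energy ?M (\<lambda>x. f x - g x) < e"
    using L2_countable_dense[OF S] by blast
  define near where "near q n f \<longleftrightarrow> f \<in> X \<and> energy ?M (\<lambda>x. f x - q x) < inverse (real (Suc n))" for q n f
  define X0 where "X0 = (\<lambda>(q,n). SOME f. near q n f) ` {(q,n). q \<in> Q \<and> (\<exists>f. near q n f)}"
  have "countable X0" unfolding X0_def
    by (rule countable_image, rule countable_subset[of _ "Q \<times> UNIV"]) (use Q(1) in auto)
  moreover have "X0 \<subseteq> X"
  proof
    fix g assume "g \<in> X0"
    then obtain q n where "g = (SOME f. near q n f)" "\<exists>f. near q n f" unfolding X0_def by auto
    hence "near q n g" using someI_ex by metis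
    thus "g \<in> X" by (simp add: near_def)
  qed
  moreover have "\<exists>g\<in>X0. energy ?M (\<lambda>x. f x - g x) < e" if f: "f \<in> X" and e: "e > 0" for f e
  proof -
    obtain n where n: "inverse (real (Suc n)) < e/4" using reals_Archimedean[of "e/4"] e by auto
    obtain q where q: "q \<in> Q" "energy ?M (\<lambda>x. f x - q x) < inverse (real (Suc n))"
      using Q(3)[OF X[OF f], of "inverse (real (Suc n))"] by auto
    hence ex: "near q n f" using f by (simp add: near_def)
    define g where "g = (SOME f. near q n f)"
    have g: "near q n g" unfolding g_def by (rule someI[of "near q n", OF ex])
    have "g \<in> X0" unfolding X0_def g_def using q ex by (intro image_eqI[where x="(q,n)"]) auto
    moreover have "energy ?M (\<lambda>x. f x - g x) \<le> 2 * energy ?M (\<lambda>x. f x - q x) + 2 * energy ?M (\<lambda>x. q x - g x)"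
      using g by (intro energy_triangle_le X f Q q) (simp add: near_def)
    moreover have "energy ?M (\<lambda>x. q x - g x) < inverse (real (Suc n))"
      using g energy_minus_commute[of ?M q g] by (simp add: near_def)
    ultimately show ?thesis using q n by (intro bexI[of _ g]) linarith+
  qed
  ultimately show thesis using that by blast
qed

text \<open>A measurable set agrees up to a null set with a decreasing intersection of open sets, so by
  dominated convergence F has integral zero over every measurable set, in particular over the sets
  where it is positive and where it is not.\<close>

lemma zero_on_open_imp_AE_zero:
  fixes F :: "'a::euclidean_space \<Rightarrow> real"
  assumes S: "open S" and F: "integrable (lebesgue_on S) F"
    and zero: "\<And>U. open U \<Longrightarrow> U \<subseteq> S \<Longrightarrow> (\<integral>x. indicator U x * F x \<partial>lebesgue_on S) = 0"
  shows "AE x in lebesgue_on S. F x = 0"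
proof -
  let ?M = "lebesgue_on S"
  have SL: "S \<in> sets lebesgue" using S by auto
  have [measurable]: "F \<in> borel_measurable ?M" using F by auto
  have on_sets: "(\<integral>x. indicator A x * F x \<partial>?M) = 0" if A: "A \<in> sets ?M" for A
  proof -
    have A': "A \<in> sets lebesgue" "A \<subseteq> S" using A SL by (auto simp: sets_lebesgue_on_iff)
    have "\<exists>T. open T \<and> A \<subseteq> T \<and> (T - A) \<in> lmeasurable \<and> emeasure lebesgue (T - A) < ennreal (inverse (real (Suc n)))" for n
    proof -
      have "inverse (real (Suc n)) > 0" by simp
      from sets_lebesgue_outer_open[OF A'(1) this] show ?thesis by metis
    qed
    then obtain T where T: "\<And>n. open (T n)" "\<And>n. A \<subseteq> T n" "\<And>n. (T n - A) \<in> lmeasurable"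
       "\<And>n. emeasure lebesgue (T n - A) < ennreal (inverse (real (Suc n)))" by metis
    define V where "V n = S \<inter> (\<Inter>i\<le>n. T i)" for n
    have Vo: "open (V n)" "V n \<subseteq> S" for n unfolding V_def using S T(1) by auto
    define G where "G = (\<Inter>n. V n)"
    have GL: "G \<in> sets lebesgue" unfolding G_def using Vo by auto
    have "emeasure lebesgue (G - A) \<le> 0"
    proof (rule ennreal_le_epsilon)
      fix e :: real assume "e > 0"
      then obtain n where n: "inverse (real (Suc n)) < e" using reals_Archimedean by auto
      have "emeasure lebesgue (G - A) \<le> emeasure lebesgue (T n - A)"
        using T(3)[of n] by (intro emeasure_mono) (auto simp: G_def V_def)
      also have "\<dots> \<le> ennreal e" using T(4)[of n] n
        by (metis ennreal_leI less_le order_trans)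
      finally show "emeasure lebesgue (G - A) \<le> 0 + ennreal e" by simp
    qed
    hence "G - A \<in> null_sets lebesgue" using GL A' by (auto simp: null_sets_def)
    hence nul: "AE x in lebesgue. x \<notin> G - A" by (rule AE_not_in)
    have AG: "A \<subseteq> G" unfolding G_def V_def using T(2) A'(2) by auto
    have "(\<lambda>n. \<integral>x. indicator (V n) x * F x \<partial>?M) \<longlonglongrightarrow> (\<integral>x. indicator G x * F x \<partial>?M)"
    proof (rule integral_dominated_convergence)
      show "integrable ?M (\<lambda>x. \<bar>F x\<bar>)" using F by simp
      have GM: "G \<in> sets ?M" using GL SL Vo(2) unfolding sets_lebesgue_on_iff[OF SL] G_def by auto
      have VM: "V n \<in> sets ?M" for n using Vo SL by (auto simp: sets_lebesgue_on_iff)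
      show "(\<lambda>x. indicator G x * F x) \<in> borel_measurable ?M" using GM by measurable
      show "(\<lambda>x. indicator (V n) x * F x) \<in> borel_measurable ?M" for n using VM[of n] by measurable
      show "AE x in ?M. norm (indicator (V n) x * F x) \<le> \<bar>F x\<bar>" for n by (auto simp: indicator_def)
      have "(\<lambda>n. indicator (V n) x) \<longlonglongrightarrow> (indicator G x :: real)" for x
        unfolding G_def by (rule LIMSEQ_indicator_decseq) (auto simp: V_def decseq_def)
      thus "AE x in ?M. (\<lambda>n. indicator (V n) x * F x) \<longlonglongrightarrow> indicator G x * F x"
        by (intro AE_I2 tendsto_intros)
    qed
    moreover have "(\<integral>x. indicator (V n) x * F x \<partial>?M) = 0" for n by (rule zero[OF Vo])
    ultimately have "(\<lambda>n::nat. 0::real) \<longlonglongrightarrow> (\<integral>x. indicator G x * F x \<partial>?M)" by simp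
    hence "(\<integral>x. indicator G x * F x \<partial>?M) = 0" by (simp add: LIMSEQ_const_iff)
    moreover have "(\<integral>x. indicator A x * F x \<partial>?M) = (\<integral>x. indicator G x * F x \<partial>?M)"
    proof (rule integral_cong_AE)
      show "AE x in ?M. indicator A x * F x = indicator G x * F x"
        using nul AG SL by (subst AE_restrict_space_iff) (auto elim!: eventually_mono simp: indicator_def)
      have "A \<in> sets ?M" "G \<in> sets ?M" using A GL SL Vo(2) unfolding sets_lebesgue_on_iff[OF SL] G_def by auto
      thus "(\<lambda>x. indicator A x * F x) \<in> borel_measurable ?M" "(\<lambda>x. indicator G x * F x) \<in> borel_measurable ?M" by measurable
    qed
    ultimately show ?thesis by simp
  qed
  show ?thesis
  proof -
    let ?P = "{x \<in> space ?M. F x > 0}" and ?N = "{x \<in> space ?M. F x \<le> 0}"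
    have P: "?P \<in> sets ?M" "?N \<in> sets ?M" by measurable
    have "AE x in ?M. indicator ?P x * F x = 0"
    proof (subst integral_nonneg_eq_0_iff_AE[symmetric])
      show "integrable ?M (\<lambda>x. indicator ?P x * F x)" using P F integrable_mult_indicator[OF P(1) F] by simp
      show "AE x in ?M. 0 \<le> indicator ?P x * F x" by (auto simp: indicator_def)
    qed (rule on_sets[OF P(1)])
    moreover have "AE x in ?M. - (indicator ?N x * F x) = 0"
    proof (subst integral_nonneg_eq_0_iff_AE[symmetric])
      show "integrable ?M (\<lambda>x. - (indicator ?N x * F x))" using P F integrable_mult_indicator[OF P(2) F] by simp
      show "AE x in ?M. 0 \<le> - (indicator ?N x * F x)" by (auto simp: indicator_def)
      show "(\<integral>x. - (indicator ?N x * F x) \<partial>?M) = 0" using on_sets[OF P(2)] by simp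
    qed
    moreover have "AE x in ?M. x \<in> space ?M" by (rule AE_space)
    ultimately show ?thesis by eventually_elim (auto simp: indicator_def split: if_splits)
  qed
qed

section \<open>The Riemann-Lebesgue lemma\<close>

lemma integral_translation:
  fixes f :: "'a::euclidean_space \<Rightarrow> real"
  assumes [measurable]: "f \<in> borel_measurable borel"
  shows "(\<integral>x. f (x + h) \<partial>lborel) = (\<integral>x. f x \<partial>lborel)"
proof -
  have "(\<integral>x. f x \<partial>lborel) = (\<integral>x. f x \<partial>distr lborel borel ((+) h))" by (simp add: lborel_distr_plus)
  also have "\<dots> = (\<integral>x. f (h + x) \<partial>lborel)" by (rule integral_distr) auto
  finally show ?thesis by (simp add: add.commute)
qed

text \<open>Translation by half a period h n changes the sign of the cosine, so twice the integral is at
  most the measure of the symmetric difference of U and its translate. For an open set this tends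
  to zero with h n by dominated convergence, because nearby translates of a point of U stay in U.\<close>

lemma Riemann_Lebesgue_open:
  fixes U :: "'a::euclidean_space set" and \<xi> :: "nat \<Rightarrow> 'a"
  assumes U: "open U" "U \<in> lmeasurable" and \<xi>: "filterlim (\<lambda>n. norm (\<xi> n)) at_top sequentially"
  shows "(\<lambda>n. \<integral>x. indicator U x * cos (\<xi> n \<bullet> x + c) \<partial>lebesgue) \<longlonglongrightarrow> 0"
proof -
  \<comment> \<open>half a period\<close>
  define h where "h n = (pi / (norm (\<xi> n))\<^sup>2) *\<^sub>R \<xi> n" for n
  have [measurable]: "U \<in> sets borel" using U(1) by simp
  have Uf: "integrable lborel (indicator U :: 'a \<Rightarrow> real)"
    using U(2) by (simp add: integrable_indicator_iff fmeasurable_def)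
  have Uhf: "integrable lborel (\<lambda>x. indicator U (x + h n) :: real)" for n
  proof -
    have "integrable (distr lborel borel ((+) (h n))) (indicator U :: 'a \<Rightarrow> real)" using Uf by (simp add: lborel_distr_plus)
    hence "integrable lborel (\<lambda>x. indicator U (h n + x) :: real)" by (subst (asm) integrable_distr_eq) auto
    thus ?thesis by (simp add: add.commute)
  qed
  have nz: "eventually (\<lambda>n. norm (\<xi> n) > 0) sequentially"
    using \<xi> unfolding filterlim_at_top_dense by blast
  have h0: "h \<longlonglongrightarrow> 0"
  proof -
    have "(\<lambda>n. inverse (norm (\<xi> n))) \<longlonglongrightarrow> 0" by (rule tendsto_inverse_0_at_top[OF \<xi>])
    hence l: "(\<lambda>n. pi * inverse (norm (\<xi> n))) \<longlonglongrightarrow> 0" using tendsto_mult_right_zero by blast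
    have "eventually (\<lambda>n. norm (h n) \<le> pi * inverse (norm (\<xi> n))) sequentially"
      using nz by eventually_elim (simp add: h_def power2_eq_square field_simps)
    thus ?thesis by (rule Lim_null_comparison[OF _ l])
  qed
  define J where "J n = (\<integral>x. indicator U x * (1 - indicator U (x + h n)) \<partial>lborel :: real)" for n
  have J0: "J \<longlonglongrightarrow> 0"
  proof -
    have "J \<longlonglongrightarrow> (\<integral>x. 0 \<partial>(lborel :: 'a measure))" unfolding J_def
    proof (rule integral_dominated_convergence)
      show "integrable lborel (indicator U :: 'a \<Rightarrow> real)" by (rule Uf)
      show "AE x in lborel. (\<lambda>n. indicator U x * (1 - indicator U (x + h n)) :: real) \<longlonglongrightarrow> 0"
      proof (rule AE_I2)
        fix x :: 'a
        show "(\<lambda>n. indicator U x * (1 - indicator U (x + h n)) :: real) \<longlonglongrightarrow> 0"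
        proof (cases "x \<in> U")
          case True
          have "(\<lambda>n. x + h n) \<longlonglongrightarrow> x" using tendsto_add[OF tendsto_const h0, of x] by simp
          hence "eventually (\<lambda>n. x + h n \<in> U) sequentially" using topological_tendstoD U(1) True by blast
          hence "eventually (\<lambda>n. indicator U x * (1 - indicator U (x + h n)) = (0 :: real)) sequentially"
            by eventually_elim simp
          thus ?thesis by (rule tendsto_eventually)
        qed auto
      qed
    qed (auto simp: indicator_def)
    thus ?thesis by simp
  qed
  have main: "\<bar>\<integral>x. indicator U x * cos (\<xi> n \<bullet> x + c) \<partial>lborel\<bar> \<le> J n" if n: "norm (\<xi> n) > 0" for n
  proof -
    define I where "I = (\<integral>x. indicator U x * cos (\<xi> n \<bullet> x + c) \<partial>lborel)"
    have sh: "\<xi> n \<bullet> h n = pi" using n by (simp add: h_def power2_norm_eq_inner[symmetric])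
    have "I = (\<integral>x. indicator U (x + h n) * cos (\<xi> n \<bullet> (x + h n) + c) \<partial>lborel)"
      unfolding I_def using integral_translation[of "\<lambda>x. indicator U x * cos (\<xi> n \<bullet> x + c)" "h n"] by simp
    also have "\<dots> = (\<integral>x. - (indicator U (x + h n) * cos (\<xi> n \<bullet> x + c)) \<partial>lborel)"
    proof (rule Bochner_Integration.integral_cong)
      fix x
      have "\<xi> n \<bullet> (x + h n) + c = (\<xi> n \<bullet> x + c) + pi" by (simp add: inner_add_right sh)
      thus "indicator U (x + h n) * cos (\<xi> n \<bullet> (x + h n) + c) = - (indicator U (x + h n) * cos (\<xi> n \<bullet> x + c))"
        by (simp only: cos_periodic_pi mult_minus_right)
    qed simp
    finally have I2: "I = (\<integral>x. - (indicator U (x + h n) * cos (\<xi> n \<bullet> x + c)) \<partial>lborel)" .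
    have i1: "integrable lborel (\<lambda>x. indicator U x * cos (\<xi> n \<bullet> x + c))"
      by (rule Bochner_Integration.integrable_bound[OF Uf]) (auto simp: indicator_def)
    have i2: "integrable lborel (\<lambda>x. indicator U (x + h n) * cos (\<xi> n \<bullet> x + c))"
      by (rule Bochner_Integration.integrable_bound[OF Uhf[of n]]) (auto simp: indicator_def)
    have i3: "integrable lborel (\<lambda>x. indicator U x * (1 - indicator U (x + h n)) :: real)"
      by (rule Bochner_Integration.integrable_bound[OF Uf]) (auto simp: indicator_def)
    have "2 * I = (\<integral>x. indicator U x * cos (\<xi> n \<bullet> x + c) - indicator U (x + h n) * cos (\<xi> n \<bullet> x + c) \<partial>lborel)"
      using i1 i2 I2 by (subst Bochner_Integration.integral_diff) (simp_all add: I_def)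
    hence "\<bar>2 * I\<bar> \<le> (\<integral>x. \<bar>indicator U x * cos (\<xi> n \<bullet> x + c) - indicator U (x + h n) * cos (\<xi> n \<bullet> x + c)\<bar> \<partial>lborel)"
      by (simp only: integral_abs_bound)
    also have "\<dots> \<le> (\<integral>x. (indicator U (x + h n) - indicator U x) + 2 * (indicator U x * (1 - indicator U (x + h n))) \<partial>lborel)"
    proof (rule integral_mono)
      show "integrable lborel (\<lambda>x. \<bar>indicator U x * cos (\<xi> n \<bullet> x + c) - indicator U (x + h n) * cos (\<xi> n \<bullet> x + c)\<bar>)"
        using i1 i2 by simp
      show "integrable lborel (\<lambda>x. (indicator U (x + h n) - indicator U x) + 2 * (indicator U x * (1 - indicator U (x + h n))) :: real)"
        using Uf Uhf i3 by (intro Bochner_Integration.integrable_add Bochner_Integration.integrable_diff integrable_mult_right) 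
      \<comment> \<open>\<bar>a - b\<bar> = (b - a) + 2 a (1 - b) for a, b in {0, 1}; the integral of b - a vanishes by
        translation invariance\<close>
      show "\<bar>indicator U x * cos (\<xi> n \<bullet> x + c) - indicator U (x + h n) * cos (\<xi> n \<bullet> x + c)\<bar>
        \<le> (indicator U (x + h n) - indicator U x) + 2 * (indicator U x * (1 - indicator U (x + h n)))" for x
        by (auto simp: indicator_def)
    qed
    also have "\<dots> = 2 * J n"
    proof -
      have "(\<integral>x. indicator U (x + h n) \<partial>lborel) = (\<integral>x. indicator U x \<partial>lborel :: real)"
        by (rule integral_translation) measurable
      thus ?thesis using Uf Uhf i3 by (simp add: J_def)
    qed
    finally show ?thesis by (simp add: I_def)
  qed
  have "(\<lambda>n. \<integral>x. indicator U x * cos (\<xi> n \<bullet> x + c) \<partial>lborel) \<longlonglongrightarrow> 0"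
    by (rule Lim_null_comparison[OF _ J0]) (use nz main in \<open>auto elim!: eventually_mono\<close>)
  moreover have "(\<integral>x. indicator U x * cos (\<xi> n \<bullet> x + c) \<partial>lebesgue) = (\<integral>x. indicator U x * cos (\<xi> n \<bullet> x + c) \<partial>lborel)" for n
    by (rule integral_completion) measurable
  ultimately show ?thesis by simp
qed

lemma integrable_indicator_bounded:
  fixes f :: "'a::euclidean_space \<Rightarrow> real"
  assumes "A \<in> lmeasurable" "f \<in> borel_measurable lebesgue" "\<And>x. \<bar>f x\<bar> \<le> B"
  shows "integrable lebesgue (\<lambda>x. indicator A x * f x)"
    and "\<bar>\<integral>x. indicator A x * f x \<partial>lebesgue\<bar> \<le> B * measure lebesgue A"
proof -
  have A[measurable]: "A \<in> sets lebesgue" using assms(1) by auto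
  note assms(2)[measurable]
  have iA: "integrable lebesgue (\<lambda>x. B * indicator A x)"
    using assms(1) by (simp add: lmeasurable_iff_integrable)
  show i: "integrable lebesgue (\<lambda>x. indicator A x * f x)"
  proof (rule Bochner_Integration.integrable_bound[OF iA])
    show "AE x in lebesgue. norm (indicator A x * f x) \<le> norm (B * indicator A x)"
    proof (rule AE_I2)
      fix x show "norm (indicator A x * f x) \<le> norm (B * indicator A x)"
        using order_trans[OF assms(3)[of x] abs_ge_self] by (simp add: indicator_def)
    qed
  qed measurable
  have "\<bar>\<integral>x. indicator A x * f x \<partial>lebesgue\<bar> \<le> (\<integral>x. \<bar>indicator A x * f x\<bar> \<partial>lebesgue)" by (rule integral_abs_bound)
  also have "\<dots> \<le> (\<integral>x. B * indicator A x \<partial>lebesgue)"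
    by (rule integral_mono) (use i iA assms(3) in \<open>auto simp: indicator_def\<close>)
  also have "\<dots> = B * measure lebesgue A" using assms(1) by simp
  finally show "\<bar>\<integral>x. indicator A x * f x \<partial>lebesgue\<bar> \<le> B * measure lebesgue A" .
qed

text \<open>Outer regularity reduces the statement to open sets, uniformly in the frequency.\<close>

lemma Riemann_Lebesgue:
  fixes A :: "'a::euclidean_space set" and \<xi> :: "nat \<Rightarrow> 'a"
  assumes A: "A \<in> lmeasurable" and \<xi>: "filterlim (\<lambda>n. norm (\<xi> n)) at_top sequentially"
  shows "(\<lambda>n. \<integral>x. indicator A x * cos (\<xi> n \<bullet> x + c) \<partial>lebesgue) \<longlonglongrightarrow> 0"
proof (rule LIMSEQ_I)
  fix e :: real assume e: "e > 0"
  obtain T where T: "open T" "A \<subseteq> T" "T - A \<in> lmeasurable" "emeasure lebesgue (T - A) < ennreal (e/2)"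
    using sets_lebesgue_outer_open[of A "e/2"] A e by auto
  have TA: "measure lebesgue (T - A) < e/2"
    using T(3,4) e by (simp add: emeasure_eq_measure2 ennreal_less_iff)
  have Tm: "T \<in> lmeasurable" using T(2,3) A by (meson fmeasurable_Diff_D)
  have cm: "(\<lambda>x. cos (\<xi> n \<bullet> x + c)) \<in> borel_measurable lebesgue" for n
    by (rule measurable_completion) measurable
  have "eventually (\<lambda>n. \<bar>\<integral>x. indicator T x * cos (\<xi> n \<bullet> x + c) \<partial>lebesgue\<bar> < e/2) sequentially"
    using tendstoD[OF Riemann_Lebesgue_open[OF T(1) Tm \<xi>, of c], of "e/2"] e by (simp add: dist_real_def)
  then obtain N where N: "\<And>n. n \<ge> N \<Longrightarrow> \<bar>\<integral>x. indicator T x * cos (\<xi> n \<bullet> x + c) \<partial>lebesgue\<bar> < e/2"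
    by (auto simp: eventually_sequentially)
  show "\<exists>no. \<forall>n\<ge>no. norm ((\<integral>x. indicator A x * cos (\<xi> n \<bullet> x + c) \<partial>lebesgue) - 0) < e"
  proof (intro exI[of _ N] allI impI)
    fix n assume "n \<ge> N"
    have "(\<integral>x. indicator T x * cos (\<xi> n \<bullet> x + c) \<partial>lebesgue)
        = (\<integral>x. indicator A x * cos (\<xi> n \<bullet> x + c) + indicator (T - A) x * cos (\<xi> n \<bullet> x + c) \<partial>lebesgue)"
      by (rule Bochner_Integration.integral_cong) (use T(2) in \<open>auto simp: indicator_def\<close>)
    also have "\<dots> = (\<integral>x. indicator A x * cos (\<xi> n \<bullet> x + c) \<partial>lebesgue) + (\<integral>x. indicator (T - A) x * cos (\<xi> n \<bullet> x + c) \<partial>lebesgue)"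
      by (rule Bochner_Integration.integral_add) (rule integrable_indicator_bounded(1)[where B=1]; use A T cm in auto)+
    finally have "\<bar>\<integral>x. indicator A x * cos (\<xi> n \<bullet> x + c) \<partial>lebesgue\<bar>
       \<le> \<bar>\<integral>x. indicator T x * cos (\<xi> n \<bullet> x + c) \<partial>lebesgue\<bar> + \<bar>\<integral>x. indicator (T - A) x * cos (\<xi> n \<bullet> x + c) \<partial>lebesgue\<bar>"
      by linarith
    also have "\<dots> < e/2 + e/2"
      using N[OF \<open>n \<ge> N\<close>] integrable_indicator_bounded(2)[OF T(3) cm[of n], of 1] TA by (intro add_strict_mono) auto
    finally show "norm ((\<integral>x. indicator A x * cos (\<xi> n \<bullet> x + c) \<partial>lebesgue) - 0) < e" by simp
  qed
qed

section \<open>The periodicity cell\<close>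

definition frac_vec :: "real^'m \<Rightarrow> real^'m" where "frac_vec y = (\<chi> i. frac (y $ i))"

lemma integer_vec_add: "integer_vec k \<Longrightarrow> integer_vec l \<Longrightarrow> integer_vec (k + l)"
  and integer_vec_diff: "integer_vec k \<Longrightarrow> integer_vec l \<Longrightarrow> integer_vec (k - l)"
  and integer_vec_0: "integer_vec 0"
  and integer_vec_axis: "integer_vec (axis i 1)"
  by (auto simp: integer_vec_def axis_def)

lemma integer_vec_minus: "integer_vec k \<Longrightarrow> integer_vec (- k)"
  by (auto simp: integer_vec_def)

lemma integer_vec_inner: "integer_vec k \<Longrightarrow> integer_vec l \<Longrightarrow> k \<bullet> l \<in> \<int>"
  unfolding integer_vec_def inner_vec_def by (auto intro!: Ints_sum Ints_mult)

lemma frac_vec_diff_integer: "integer_vec (y - frac_vec y)"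
  by (auto simp: integer_vec_def frac_vec_def frac_def)

lemma frac_vec_periodic: "integer_vec k \<Longrightarrow> frac_vec (y + k) = frac_vec y"
proof -
  assume k: "integer_vec k"
  have "frac (y $ i + k $ i) = frac (y $ i)" for i
  proof -
    obtain n where "k $ i = of_int n" using k by (auto simp: integer_vec_def elim: Ints_cases)
    thus ?thesis by (simp add: frac_def)
  qed
  thus ?thesis by (simp add: frac_vec_def)
qed

lemma frac_vec_cell: "y \<in> Y_cell \<Longrightarrow> frac_vec y = y"
  by (auto simp: Y_cell_def frac_vec_def vec_eq_iff frac_eq less_imp_le)

lemma Y_periodic_frac: "Y_periodic f \<Longrightarrow> f (frac_vec y) = f y"
  using frac_vec_diff_integer[of y] unfolding Y_periodic_def by (metis add.commute diff_add_cancel)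

lemma frac_vec_cbox: "frac_vec y \<in> cbox 0 1"
  by (auto simp: mem_box_cart frac_vec_def frac_lt_1 less_imp_le)

lemma Y_cell_box: "Y_cell = box 0 1"
  by (auto simp: Y_cell_def mem_box_cart)

lemma open_Y_cell: "open Y_cell" by (simp add: Y_cell_box open_box)

lemma Y_cell_lmeasurable: "(Y_cell :: (real^'m) set) \<in> lmeasurable" by (simp add: Y_cell_box)

lemma measure_Y_cell: "measure lebesgue (Y_cell :: (real^'m) set) = 1"
proof -
  have "measure lborel (cbox (0::real^'m) 1) = 1"
    by (subst content_cbox_cart) (auto simp: interval_eq_empty_cart)
  moreover have "measure lborel (box (0::real^'m) 1) = measure lborel (cbox (0::real^'m) 1)"
    by (simp add: measure_lborel_box_eq measure_lborel_cbox_eq)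
  ultimately show ?thesis unfolding Y_cell_box by simp
qed

text \<open>The part of the shifted cell that sticks out of the cell is, by periodicity, the part that the
  shift has uncovered.\<close>

lemma cell_shift_integral:
  fixes f :: "real^'m \<Rightarrow> real"
  assumes f[measurable]: "f \<in> borel_measurable borel" and b: "\<And>y. \<bar>f y\<bar> \<le> B"
    and per: "Y_periodic f" and h: "0 \<le> h" "h \<le> 1"
  shows "(\<integral>y. f (y + axis i h) \<partial>lebesgue_on Y_cell) = (\<integral>y. f y \<partial>lebesgue_on Y_cell)"
proof -
  let ?Y = "Y_cell :: (real^'m) set"
  define P where "P a b = {y :: real^'m. a < y $ i \<and> y $ i < b \<and> (\<forall>j. j \<noteq> i \<longrightarrow> 0 < y $ j \<and> y $ j < 1)}" for a b
  have Pbox: "P a b = box (\<chi> j. if j = i then a else 0) (\<chi> j. if j = i then b else 1)" for a b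
  proof (rule set_eqI)
    fix x :: "real^'m"
    have "x \<in> P a b \<longleftrightarrow> (\<forall>j. (if j = i then a else 0) < x $ j \<and> x $ j < (if j = i then b else 1))"
    proof
      assume "x \<in> P a b" thus "\<forall>j. (if j = i then a else 0) < x $ j \<and> x $ j < (if j = i then b else 1)"
        by (simp add: P_def)
    next
      assume *: "\<forall>j. (if j = i then a else 0) < x $ j \<and> x $ j < (if j = i then b else 1)"
      have "a < x $ i \<and> x $ i < b" using *[rule_format, of i] by simp
      moreover have "0 < x $ j \<and> x $ j < 1" if "j \<noteq> i" for j using *[rule_format, of j] that by simp
      ultimately show "x \<in> P a b" by (simp add: P_def)
    qed
    thus "x \<in> P a b \<longleftrightarrow> x \<in> box (\<chi> j. if j = i then a else 0) (\<chi> j. if j = i then b else 1)"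
      by (simp add: mem_box_cart)
  qed
  have Pm[measurable]: "P a b \<in> sets borel" for a b unfolding Pbox by simp
  have Pint: "integrable lborel (\<lambda>y. indicator (P a b) y * f y)" for a b
  proof -
    have "P a b \<in> lmeasurable" unfolding Pbox by simp
    hence "integrable lebesgue (\<lambda>y. indicator (P a b) y * f y)"
      by (rule integrable_indicator_bounded(1)[OF _ _ b]) (use measurable_completion[of f lborel borel] in simp)
    thus ?thesis by (subst (asm) integrable_completion) measurable
  qed
  have Y: "?Y = P 0 1" unfolding Y_cell_def P_def by (auto; metis)
  have Psh: "(\<integral>y. indicator (P a b) y * f (y + axis i t) \<partial>lborel) = (\<integral>y. indicator (P (a + t) (b + t)) y * f y \<partial>lborel)" for a b t
  proof -
    have "indicator (P a b) y = (indicator (P (a + t) (b + t)) (y + axis i t) :: real)" for y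
      unfolding P_def by (auto simp: indicator_def axis_def)
    hence "(\<integral>y. indicator (P a b) y * f (y + axis i t) \<partial>lborel) = (\<integral>y. (\<lambda>y. indicator (P (a + t) (b + t)) y * f y) (y + axis i t) \<partial>lborel)"
      by simp
    also have "\<dots> = (\<integral>y. indicator (P (a + t) (b + t)) y * f y \<partial>lborel)"
      by (rule integral_translation) measurable
    finally show ?thesis .
  qed
  have hyp: "AE y :: real^'m in lborel. y $ i \<noteq> t" for t
  proof -
    have "negligible {y :: real^'m. y $ i = t}" 
      using negligible_standard_hyperplane[of "axis i 1 :: real^'m" t] by (simp add: cart_eq_inner_axis)
    hence "AE y in lebesgue. y \<notin> {y :: real^'m. y $ i = t}" by (intro AE_not_in) (simp add: negligible_iff_null_sets)
    thus ?thesis by (simp add: AE_completion_iff)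
  qed
  have split: "(\<integral>y. indicator (P a c) y * f y \<partial>lborel) = (\<integral>y. indicator (P a b) y * f y \<partial>lborel) + (\<integral>y. indicator (P b c) y * f y \<partial>lborel)"
    if "a \<le> b" "b \<le> c" for a b c
  proof -
    have "(\<integral>y. indicator (P a c) y * f y \<partial>lborel) = (\<integral>y. indicator (P a b) y * f y + indicator (P b c) y * f y \<partial>lborel)"
    proof (rule integral_cong_AE)
      show "AE y in lborel. indicator (P a c) y * f y = indicator (P a b) y * f y + indicator (P b c) y * f y"
        using hyp[of b] by eventually_elim (use that in \<open>auto simp: P_def indicator_def\<close>)
    qed measurable
    thus ?thesis using Pint by simp
  qed
  have leb: "(\<integral>y. g y \<partial>lebesgue_on ?Y) = (\<integral>y. indicator (P 0 1) y * g y \<partial>lborel)" if [measurable]: "g \<in> borel_measurable borel" for g :: "real^'m \<Rightarrow> real"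
  proof -
    have "(\<integral>y. g y \<partial>lebesgue_on ?Y) = (\<integral>y. indicator (P 0 1) y * g y \<partial>lebesgue)"
      unfolding Y by (subst integral_lebesgue_on) auto
    also have "\<dots> = (\<integral>y. indicator (P 0 1) y * g y \<partial>lborel)" by (rule integral_completion) measurable
    finally show ?thesis .
  qed
  \<comment> \<open>the slab that sticks out returns at the opposite face\<close>
  have wrap: "(\<integral>y. indicator (P 1 (1 + h)) y * f y \<partial>lborel) = (\<integral>y. indicator (P 0 h) y * f y \<partial>lborel)"
  proof -
    have "f (y + axis i 1) = f y" for y using per integer_vec_axis[of i] unfolding Y_periodic_def by blast
    thus ?thesis using Psh[of 0 h 1] by (simp add: add.commute)
  qed
  have "(\<integral>y. f (y + axis i h) \<partial>lebesgue_on ?Y) = (\<integral>y. indicator (P h (1 + h)) y * f y \<partial>lborel)"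
    using Psh[of 0 1 h] by (subst leb) auto
  also have "\<dots> = (\<integral>y. indicator (P h 1) y * f y \<partial>lborel) + (\<integral>y. indicator (P 0 h) y * f y \<partial>lborel)"
    using split[of h 1 "1 + h"] h wrap by simp
  also have "\<dots> = (\<integral>y. f y \<partial>lebesgue_on ?Y)" using split[of 0 h 1] h by (simp add: leb)
  finally show ?thesis .
qed

section \<open>Trigonometric polynomials and averages of fast oscillations\<close>

text \<open>The phase is a multiple of pi / 2, so that sines are included, the family is countable, and
  products and derivatives of waves are again combinations of waves.\<close>

definition wave :: "real^'m \<Rightarrow> int \<Rightarrow> real^'m \<Rightarrow> real" where
  "wave k j y = cos (2 * pi * (k \<bullet> y) + of_int j * (pi / 2))"

inductive_set trig_poly :: "(real^'m \<Rightarrow> real) set" where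
  trig_wave: "integer_vec k \<Longrightarrow> wave k j \<in> trig_poly"
| trig_add: "f \<in> trig_poly \<Longrightarrow> g \<in> trig_poly \<Longrightarrow> (\<lambda>y. f y + g y) \<in> trig_poly"
| trig_scale: "f \<in> trig_poly \<Longrightarrow> (\<lambda>y. c * f y) \<in> trig_poly"

lemma wave_mult: "wave k j y * wave l i y = (1/2) * wave (k + l) (j + i) y + (1/2) * wave (k - l) (j - i) y"
proof -
  have "cos a * cos b = (1/2) * cos (a + b) + (1/2) * cos (a - b)" for a b :: real
    by (simp add: cos_add cos_diff field_simps)
  moreover define a where "a = 2 * pi * (k \<bullet> y) + of_int j * (pi / 2)"
  moreover define b where "b = 2 * pi * (l \<bullet> y) + of_int i * (pi / 2)"
  moreover have "a + b = 2 * pi * ((k + l) \<bullet> y) + of_int (j + i) * (pi / 2)"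
    "a - b = 2 * pi * ((k - l) \<bullet> y) + of_int (j - i) * (pi / 2)"
    by (simp_all add: a_def b_def inner_add_left inner_diff_left distrib_left distrib_right left_diff_distrib right_diff_distrib)
  ultimately show ?thesis unfolding wave_def by metis
qed

lemma trig_mult: "f \<in> trig_poly \<Longrightarrow> g \<in> trig_poly \<Longrightarrow> (\<lambda>y. f y * g y) \<in> trig_poly"
proof (induction f rule: trig_poly.induct)
  case (trig_wave k j)
  from trig_wave(2,1) show ?case
  proof (induction g rule: trig_poly.induct)
    case (trig_wave l i)
    thus ?case unfolding wave_mult
      by (intro trig_poly.intros integer_vec_add integer_vec_diff)
  next
    case (trig_add f g)
    then show ?case unfolding distrib_left by (intro trig_poly.trig_add)
  next
    case (trig_scale f c)
    then show ?case using trig_poly.trig_scale[of "\<lambda>y. wave k j y * f y" c] by (simp add: mult.left_commute)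
  qed
next
  case (trig_add f1 f2)
  then show ?case unfolding distrib_right by (intro trig_poly.trig_add) auto
next
  case (trig_scale f c)
  then show ?case using trig_poly.trig_scale[of "\<lambda>y. f y * g y" c] by (simp add: mult.assoc)
qed

lemma trig_const: "(\<lambda>y. c) \<in> trig_poly"
  using trig_scale[OF trig_wave[OF integer_vec_0, of 0], of c] by (simp add: wave_def)

lemma wave_periodic: "integer_vec k \<Longrightarrow> Y_periodic (wave k j)"
  unfolding Y_periodic_def
proof (intro allI impI)
  fix y l :: "real^'a" assume "integer_vec k" "integer_vec l"
  then obtain n where n: "k \<bullet> l = of_int n" using integer_vec_inner Ints_cases by metis
  have "2 * pi * (k \<bullet> (y + l)) + of_int j * (pi / 2) = (2 * pi * (k \<bullet> y) + of_int j * (pi / 2)) + 2 * pi * of_int n"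
    by (simp add: inner_add_right n algebra_simps)
  thus "wave k j (y + l) = wave k j y" unfolding wave_def
    by (simp only: cos_add[of _ "2 * pi * of_int n"] cos_int_2pin sin_int_2pin mult_1_right mult_zero_right diff_zero)
qed

lemma trig_poly_C_per: "f \<in> trig_poly \<Longrightarrow> f \<in> C_per"
proof (induction f rule: trig_poly.induct)
  case (trig_wave k j)
  have "continuous_on UNIV (wave k j)" unfolding wave_def[abs_def] by (intro continuous_intros)
  then show ?case using wave_periodic[OF trig_wave] by (simp add: C_per_def)
qed (auto simp: C_per_def Y_periodic_def intro!: continuous_on_add continuous_on_mult continuous_on_const)

lemma C_per_bounded: 
  assumes "f \<in> C_per" obtains B where "0 \<le> B" "\<And>y. \<bar>f y\<bar> \<le> B"
proof -
  have "compact (f ` cbox 0 1)" using assms by (intro compact_continuous_image) (auto simp: C_per_def intro: continuous_on_subset)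
  hence "bounded (f ` cbox 0 1)" by (rule compact_imp_bounded)
  then obtain B where "\<forall>w\<in>f ` cbox 0 1. norm w \<le> B" unfolding bounded_iff by blast
  hence B: "\<bar>f (frac_vec y)\<bar> \<le> B" for y using frac_vec_cbox[of y] by simp
  have "\<bar>f y\<bar> \<le> B" for y
  proof -
    have "f (frac_vec y) = f y" by (rule Y_periodic_frac) (use assms in \<open>simp add: C_per_def\<close>)
    with B[of y] show ?thesis by (simp only:)
  qed
  moreover from this[of 0] have "0 \<le> B" by linarith
  ultimately show thesis using that by blast
qed

lemma C_per_measurable: "f \<in> C_per \<Longrightarrow> f \<in> borel_measurable borel"
  by (auto simp: C_per_def intro: borel_measurable_continuous_onI)

text \<open>Stone-Weierstrass on the torus, realised as the image of the cell under y \<mapsto> (exp (2 pi i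
  y_j))_j. A continuous periodic function descends to a continuous function there, and the
  functions that pull back to trigonometric polynomials form an algebra that separates points.\<close>

lemma C_per_uniform_trig_approx:
  fixes g :: "real^'m \<Rightarrow> real"
  assumes g: "g \<in> C_per" and e: "e > 0"
  obtains t where "t \<in> trig_poly" "\<And>y. \<bar>g y - t y\<bar> < e"
proof -
  have gc: "continuous_on UNIV g" and gp: "Y_periodic g" using g by (auto simp: C_per_def)
  define E :: "real^'m \<Rightarrow> complex^'m" where "E y = (\<chi> i. cis (2 * pi * y $ i))" for y
  have Ec: "continuous_on A E" for A unfolding E_def
    by (intro continuous_on_vec_lambda continuous_on_cis continuous_intros)
  have Ep: "E (y + k) = E y" if "integer_vec k" for y k
  proof -
    have "cis (2 * pi * (y $ i + k $ i)) = cis (2 * pi * y $ i)" for i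
    proof -
      have "k $ i \<in> \<int>" using that by (simp add: integer_vec_def)
      then obtain n where "k $ i = of_int n" by (rule Ints_cases)
      thus ?thesis by (simp add: distrib_left cis_mult[symmetric])
    qed
    thus ?thesis by (simp add: E_def)
  qed
  have Efrac: "E (frac_vec y) = E y" for y
    using Y_periodic_frac[of E y] Ep by (auto simp: Y_periodic_def)
  have Einj: "integer_vec (y - z)" if "E y = E z" for y z
    unfolding integer_vec_def
  proof
    fix i
    have "cis (2 * pi * y $ i) = cis (2 * pi * z $ i)" using that by (simp add: E_def vec_eq_iff)
    hence "cis (2 * pi * y $ i - 2 * pi * z $ i) = 1" by (simp add: cis_divide[symmetric])
    hence "cos (2 * pi * y $ i - 2 * pi * z $ i) = 1" by (metis cis.sel(1) one_complex.sel(1))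
    then obtain n :: int where "2 * pi * y $ i - 2 * pi * z $ i = of_int n * 2 * pi" by (auto simp: cos_one_2pi_int)
    hence "2 * pi * (y $ i - z $ i - of_int n) = 0" by (simp add: algebra_simps)
    hence "y $ i - z $ i = of_int n" by simp
    thus "(y - z) $ i \<in> \<int>" by simp
  qed
  define S where "S = E ` cbox 0 1"
  have S: "compact S" unfolding S_def by (intro compact_continuous_image Ec) simp
  have ES: "E y \<in> S" for y unfolding S_def using Efrac[of y] frac_vec_cbox[of y] by (metis imageI)
  define G where "G z = g (SOME y. E y = z)" for z
  have GE: "G (E y) = g y" for y
  proof -
    define s where "s = (SOME w. E w = E y)"
    have "E s = E y" unfolding s_def by (rule someI_ex) blast
    from Einj[OF this] have "g (y + (s - y)) = g y" using gp unfolding Y_periodic_def by blast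
    thus ?thesis by (simp add: G_def s_def)
  qed
  have Gc: "continuous_on S G"
    unfolding continuous_on_closed_invariant
  proof (intro allI impI)
    fix C :: "real set" assume C: "closed C"
    let ?A = "E ` (cbox 0 1 \<inter> g -` C)"
    have "compact ?A"
      by (intro compact_continuous_image Ec compact_Int_closed closed_vimage C gc) simp
    hence "closed ?A" by (rule compact_imp_closed)
    moreover have "?A \<inter> S = G -` C \<inter> S" using GE by (auto simp: S_def)
    ultimately show "\<exists>A. closed A \<and> A \<inter> S = G -` C \<inter> S" by blast
  qed
  define \<R> where "\<R> = {F. continuous_on S F \<and> (\<lambda>y. F (E y)) \<in> trig_poly}"
  interpret function_ring_on \<R> S
  proof
    show "compact S" by (rule S)
    show "f \<in> \<R> \<Longrightarrow> continuous_on S f" for f by (simp add: \<R>_def)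
    show "f \<in> \<R> \<Longrightarrow> h \<in> \<R> \<Longrightarrow> (\<lambda>x. f x + h x) \<in> \<R>" for f h
      by (auto simp: \<R>_def intro: continuous_intros trig_add)
    show "f \<in> \<R> \<Longrightarrow> h \<in> \<R> \<Longrightarrow> (\<lambda>x. f x * h x) \<in> \<R>" for f h
      by (auto simp: \<R>_def intro: continuous_intros trig_mult)
    show "(\<lambda>_. c) \<in> \<R>" for c by (auto simp: \<R>_def intro: trig_const)
    fix z w :: "complex^'m" assume "z \<noteq> w"
    then obtain i where i: "z $ i \<noteq> w $ i" by (auto simp: vec_eq_iff)
    have re: "(\<lambda>u. Re (u $ i)) \<in> \<R>"
    proof -
      have "(\<lambda>y. Re (E y $ i)) = wave (axis i 1) 0" by (auto simp: E_def wave_def inner_axis')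
      thus ?thesis unfolding \<R>_def using trig_wave[OF integer_vec_axis] by (auto intro!: continuous_intros)
    qed
    have im: "(\<lambda>u. Im (u $ i)) \<in> \<R>"
    proof -
      have "(\<lambda>y. Im (E y $ i)) = wave (axis i 1) (-1)" by (auto simp: E_def wave_def inner_axis' cos_diff)
      thus ?thesis unfolding \<R>_def using trig_wave[OF integer_vec_axis] by (auto intro!: continuous_intros)
    qed
    show "\<exists>f\<in>\<R>. f z \<noteq> f w"
    proof (cases "Re (z $ i) = Re (w $ i)")
      case True
      hence "Im (z $ i) \<noteq> Im (w $ i)" using i complex_eqI by blast
      thus ?thesis by (intro bexI[OF _ im])
    qed (intro bexI[OF _ re])
  qed
  obtain F where F: "F \<in> UNIV \<rightarrow> \<R>" "uniform_limit S F G sequentially"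
    using Stone_Weierstrass[OF Gc] by blast
  from uniform_limitD[OF F(2) e] obtain n where n: "\<And>z. z \<in> S \<Longrightarrow> dist (F n z) (G z) < e"
    by (auto simp: eventually_sequentially)
  show thesis
  proof
    show "(\<lambda>y. F n (E y)) \<in> trig_poly" using F(1) by (auto simp: \<R>_def)
    show "\<bar>g y - F n (E y)\<bar> < e" for y using n[OF ES, of y] by (simp add: GE dist_real_def abs_minus_commute)
  qed
qed

text \<open>Shifting by half a period along an axis on which k does not vanish changes the sign of the wave.\<close>

lemma integral_wave_cell:
  fixes k :: "real^'m"
  assumes k: "integer_vec k" "k \<noteq> 0"
  shows "(\<integral>y. wave k j y \<partial>lebesgue_on Y_cell) = 0"
proof -
  obtain i where i: "k $ i \<noteq> 0" using k(2) by (auto simp: vec_eq_iff)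
  then obtain n :: int where n: "k $ i = of_int n" "n \<noteq> 0" using k(1) by (auto simp: integer_vec_def elim!: Ints_cases)
  \<comment> \<open>half a period; at most 1 / 2 because k is integer\<close>
  define h where "h = 1 / (2 * \<bar>k $ i\<bar>)"
  have "\<bar>k $ i\<bar> \<ge> 1" using n by (simp add: n(1) flip: of_int_abs)
  hence h: "0 \<le> h" "h \<le> 1" by (auto simp: h_def field_simps)
  have neg: "wave k j (y + axis i h) = - wave k j y" for y
  proof -
    have "2 * pi * (k $ i * h) = pi \<or> 2 * pi * (k $ i * h) = - pi"
      using i by (cases "k $ i > 0") (auto simp: h_def)
    moreover have "2 * pi * (k \<bullet> (y + axis i h)) + of_int j * (pi / 2) = (2 * pi * (k \<bullet> y) + of_int j * (pi / 2)) + 2 * pi * (k $ i * h)"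
      by (simp add: inner_add_right inner_axis algebra_simps)
    moreover have "cos (x + t) = - cos x" if "t = pi \<or> t = - pi" for x t :: real using that by (auto simp: cos_add)
    ultimately show ?thesis unfolding wave_def by presburger
  qed
  have C: "wave k j \<in> C_per" by (rule trig_poly_C_per[OF trig_wave[OF k(1)]])
  have "(\<integral>y. wave k j (y + axis i h) \<partial>lebesgue_on Y_cell) = (\<integral>y. wave k j y \<partial>lebesgue_on Y_cell)"
    by (rule cell_shift_integral[where B=1, OF C_per_measurable[OF C] _ wave_periodic[OF k(1)] h]) (simp add: wave_def)
  thus ?thesis by (simp add: neg)
qed

lemma filterlim_inverse_eta:
  assumes "\<And>n. \<eta> n > (0::real)" "\<eta> \<longlonglongrightarrow> 0" "(c::real) > 0"
  shows "filterlim (\<lambda>n. (1 / \<eta> n) * c) at_top sequentially"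
proof -
  have "filterlim (\<lambda>n. inverse (\<eta> n)) at_top sequentially"
    by (rule filterlim_inverse_at_top[OF assms(2)]) (use assms(1) in auto)
  thus ?thesis using filterlim_at_top_mult_tendsto_pos[OF tendsto_const assms(3), of "\<lambda>n. inverse (\<eta> n)"]
    by (simp add: divide_inverse mult.commute)
qed

text \<open>The composed wave of index k has frequency R^T k / eta, which tends to infinity if k is nonzero;
  Riemann-Lebesgue then matches the vanishing mean of the wave over the cell.\<close>

theorem oscillation_average:
  fixes R :: "real^3^'m"
  assumes R: "\<And>k :: real^'m. integer_vec k \<Longrightarrow> k \<noteq> 0 \<Longrightarrow> transpose R *v k \<noteq> 0"
    and \<eta>: "\<And>n. \<eta> n > 0" "\<eta> \<longlonglongrightarrow> 0"
    and f: "f \<in> trig_poly" and A: "A \<in> lmeasurable"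
  shows "(\<lambda>n. \<integral>x. indicator A x * f ((1 / \<eta> n) *\<^sub>R (R *v x)) \<partial>lebesgue)
           \<longlonglongrightarrow> measure lebesgue A * (\<integral>y. f y \<partial>lebesgue_on Y_cell)"
proof -
  have int: "integrable lebesgue (\<lambda>x. indicator A x * g ((1 / \<eta> n) *\<^sub>R (R *v x)))" if g: "g \<in> trig_poly" for g n
  proof -
    obtain B where B: "\<And>y. \<bar>g y\<bar> \<le> B" using C_per_bounded[OF trig_poly_C_per[OF g]] by blast
    have "continuous_on UNIV (\<lambda>x. g ((1 / \<eta> n) *\<^sub>R (R *v x)))"
      by (rule continuous_on_compose2[of UNIV g]) (use trig_poly_C_per[OF g] in \<open>auto simp: C_per_def intro!: continuous_intros\<close>)
    thus ?thesis using B A by (intro integrable_indicator_bounded(1)[where B=B]) (auto intro!: measurable_completion borel_measurable_continuous_onI)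
  qed
  have intY: "integrable (lebesgue_on Y_cell) g" if g: "g \<in> trig_poly" for g :: "real^'m \<Rightarrow> real"
  proof -
    obtain B where B: "\<And>y. \<bar>g y\<bar> \<le> B" using C_per_bounded[OF trig_poly_C_per[OF g]] by blast
    have "integrable lebesgue (\<lambda>x. indicator Y_cell x * g x)"
      by (rule integrable_indicator_bounded(1)[where B=B])
         (use B Y_cell_lmeasurable C_per_measurable[OF trig_poly_C_per[OF g]] in \<open>auto intro!: measurable_completion\<close>)
    thus ?thesis using Y_cell_lmeasurable by (subst integrable_restrict_space) auto
  qed
  show ?thesis using f
  proof (induction f rule: trig_poly.induct)
    case (trig_wave k j)
    show ?case
    proof (cases "k = 0")
      case True
      have mY: "measure (lebesgue_on Y_cell) (Y_cell :: (real^'m) set) = 1"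
        using measure_Y_cell[where 'm='m] Y_cell_lmeasurable[where 'm='m]
        by (simp add: measure_restrict_space fmeasurableD)
      show ?thesis using True A by (simp add: wave_def mY)
    next
      case False
      let ?\<zeta> = "transpose R *v k"
      have z: "?\<zeta> \<noteq> 0" using R[OF trig_wave False] .
      have eq: "wave k j ((1 / \<eta> n) *\<^sub>R (R *v x)) = cos (((2 * pi / \<eta> n) *\<^sub>R ?\<zeta>) \<bullet> x + of_int j * (pi / 2))" for n x
        by (simp add: wave_def dot_lmul_matrix[symmetric])
      have "filterlim (\<lambda>n. norm ((2 * pi / \<eta> n) *\<^sub>R ?\<zeta>)) at_top sequentially"
        using filterlim_inverse_eta[OF \<eta>, of "2 * pi * norm ?\<zeta>"] z \<eta>(1) by (simp add: abs_of_pos less_imp_le)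
      from Riemann_Lebesgue[OF A this] show ?thesis
        unfolding eq using integral_wave_cell[OF trig_wave False] by simp
    qed
  next
    case (trig_add f g)
    then show ?case
      using int intY tendsto_add[OF trig_add.IH] by (simp add: distrib_left)
  next
    case (trig_scale f c)
    then show ?case
      using tendsto_mult_left[OF trig_scale.IH, of c] by (simp add: mult.left_commute)
  qed
qed

section \<open>Lebesgue measure on a product\<close>

text \<open>Lebesgue measurability of the first projection needs more than Borel measurability: preimages of
  null sets have to be null, which Fubini provides.\<close>

lemma fst_lebesgue_measurable:
  "fst \<in> measurable (lebesgue :: ('a::euclidean_space \<times> 'b::euclidean_space) measure) (lebesgue :: 'a measure)"
proof (rule completion.measurable_completion2)
  show f: "fst \<in> (lebesgue :: ('a \<times> 'b) measure) \<rightarrow>\<^sub>M (lborel :: 'a measure)"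
    by (rule measurable_completion) (simp add: lborel_prod[symmetric])
  show "null_sets lborel \<subseteq> null_sets (distr (lebesgue :: ('a \<times> 'b) measure) (lborel :: 'a measure) fst)"
  proof
    fix N :: "'a set" assume N: "N \<in> null_sets lborel"
    have Nm: "N \<in> sets borel" using N by auto
    have "emeasure (distr (lebesgue :: ('a \<times> 'b) measure) (lborel :: 'a measure) fst) N
        = emeasure (lebesgue :: ('a \<times> 'b) measure) (fst -` N \<inter> space lebesgue)"
      by (rule emeasure_distr[OF f]) (use Nm in simp)
    also have "fst -` N \<inter> space (lebesgue :: ('a \<times> 'b) measure) = N \<times> UNIV" by auto
    also have "emeasure (lebesgue :: ('a \<times> 'b) measure) (N \<times> UNIV) = emeasure (lborel \<Otimes>\<^sub>M lborel) (N \<times> (UNIV :: 'b set))"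
      using Nm by (simp add: lborel_prod borel_Times)
    also have "\<dots> = emeasure lborel N * emeasure lborel (UNIV :: 'b set)"
      by (rule lborel.emeasure_pair_measure_Times) (use Nm in auto)
    also have "\<dots> = 0" using N by (simp add: null_setsD1)
    finally show "N \<in> null_sets (distr (lebesgue :: ('a \<times> 'b) measure) (lborel :: 'a measure) fst)"
      using Nm by (simp add: null_sets_def)
  qed
qed

lemma AE_lebesgue_fst:
  assumes "AE x in (lebesgue :: 'a::euclidean_space measure). P x"
  shows "AE z in (lebesgue :: ('a \<times> 'b::euclidean_space) measure). P (fst z)"
proof -
  obtain N where N: "{x. \<not> P x} \<subseteq> N" "N \<in> null_sets (lborel :: 'a measure)"
    using assms unfolding AE_completion_iff by (auto simp: eventually_ae_filter)
  have Nm: "N \<in> sets borel" using N by auto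
  have "emeasure (lborel \<Otimes>\<^sub>M lborel) (N \<times> (UNIV :: 'b set)) = emeasure lborel N * emeasure lborel (UNIV :: 'b set)"
    by (rule lborel.emeasure_pair_measure_Times) (use Nm in auto)
  hence "N \<times> (UNIV :: 'b set) \<in> null_sets lborel"
    using N Nm by (simp add: null_sets_def lborel_prod borel_Times)
  hence "AE z in lborel. z \<notin> N \<times> (UNIV :: 'b set)" by (rule AE_not_in)
  hence "AE z in (lborel :: ('a \<times> 'b) measure). P (fst z)" by eventually_elim (use N(1) in auto)
  thus ?thesis by (simp add: AE_completion_iff)
qed

lemma AE_lebesgue_on_fst:
  assumes A: "A \<in> sets borel" "B \<in> sets borel" and P: "AE x in lebesgue_on (A :: 'a::euclidean_space set). P x"
  shows "AE z in lebesgue_on (A \<times> (B :: 'b::euclidean_space set)). P (fst z)"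
proof -
  have "AE x in lebesgue. x \<in> A \<longrightarrow> P x" using P A by (subst (asm) AE_restrict_space_iff) auto
  from AE_lebesgue_fst[OF this] have "AE z in (lebesgue :: ('a \<times> 'b) measure). z \<in> A \<times> B \<longrightarrow> P (fst z)"
    by eventually_elim auto
  thus ?thesis using A by (subst AE_restrict_space_iff) (auto simp: borel_Times)
qed

lemma fst_lebesgue_on_measurable:
  assumes "A \<in> sets borel" "B \<in> sets borel"
  shows "fst \<in> measurable (lebesgue_on ((A :: 'a::euclidean_space set) \<times> (B :: 'b::euclidean_space set))) (lebesgue_on A)"
  by (rule measurable_restrict_space2) (auto intro: measurable_restrict_space1 fst_lebesgue_measurable)

lemma snd_lebesgue_on_measurable:
  "snd \<in> measurable (lebesgue_on (S :: ('a::euclidean_space \<times> 'b::euclidean_space) set)) borel"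
proof -
  have "snd \<in> measurable (lborel :: ('a \<times> 'b) measure) borel" by (simp add: lborel_prod[symmetric])
  thus ?thesis by (intro measurable_restrict_space1 measurable_completion)
qed

text \<open>Fubini's theorem is applied below to Borel functions only; this is how Lebesgue measurable ones
  reach it.\<close>

lemma borel_representative:
  fixes f :: "'a::euclidean_space \<Rightarrow> real"
  assumes A: "A \<in> sets borel" and f: "f \<in> borel_measurable (lebesgue_on A)"
  obtains g where "g \<in> borel_measurable borel" "AE x in lebesgue_on A. f x = g x"
proof -
  have "(\<lambda>x. indicator A x *\<^sub>R f x) \<in> borel_measurable lebesgue"
    using f A by (subst (asm) borel_measurable_restrict_space_iff) auto
  then obtain g where g: "g \<in> borel_measurable lborel" "AE x in lborel. indicator A x *\<^sub>R f x = g x"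
    using completion_ex_borel_measurable_real by blast
  have "AE x in lebesgue. x \<in> A \<longrightarrow> f x = g x"
    unfolding AE_completion_iff using g(2) by eventually_elim auto
  hence "AE x in lebesgue_on A. f x = g x" using A by (subst AE_restrict_space_iff) auto
  with g(1) show thesis using that by simp
qed

lemma borel_measurable_lebesgue_on_AE:
  fixes f g :: "'a::euclidean_space \<Rightarrow> real"
  assumes S: "S \<in> sets lebesgue" and f: "f \<in> borel_measurable (lebesgue_on S)"
    and eq: "AE x in lebesgue_on S. f x = g x"
  shows "g \<in> borel_measurable (lebesgue_on S)"
proof -
  have f': "(\<lambda>x. indicator S x * f x) \<in> borel_measurable lebesgue"
    using f S by (subst (asm) borel_measurable_restrict_space_iff) auto
  have ae: "AE x in lebesgue. indicator S x * f x = indicator S x * g x"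
    using eq S by (subst (asm) AE_restrict_space_iff) (auto elim!: eventually_mono simp: indicator_def)
  have "(\<lambda>x. indicator S x * g x) \<in> borel_measurable lebesgue"
  proof (rule measurableI)
    fix B :: "real set" assume B: "B \<in> sets borel"
    show "(\<lambda>x. indicator S x * g x) -` B \<inter> space lebesgue \<in> sets lebesgue"
    proof (rule completion.in_sets_AE)
      show "AE x in lebesgue. x \<in> (\<lambda>x. indicator S x * f x) -` B \<inter> space lebesgue \<longleftrightarrow> x \<in> (\<lambda>x. indicator S x * g x) -` B \<inter> space lebesgue"
        using ae
      proof eventually_elim
        case (elim x) thus ?case by (simp only: vimage_eq Int_iff)
      qed
      show "(\<lambda>x. indicator S x * f x) -` B \<inter> space lebesgue \<in> sets lebesgue"
        by (rule measurable_sets[OF f' B])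
    qed simp
  qed simp
  thus ?thesis using S by (subst borel_measurable_restrict_space_iff) auto
qed

lemma borel_measurable_lebesgue_on_AE_LIMSEQ:
  fixes f :: "nat \<Rightarrow> 'a::euclidean_space \<Rightarrow> real"
  assumes S: "S \<in> sets lebesgue" and f: "\<And>n. f n \<in> borel_measurable (lebesgue_on S)"
    and lim: "AE x in lebesgue_on S. (\<lambda>n. f n x) \<longlonglongrightarrow> g x"
  shows "g \<in> borel_measurable (lebesgue_on S)"
proof (rule borel_measurable_lebesgue_on_AE[OF S])
  show "(\<lambda>x. lim (\<lambda>n. f n x)) \<in> borel_measurable (lebesgue_on S)" using f by (rule borel_measurable_lim_metric)
  show "AE x in lebesgue_on S. lim (\<lambda>n. f n x) = g x" using lim by eventually_elim (rule limI)
qed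

lemma Fubini_lebesgue_on:
  fixes f :: "'a::euclidean_space \<times> 'b::euclidean_space \<Rightarrow> real"
  assumes A[measurable]: "A \<in> sets borel" and B[measurable]: "B \<in> sets borel" and f[measurable]: "f \<in> borel_measurable borel"
    and int: "integrable (lebesgue_on (A \<times> B)) f"
  shows "(\<integral>z. f z \<partial>lebesgue_on (A \<times> B)) = (\<integral>x. (\<integral>y. f (x, y) \<partial>lebesgue_on B) \<partial>lebesgue_on A)"
    and "integrable (lebesgue_on A) (\<lambda>x. \<integral>y. f (x, y) \<partial>lebesgue_on B)"
    and "AE x in lebesgue_on A. integrable (lebesgue_on B) (\<lambda>y. f (x, y))"
proof -
  define g where "g z = indicator (A \<times> B) z * f z" for z
  have AB[measurable]: "A \<times> B \<in> sets borel" using A B by (rule borel_Times)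
  have g[measurable]: "g \<in> borel_measurable borel" unfolding g_def by measurable
  have f2[measurable]: "f \<in> borel_measurable (borel \<Otimes>\<^sub>M borel)" using f by (simp add: borel_prod)
  have g2[measurable]: "g \<in> borel_measurable (borel \<Otimes>\<^sub>M borel)" using g by (simp add: borel_prod)
  have gi: "integrable (lborel \<Otimes>\<^sub>M lborel) g"
  proof -
    have "integrable lebesgue g" using int unfolding g_def by (subst (asm) integrable_restrict_space) auto
    thus ?thesis unfolding lborel_prod by (subst (asm) integrable_completion) auto
  qed
  have sec: "(\<integral>y. f (x, y) \<partial>lebesgue_on B) = (\<integral>y. indicator B y * f (x, y) \<partial>lborel)" for x
    by (subst integral_lebesgue_on, simp, rule integral_completion) measurable
  have sec2: "indicator A x * (\<integral>y. f (x, y) \<partial>lebesgue_on B) = (\<integral>y. g (x, y) \<partial>lborel)" for x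
    unfolding sec g_def by (auto simp: indicator_times indicator_def)
  have m1: "(\<lambda>x. \<integral>y. g (x, y) \<partial>lborel) \<in> borel_measurable borel" 
    by (rule lborel.borel_measurable_lebesgue_integral) (simp add: g2)
  have i1: "integrable lborel (\<lambda>x. \<integral>y. g (x, y) \<partial>lborel)" by (rule lborel_pair.integrable_fst'[OF gi])
  show "integrable (lebesgue_on A) (\<lambda>x. \<integral>y. f (x, y) \<partial>lebesgue_on B)"
    using i1 m1 by (subst integrable_restrict_space) (auto simp: sec2 integrable_completion)
  have "(\<integral>z. f z \<partial>lebesgue_on (A \<times> B)) = (\<integral>z. g z \<partial>lebesgue)"
    unfolding g_def by (rule integral_lebesgue_on) simp
  also have "\<dots> = (\<integral>z. g z \<partial>(lborel \<Otimes>\<^sub>M lborel))" unfolding lborel_prod by (rule integral_completion) simp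
  also have "\<dots> = (\<integral>x. (\<integral>y. g (x, y) \<partial>lborel) \<partial>lborel)" by (rule lborel_pair.integral_fst'[OF gi, symmetric])
  also have "\<dots> = (\<integral>x. indicator A x * (\<integral>y. f (x, y) \<partial>lebesgue_on B) \<partial>lebesgue)"
    unfolding sec2 by (rule integral_completion[symmetric]) (use m1 in simp)
  also have "\<dots> = (\<integral>x. (\<integral>y. f (x, y) \<partial>lebesgue_on B) \<partial>lebesgue_on A)"
    by (rule integral_lebesgue_on[symmetric]) simp
  finally show "(\<integral>z. f z \<partial>lebesgue_on (A \<times> B)) = (\<integral>x. (\<integral>y. f (x, y) \<partial>lebesgue_on B) \<partial>lebesgue_on A)" .
  have "AE x in lborel. integrable lborel (\<lambda>y. g (x, y))" by (rule lborel_pair.AE_integrable_fst'[OF gi])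
  hence "AE x in lebesgue. x \<in> A \<longrightarrow> integrable (lebesgue_on B) (\<lambda>y. f (x, y))"
    unfolding AE_completion_iff
  proof eventually_elim
    case (elim x)
    show ?case
    proof
      assume "x \<in> A"
      hence "(\<lambda>y. g (x, y)) = (\<lambda>y. indicator B y *\<^sub>R f (x, y))" by (auto simp: g_def indicator_times)
      hence "integrable lborel (\<lambda>y. indicator B y *\<^sub>R f (x, y))" using elim by simp
      thus "integrable (lebesgue_on B) (\<lambda>y. f (x, y))"
        by (subst integrable_restrict_space) (auto simp: integrable_completion)
    qed
  qed
  thus "AE x in lebesgue_on A. integrable (lebesgue_on B) (\<lambda>y. f (x, y))"
    by (subst AE_restrict_space_iff) auto
qed

text \<open>As B has measure one, passing to the product preserves the energy.\<close>

lemma square_integrable_fst: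
  fixes b :: "'a::euclidean_space \<Rightarrow> real"
  assumes A[measurable]: "A \<in> sets borel" and B[measurable]: "B \<in> sets borel" and B1: "emeasure lborel (B :: 'b::euclidean_space set) = 1"
    and b: "square_integrable (lebesgue_on A) b"
  shows "square_integrable (lebesgue_on (A \<times> B)) (\<lambda>z. b (fst z))"
    and "energy (lebesgue_on (A \<times> B)) (\<lambda>z. b (fst z)) \<le> energy (lebesgue_on A) b"
proof -
  have bm: "b \<in> borel_measurable (lebesgue_on A)" using b by (rule square_integrable_measurable)
  obtain g where g[measurable]: "g \<in> borel_measurable borel" and ge: "AE x in lebesgue_on A. b x = g x"
    using borel_representative[OF A bm] by blast
  have AB[measurable]: "A \<times> B \<in> sets borel" using A B by (rule borel_Times)
  have "(\<integral>\<^sup>+z. ennreal ((norm (b (fst z)))\<^sup>2) \<partial>lebesgue_on (A \<times> B)) = (\<integral>\<^sup>+z. ennreal ((norm (g (fst z)))\<^sup>2) \<partial>lebesgue_on (A \<times> B))"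
    by (rule nn_integral_cong_AE) (use AE_lebesgue_on_fst[OF A B ge] in \<open>auto elim!: eventually_mono\<close>)
  also have "\<dots> = (\<integral>\<^sup>+z. ennreal ((norm (g (fst z)))\<^sup>2) * indicator (A \<times> B) z \<partial>lebesgue)"
    by (rule nn_integral_restrict_space) simp
  also have "\<dots> = (\<integral>\<^sup>+z. ennreal ((norm (g (fst z)))\<^sup>2) * indicator (A \<times> B) z \<partial>(lborel \<Otimes>\<^sub>M lborel))"
    unfolding lborel_prod by (rule nn_integral_completion)
  also have "\<dots> = (\<integral>\<^sup>+x. \<integral>\<^sup>+y. ennreal ((norm (g x))\<^sup>2) * indicator A x * indicator B y \<partial>lborel \<partial>lborel)"
  proof (subst lborel.nn_integral_fst[symmetric])
    have [measurable]: "A \<times> B \<in> sets (lborel \<Otimes>\<^sub>M lborel)" using A B by simp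
    show "(\<lambda>z. ennreal ((norm (g (fst z)))\<^sup>2) * indicator (A \<times> B) z) \<in> borel_measurable (lborel \<Otimes>\<^sub>M lborel)"
      by measurable
  qed (auto simp: indicator_times mult.assoc)
  also have "\<dots> = (\<integral>\<^sup>+x. ennreal ((norm (g x))\<^sup>2) * indicator A x \<partial>lborel)"
    by (subst nn_integral_cmult) (auto simp: B1)
  also have "\<dots> = (\<integral>\<^sup>+x. ennreal ((norm (g x))\<^sup>2) * indicator A x \<partial>lebesgue)"
    by (rule nn_integral_completion[symmetric])
  also have "\<dots> = (\<integral>\<^sup>+x. ennreal ((norm (g x))\<^sup>2) \<partial>lebesgue_on A)"
    by (rule nn_integral_restrict_space[symmetric]) simp
  also have "\<dots> = (\<integral>\<^sup>+x. ennreal ((norm (b x))\<^sup>2) \<partial>lebesgue_on A)"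
    by (rule nn_integral_cong_AE) (use ge in \<open>auto elim!: eventually_mono\<close>)
  also have "\<dots> = ennreal (energy (lebesgue_on A) b)" by (rule energy_eq_nn_integral[OF b, symmetric])
  finally have "(\<integral>\<^sup>+z. ennreal ((norm (b (fst z)))\<^sup>2) \<partial>lebesgue_on (A \<times> B)) \<le> ennreal (energy (lebesgue_on A) b)" by simp
  moreover have "(\<lambda>z. b (fst z)) \<in> borel_measurable (lebesgue_on (A \<times> B))"
    by (rule measurable_compose[OF fst_lebesgue_on_measurable[OF A B] bm])
  ultimately show "square_integrable (lebesgue_on (A \<times> B)) (\<lambda>z. b (fst z))"
    and "energy (lebesgue_on (A \<times> B)) (\<lambda>z. b (fst z)) \<le> energy (lebesgue_on A) b"
    using square_integrable_of_nn_integral_le[OF _ _ energy_nonneg] by blast+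
qed

lemma emeasure_Y_cell: "emeasure lborel (Y_cell :: (real^'m) set) = 1"
proof -
  have "emeasure lebesgue (Y_cell :: (real^'m) set) = ennreal (measure lebesgue (Y_cell :: (real^'m) set))"
    by (rule emeasure_eq_measure2) (rule Y_cell_lmeasurable)
  thus ?thesis using open_Y_cell[where 'a='m] by (simp add: measure_Y_cell)
qed

lemma Y_cell_borel [measurable]: "(Y_cell :: (real^'m) set) \<in> sets borel"
  by (simp add: Y_cell_box)

lemma lmeasurable_Times_cell:
  assumes "open \<Omega>" "bounded (\<Omega> :: (real^3) set)"
  shows "\<Omega> \<times> (Y_cell :: (real^'m) set) \<in> lmeasurable"
proof -
  have "open (\<Omega> \<times> (Y_cell :: (real^'m) set))" using assms open_Y_cell by (intro open_Times)
  moreover have "bounded (\<Omega> \<times> (Y_cell :: (real^'m) set))" using assms by (intro bounded_Times) (auto simp: Y_cell_box bounded_box)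
  ultimately show ?thesis by (simp add: lmeasurable_open)
qed

lemma integrable_bounded_on:
  fixes f :: "'a::euclidean_space \<Rightarrow> real"
  assumes "S \<in> lmeasurable" "f \<in> borel_measurable (lebesgue_on S)" "\<And>x. \<bar>f x\<bar> \<le> B"
  shows "integrable (lebesgue_on S) f"
proof -
  have "finite_measure (lebesgue_on S)" using assms(1) by (rule finite_measure_lebesgue_on)
  thus ?thesis using assms by (intro finite_measure.integrable_const_bound[where B=B]) auto
qed

lemma square_integrable_bounded_on:
  fixes f :: "'a::euclidean_space \<Rightarrow> 'b::euclidean_space"
  assumes S: "S \<in> lmeasurable" and f: "f \<in> borel_measurable (lebesgue_on S)" "\<And>x. norm (f x) \<le> B"
  shows "square_integrable (lebesgue_on S) f"
  unfolding square_integrable_def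
proof
  show "integrable (lebesgue_on S) (\<lambda>x. (norm (f x))\<^sup>2)"
  proof (rule integrable_bounded_on[OF S])
    show "\<bar>(norm (f x))\<^sup>2\<bar> \<le> B\<^sup>2" for x using power_mono[OF f(2)[of x], of 2] by simp
  qed (use f(1) in measurable)
qed (rule f(1))

section \<open>Density of step functions with trigonometric values\<close>

lemma sup_norm_bound: "f \<in> C_per \<Longrightarrow> \<bar>f y\<bar> \<le> sup_norm f"
proof -
  assume "f \<in> C_per"
  then obtain B where "\<And>y. \<bar>f y\<bar> \<le> B" using C_per_bounded by blast
  hence "bdd_above (range (\<lambda>y. \<bar>f y\<bar>))" by (intro bdd_aboveI[where M=B]) auto
  thus "\<bar>f y\<bar> \<le> sup_norm f" unfolding sup_norm_def by (rule cSUP_upper[rotated]) simp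
qed

lemma sup_norm_le: "(\<And>y. \<bar>f y\<bar> \<le> c) \<Longrightarrow> sup_norm f \<le> c"
  unfolding sup_norm_def by (rule cSUP_least) auto

lemma C_per_diff: "f \<in> C_per \<Longrightarrow> g \<in> C_per \<Longrightarrow> (\<lambda>y. f y - g y) \<in> C_per"
  and C_per_zero: "(\<lambda>y. 0) \<in> C_per"
  by (auto simp: C_per_def Y_periodic_def intro!: continuous_on_add continuous_on_diff)

lemma sup_norm_nonneg: "f \<in> C_per \<Longrightarrow> 0 \<le> sup_norm f"
  using sup_norm_bound[of f 0] by linarith

lemma sup_norm_triangle:
  assumes "f \<in> C_per" "g \<in> C_per" "h \<in> C_per"
  shows "sup_norm (\<lambda>y. f y - h y) \<le> sup_norm (\<lambda>y. f y - g y) + sup_norm (\<lambda>y. g y - h y)"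
proof (rule sup_norm_le)
  fix y
  show "\<bar>f y - h y\<bar> \<le> sup_norm (\<lambda>y. f y - g y) + sup_norm (\<lambda>y. g y - h y)"
    using sup_norm_bound[OF C_per_diff[OF assms(1,2)], of y] sup_norm_bound[OF C_per_diff[OF assms(2,3)], of y] by linarith
qed

lemma sup_norm_minus_commute: "sup_norm (\<lambda>y. f y - g y) = sup_norm (\<lambda>y. g y - f y)"
  unfolding sup_norm_def by (simp add: abs_minus_commute)

lemma sup_norm_0: "sup_norm (\<lambda>y. 0) = 0" by (simp add: sup_norm_def)

text \<open>The indicators are restricted to a family of sets: a countable one for the diagonal argument,
  all measurable sets for closure under products.\<close>

inductive_set step_waves :: "(real^3) set set \<Rightarrow> (real^3 \<Rightarrow> real^'m \<Rightarrow> real) set" for \<A> where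
  step_wave: "A \<in> \<A> \<Longrightarrow> integer_vec k \<Longrightarrow> (\<lambda>x y. indicator A x * wave k j y) \<in> step_waves \<A>"
| step_add: "f \<in> step_waves \<A> \<Longrightarrow> g \<in> step_waves \<A> \<Longrightarrow> (\<lambda>x y. f x y + g x y) \<in> step_waves \<A>"
| step_scale: "f \<in> step_waves \<A> \<Longrightarrow> (\<lambda>x y. c * f x y) \<in> step_waves \<A>"

lemma step_trig: "t \<in> trig_poly \<Longrightarrow> A \<in> \<A> \<Longrightarrow> (\<lambda>x y. indicator A x * t y) \<in> step_waves \<A>"
proof (induction t rule: trig_poly.induct)
  case (trig_scale f c)
  then show ?case using step_scale[of "\<lambda>x y. indicator A x * f y" \<A> c] by (simp add: mult.left_commute)
next
  case (trig_add f g)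
  then show ?case unfolding distrib_left by (intro step_add)
qed (rule step_wave)

text \<open>Closeness in L2(\<Omega>, C): uniform in y and quadratic in x. The majorant b avoids the question
  whether the supremum over y is measurable.\<close>

definition near_uniformly :: "(real^3) set \<Rightarrow> (real^3 \<Rightarrow> real^'m \<Rightarrow> real) \<Rightarrow> (real^3 \<Rightarrow> real^'m \<Rightarrow> real) \<Rightarrow> real \<Rightarrow> bool" where
  "near_uniformly \<Omega> \<phi> \<psi> e \<longleftrightarrow> (\<exists>b. square_integrable (lebesgue_on \<Omega>) b \<and> energy (lebesgue_on \<Omega>) b < e \<and>
      (AE x in lebesgue_on \<Omega>. \<forall>y. \<bar>\<phi> x y - \<psi> x y\<bar> \<le> b x))"

lemma near_uniformly_add:
  assumes "near_uniformly \<Omega> f f' (e/4)" "near_uniformly \<Omega> g g' (e/4)"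
  shows "near_uniformly \<Omega> (\<lambda>x y. f x y + g x y) (\<lambda>x y. f' x y + g' x y) e"
proof -
  obtain b where b: "square_integrable (lebesgue_on \<Omega>) b" "energy (lebesgue_on \<Omega>) b < e/4"
      "AE x in lebesgue_on \<Omega>. \<forall>y. \<bar>f x y - f' x y\<bar> \<le> b x" using assms(1) unfolding near_uniformly_def by blast
  obtain c where c: "square_integrable (lebesgue_on \<Omega>) c" "energy (lebesgue_on \<Omega>) c < e/4"
      "AE x in lebesgue_on \<Omega>. \<forall>y. \<bar>g x y - g' x y\<bar> \<le> c x" using assms(2) unfolding near_uniformly_def by blast
  have "energy (lebesgue_on \<Omega>) (\<lambda>x. b x + c x) < e" using energy_add_le[OF b(1) c(1)] b(2) c(2) by linarith
  moreover have "AE x in lebesgue_on \<Omega>. \<forall>y. \<bar>(f x y + g x y) - (f' x y + g' x y)\<bar> \<le> b x + c x"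
    using b(3) c(3)
  proof eventually_elim
    case (elim x)
    show ?case
    proof
      fix y show "\<bar>(f x y + g x y) - (f' x y + g' x y)\<bar> \<le> b x + c x" using spec[OF elim(1), of y] spec[OF elim(2), of y] by linarith
    qed
  qed
  ultimately show ?thesis unfolding near_uniformly_def using square_integrable_add[OF b(1) c(1)] by blast
qed

lemma near_uniformly_trans:
  assumes "near_uniformly \<Omega> f g (e/4)" "near_uniformly \<Omega> g h (e/4)"
  shows "near_uniformly \<Omega> f h e"
  using near_uniformly_add[OF assms] unfolding near_uniformly_def by (simp add: algebra_simps)

lemma near_uniformly_refl: "e > 0 \<Longrightarrow> near_uniformly \<Omega> f f e"
  unfolding near_uniformly_def by (intro exI[of _ "\<lambda>x. 0"]) (auto simp: square_integrable_def energy_def)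

text \<open>A simple function with values in C_per is a finite sum of indicators times continuous functions.
  Applied both to x \<mapsto> s x (R x / eta) and to the function s of two variables.\<close>

lemma simple_eval_measurable:
  fixes s :: "'a \<Rightarrow> real^'m \<Rightarrow> real"
  assumes s: "simple_function M s" "s ` space M \<subseteq> C_per"
    and q: "q \<in> measurable K M" and p: "p \<in> measurable K borel"
  shows "(\<lambda>z. s (q z) (p z)) \<in> borel_measurable K"
proof -
  have fin: "finite (s ` space M)" and ms: "\<And>f. f \<in> s ` space M \<Longrightarrow> s -` {f} \<inter> space M \<in> sets M"
    using simple_functionD[OF s(1)] by auto
  have "(\<lambda>z. s (q z) (p z)) \<in> borel_measurable K \<longleftrightarrow>
     (\<lambda>z. \<Sum>f\<in>s ` space M. indicator (s -` {f} \<inter> space M) (q z) * f (p z)) \<in> borel_measurable K"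
  proof (rule measurable_cong)
    fix z assume "z \<in> space K"
    hence qz: "q z \<in> space M" using q by (rule measurable_space[rotated])
    have "(\<Sum>f\<in>s ` space M. indicator (s -` {f} \<inter> space M) (q z) * f (p z)) = (\<Sum>f\<in>s ` space M. if f = s (q z) then f (p z) else 0)"
      by (rule sum.cong) (use qz in \<open>auto simp: indicator_def\<close>)
    also have "\<dots> = s (q z) (p z)" using fin qz by simp
    finally show "s (q z) (p z) = (\<Sum>f\<in>s ` space M. indicator (s -` {f} \<inter> space M) (q z) * f (p z))" by simp
  qed
  moreover have "(\<lambda>z. \<Sum>f\<in>s ` space M. indicator (s -` {f} \<inter> space M) (q z) * f (p z)) \<in> borel_measurable K"
  proof (intro borel_measurable_sum borel_measurable_times)
    fix f assume f: "f \<in> s ` space M"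
    show "(\<lambda>z. indicator (s -` {f} \<inter> space M) (q z) :: real) \<in> borel_measurable K"
      by (rule measurable_compose[OF q borel_measurable_indicator[OF ms[OF f]]])
    show "(\<lambda>z. f (p z)) \<in> borel_measurable K"
      by (rule measurable_compose[OF p C_per_measurable]) (use f s(2) in auto)
  qed
  ultimately show ?thesis by simp
qed

lemma Bochner_test_eval_measurable:
  fixes \<phi> :: "real^3 \<Rightarrow> real^'m \<Rightarrow> real"
  assumes \<phi>: "\<phi> \<in> L2_Bochner \<Omega> C_per sup_norm"
    and S: "S \<in> sets lebesgue" and q: "q \<in> measurable (lebesgue_on S) (lebesgue_on \<Omega>)" and p: "p \<in> measurable (lebesgue_on S) borel"
    and AE_q: "\<And>P. AE x in lebesgue_on \<Omega>. P x \<Longrightarrow> AE z in lebesgue_on S. P (q z)"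
  shows "(\<lambda>z. \<phi> (q z) (p z)) \<in> borel_measurable (lebesgue_on (S :: 'z::euclidean_space set))"
proof -
  obtain s where s: "\<And>n. simple_function (lebesgue_on \<Omega>) (s n)" "\<And>n. s n ` \<Omega> \<subseteq> C_per"
      "AE x in lebesgue_on \<Omega>. (\<lambda>n::nat. sup_norm (\<lambda>y. s n x y - \<phi> x y)) \<longlonglongrightarrow> 0"
    and C: "AE x in lebesgue_on \<Omega>. \<phi> x \<in> C_per"
    using \<phi> unfolding L2_Bochner_def by blast
  show ?thesis
  proof (rule borel_measurable_lebesgue_on_AE_LIMSEQ[OF S])
    show "(\<lambda>z. s n (q z) (p z)) \<in> borel_measurable (lebesgue_on S)" for n
      by (rule simple_eval_measurable[OF s(1) _ q p]) (use s(2) in simp)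
    have "AE x in lebesgue_on \<Omega>. \<forall>y. (\<lambda>n. s n x y) \<longlonglongrightarrow> \<phi> x y"
      using s(3) C AE_space
    proof eventually_elim
      case (elim x)
      show ?case
      proof
        fix y
        have "norm (s n x y - \<phi> x y) \<le> sup_norm (\<lambda>y. s n x y - \<phi> x y)" for n
          using sup_norm_bound[OF C_per_diff, of "s n x" "\<phi> x" y] s(2)[of n] elim by auto
        hence "(\<lambda>n. s n x y - \<phi> x y) \<longlonglongrightarrow> 0" by (intro Lim_null_comparison[OF _ elim(1)]) simp
        thus "(\<lambda>n. s n x y) \<longlonglongrightarrow> \<phi> x y" by (simp add: LIM_zero_iff)
      qed
    qed
    thus "AE z in lebesgue_on S. (\<lambda>n. s n (q z) (p z)) \<longlonglongrightarrow> \<phi> (q z) (p z)"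
      using AE_q[of "\<lambda>x. \<forall>y. (\<lambda>n. s n x y) \<longlonglongrightarrow> \<phi> x y"] by (auto elim!: eventually_mono)
  qed
qed

text \<open>The given simple functions converge only almost everywhere. Replacing s n x by zero where its
  norm exceeds twice that of \<phi> x keeps the convergence and makes dominated convergence available.\<close>

lemma Bochner_near_simple:
  fixes \<phi> :: "real^3 \<Rightarrow> real^'m \<Rightarrow> real"
  assumes \<phi>: "\<phi> \<in> L2_Bochner \<Omega> C_per sup_norm" and e: "e > 0"
  obtains t where "simple_function (lebesgue_on \<Omega>) t" "t ` \<Omega> \<subseteq> C_per" "near_uniformly \<Omega> \<phi> t e"
proof -
  let ?M = "lebesgue_on \<Omega>"
  obtain s where s: "\<And>n. simple_function ?M (s n)" "\<And>n. s n ` \<Omega> \<subseteq> C_per"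
      "AE x in ?M. (\<lambda>n::nat. sup_norm (\<lambda>y. s n x y - \<phi> x y)) \<longlonglongrightarrow> 0"
    and C: "AE x in ?M. \<phi> x \<in> C_per" and int: "integrable ?M (\<lambda>x. (sup_norm (\<phi> x))\<^sup>2)"
    using \<phi> unfolding L2_Bochner_def by blast
  define r where "r x = sqrt ((sup_norm (\<phi> x))\<^sup>2)" for x
  have rm[measurable]: "r \<in> borel_measurable ?M" unfolding r_def using int by measurable
  have r0: "0 \<le> r x" for x by (simp add: r_def)
  define D where "D n = {x \<in> space ?M. sup_norm (s n x) \<le> 2 * r x}" for n
  have [measurable]: "(\<lambda>x. sup_norm (s n x)) \<in> borel_measurable ?M" for n
    by (rule borel_measurable_simple_function) (rule simple_function_compose1[OF s(1)])
  have Dm: "D n \<in> sets ?M" for n unfolding D_def by measurable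
  define t where "t n x = (if x \<in> D n then s n x else (\<lambda>y. 0))" for n x
  have ts: "simple_function ?M (t n)" for n
    unfolding t_def by (rule simple_function_If_set) (use Dm[of n] s(1) sets.sets_into_space[OF Dm[of n]] in \<open>auto simp: Int_absorb1 Int_absorb2\<close>)
  have tC: "x \<in> \<Omega> \<Longrightarrow> t n x \<in> C_per" for n x using s(2)[of n] C_per_zero by (auto simp: t_def)
  have tr: "sup_norm (t n x) \<le> 2 * r x" for n x using r0[of x] by (auto simp: t_def D_def sup_norm_0)
  have tlim: "AE x in ?M. (\<lambda>n. sup_norm (\<lambda>y. t n x y - \<phi> x y)) \<longlonglongrightarrow> 0"
    using s(3) C AE_space
  proof eventually_elim
    case (elim x)
    have x: "x \<in> \<Omega>" using elim by simp
    have sC: "s n x \<in> C_per" for n using s(2)[of n] x by auto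
    have rx: "r x = sup_norm (\<phi> x)" using sup_norm_nonneg[OF elim(2)] by (simp add: r_def)
    show ?case
    proof (cases "r x = 0")
      case True
      have "sup_norm (\<lambda>y. t n x y - \<phi> x y) = 0" for n
      proof -
        have z: "\<phi> x y = 0" for y using sup_norm_bound[OF elim(2), of y] True rx by simp
        have "t n x y = 0" for y using sup_norm_bound[OF tC[OF x, of n], of y] tr[of n x] True by simp
        thus ?thesis by (simp add: z sup_norm_0)
      qed
      thus ?thesis by simp
    next
      case False
      hence "r x > 0" using r0[of x] by linarith
      from order_tendstoD(2)[OF elim(1) this] have "eventually (\<lambda>n. x \<in> D n) sequentially"
      proof eventually_elim
        case (elim n)
        have "sup_norm (\<lambda>y. s n x y - 0) \<le> sup_norm (\<lambda>y. s n x y - \<phi> x y) + sup_norm (\<lambda>y. \<phi> x y - 0)"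
          by (rule sup_norm_triangle) (use sC \<open>\<phi> x \<in> C_per\<close> C_per_zero in auto)
        thus ?case using elim rx x by (simp add: D_def)
      qed
      hence "eventually (\<lambda>n. sup_norm (\<lambda>y. s n x y - \<phi> x y) = sup_norm (\<lambda>y. t n x y - \<phi> x y)) sequentially"
        by eventually_elim (simp add: t_def)
      from Lim_transform_eventually[OF elim(1) this] show ?thesis .
    qed
  qed
  \<comment> \<open>equals the distance of t n x to \<phi> x almost everywhere, and is measurable as a limit of
    simple functions\<close>
  define b where "b n x = lim (\<lambda>k. sup_norm (\<lambda>y. t n x y - t k x y))" for n x
  have bm[measurable]: "b n \<in> borel_measurable ?M" for n unfolding b_def
    by (intro borel_measurable_lim_metric borel_measurable_simple_function simple_function_compose2[OF ts ts])
  have bv: "AE x in ?M. \<forall>n. b n x = sup_norm (\<lambda>y. t n x y - \<phi> x y)"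
    using tlim C AE_space
  proof eventually_elim
    case (elim x)
    have x: "x \<in> \<Omega>" using elim by simp
    show ?case
    proof
      fix n
      have "norm (sup_norm (\<lambda>y. t n x y - t k x y) - sup_norm (\<lambda>y. t n x y - \<phi> x y)) \<le> sup_norm (\<lambda>y. t k x y - \<phi> x y)" for k
        using sup_norm_triangle[OF tC[OF x, of n] tC[OF x, of k] elim(2)]
          sup_norm_triangle[OF tC[OF x, of n] elim(2) tC[OF x, of k]] sup_norm_minus_commute[of "\<phi> x" "t k x"]
        by (simp add: abs_le_iff)
      hence "(\<lambda>k. sup_norm (\<lambda>y. t n x y - t k x y) - sup_norm (\<lambda>y. t n x y - \<phi> x y)) \<longlonglongrightarrow> 0"
        by (intro Lim_null_comparison[OF _ elim(1)]) simp
      hence "(\<lambda>k. sup_norm (\<lambda>y. t n x y - t k x y)) \<longlonglongrightarrow> sup_norm (\<lambda>y. t n x y - \<phi> x y)" by (simp add: LIM_zero_iff)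
      thus "b n x = sup_norm (\<lambda>y. t n x y - \<phi> x y)" unfolding b_def by (rule limI)
    qed
  qed
  have b3: "AE x in ?M. \<forall>n. 0 \<le> b n x \<and> b n x \<le> 3 * r x"
    using bv C AE_space
  proof eventually_elim
    case (elim x)
    have x: "x \<in> \<Omega>" using elim by simp
    show ?case
    proof
      fix n
      have "sup_norm (\<lambda>y. t n x y - \<phi> x y) \<le> sup_norm (\<lambda>y. t n x y - 0) + sup_norm (\<lambda>y. 0 - \<phi> x y)"
        by (rule sup_norm_triangle) (use tC[OF x] elim C_per_zero in auto)
      also have "sup_norm (\<lambda>y. 0 - \<phi> x y) = r x"
        using sup_norm_minus_commute[of "\<lambda>y. 0" "\<phi> x"] sup_norm_nonneg[OF elim(2)] by (simp add: r_def)
      finally have "b n x \<le> 3 * r x" using elim tr[of n x] by simp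
      moreover have "0 \<le> b n x" using elim sup_norm_nonneg[OF C_per_diff[OF tC[OF x, of n] elim(2)]] by simp
      ultimately show "0 \<le> b n x \<and> b n x \<le> 3 * r x" by simp
    qed
  qed
  have b3': "AE x in ?M. (norm (b n x))\<^sup>2 \<le> 9 * (sup_norm (\<phi> x))\<^sup>2" for n
    using b3
  proof eventually_elim
    case (elim x)
    have "0 \<le> b n x \<and> b n x \<le> 3 * r x" using elim by blast
    hence "(norm (b n x))\<^sup>2 \<le> (3 * r x)\<^sup>2" by (intro power_mono) auto
    thus ?case by (simp add: r_def power_mult_distrib)
  qed
  have int9: "integrable ?M (\<lambda>x. 9 * (sup_norm (\<phi> x))\<^sup>2)" using int by simp
  have bsq: "square_integrable ?M (b n)" for n
    by (rule square_integrable_bound[OF bm int9 b3'])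
  have "(\<lambda>n. energy ?M (b n)) \<longlonglongrightarrow> (\<integral>x. 0 \<partial>?M)"
    unfolding energy_def
  proof (rule integral_dominated_convergence[OF _ _ int9])
    show "AE x in ?M. (\<lambda>n. (norm (b n x))\<^sup>2) \<longlonglongrightarrow> 0"
      using bv tlim
    proof eventually_elim
      case (elim x)
      have "(\<lambda>n. (norm (sup_norm (\<lambda>y. t n x y - \<phi> x y)))\<^sup>2) \<longlonglongrightarrow> (norm (0::real))\<^sup>2" by (intro tendsto_intros elim)
      thus ?case using elim(1) by simp
    qed
    show "AE x in ?M. norm ((norm (b n x))\<^sup>2) \<le> 9 * (sup_norm (\<phi> x))\<^sup>2" for n using b3'[of n] by simp
  qed auto
  hence "(\<lambda>n. energy ?M (b n)) \<longlonglongrightarrow> 0" by simp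
  from order_tendstoD(2)[OF this e] obtain n where n: "energy ?M (b n) < e" by (auto simp: eventually_sequentially)
  have "near_uniformly \<Omega> \<phi> (t n) e"
    unfolding near_uniformly_def
  proof (intro exI[of _ "b n"] conjI n bsq)
    show "AE x in ?M. \<forall>y. \<bar>\<phi> x y - t n x y\<bar> \<le> b n x"
      using bv C AE_space
    proof eventually_elim
      case (elim x)
      have x: "x \<in> \<Omega>" using elim by simp
      show ?case using sup_norm_bound[OF C_per_diff[OF tC[OF x, of n] elim(2)]] elim(1) by (simp add: abs_minus_commute)
    qed
  qed
  thus thesis using that ts tC by blast
qed

text \<open>A simple function is a finite sum of indicators times continuous periodic functions; approximate
  each set from the given family and each function by a trigonometric polynomial.\<close>

theorem Bochner_test_approx:
  fixes \<phi> :: "real^3 \<Rightarrow> real^'m \<Rightarrow> real"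
  assumes \<Omega>: "open \<Omega>" "bounded \<Omega>"
    and \<B>: "\<And>A e. A \<in> lmeasurable \<Longrightarrow> e > 0 \<Longrightarrow>
       \<exists>B\<in>\<B>. (A - B) \<union> (B - A) \<in> lmeasurable \<and> measure lebesgue ((A - B) \<union> (B - A)) < e"
    and \<B>ne: "{} \<in> \<B>"
    and \<phi>: "\<phi> \<in> L2_Bochner \<Omega> C_per sup_norm" and e: "e > 0"
  obtains \<psi> where "\<psi> \<in> step_waves \<B>" "near_uniformly \<Omega> \<phi> \<psi> e"
proof -
  let ?M = "lebesgue_on \<Omega>"
  have \<Omega>m: "\<Omega> \<in> lmeasurable" using \<Omega> by (simp add: lmeasurable_open)
  have \<Omega>L: "\<Omega> \<in> sets lebesgue" using \<Omega>m by auto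
  define approx where "approx f \<longleftrightarrow> (\<forall>e>0. \<exists>\<psi>\<in>step_waves \<B>. near_uniformly \<Omega> f \<psi> e)" for f :: "real^3 \<Rightarrow> real^'m \<Rightarrow> real"
  have a_add: "approx (\<lambda>x y. f x y + g x y)" if fg: "approx f" "approx g" for f g
    unfolding approx_def
  proof (intro allI impI)
    fix e :: real assume e: "e > 0"
    hence e4: "e/4 > 0" by simp
    obtain \<psi>1 where p1: "\<psi>1 \<in> step_waves \<B>" "near_uniformly \<Omega> f \<psi>1 (e/4)" using fg(1) e4 unfolding approx_def by blast
    obtain \<psi>2 where p2: "\<psi>2 \<in> step_waves \<B>" "near_uniformly \<Omega> g \<psi>2 (e/4)" using fg(2) e4 unfolding approx_def by blast
    show "\<exists>\<psi>\<in>step_waves \<B>. near_uniformly \<Omega> (\<lambda>x y. f x y + g x y) \<psi> e"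
      using near_uniformly_add[OF p1(2) p2(2)] step_add[OF p1(1) p2(1)] by (rule bexI)
  qed
  have a_base: "approx (\<lambda>x y. indicator A x * f y)" if A: "A \<in> sets ?M" and f: "f \<in> C_per" for A f
    unfolding approx_def
  proof (intro allI impI)
    fix e :: real assume e: "e > 0"
    have Am: "A \<in> lmeasurable" using A \<Omega>m \<Omega>L by (auto simp: sets_lebesgue_on_iff intro: fmeasurableI2)
    let ?m = "measure lebesgue \<Omega>"
    \<comment> \<open>accuracy in y; its contribution to the energy is below e / 4\<close>
    define d where "d = sqrt (e / (4 * (?m + 1)))"
    have m0: "?m + 1 > 0" using measure_nonneg[of lebesgue \<Omega>] by linarith
    have d: "d > 0" using e m0 by (simp add: d_def)
    have d2: "d\<^sup>2 * ?m < e / 4"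
    proof -
      have "d\<^sup>2 = e / (4 * (?m + 1))" using e m0 by (simp add: d_def)
      hence "d\<^sup>2 * ?m = e / 4 * (?m / (?m + 1))" by simp
      also have "\<dots> < e / 4 * 1"
      proof (rule mult_strict_left_mono)
        show "?m / (?m + 1) < 1" using m0 by (subst divide_less_eq_1_pos) auto
      qed (use e in simp)
      finally show ?thesis by simp
    qed
    obtain t where t: "t \<in> trig_poly" "\<And>y. \<bar>f y - t y\<bar> < d" using C_per_uniform_trig_approx[OF f d] by blast
    obtain K where K: "0 \<le> K" "\<And>y. \<bar>f y\<bar> \<le> K" using C_per_bounded[OF f] by blast
    have K1: "4 * (K\<^sup>2 + 1) > 0" by (simp add: add_nonneg_pos)
    hence "e / (4 * (K\<^sup>2 + 1)) > 0" using e by (rule divide_pos_pos[rotated])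
    then obtain B where B: "B \<in> \<B>" "(A - B) \<union> (B - A) \<in> lmeasurable"
      "measure lebesgue ((A - B) \<union> (B - A)) < e / (4 * (K\<^sup>2 + 1))" using \<B>[OF Am] by blast
    let ?D = "(A - B) \<union> (B - A)"
    define b where "b x = K * indicator ?D x + d * indicator \<Omega> x" for x :: "real^3"
    have e1: "square_integrable ?M (\<lambda>x. K * indicator ?D x :: real)" "energy ?M (\<lambda>x. K * indicator ?D x :: real) \<le> K\<^sup>2 * measure lebesgue ?D"
      using energy_indicator[OF \<Omega>L B(2), of K] by auto
    have e2: "square_integrable ?M (\<lambda>x. d * indicator \<Omega> x :: real)" "energy ?M (\<lambda>x. d * indicator \<Omega> x :: real) \<le> d\<^sup>2 * ?m"
      using energy_indicator[OF \<Omega>L \<Omega>m, of d] by auto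
    have "K\<^sup>2 * measure lebesgue ?D \<le> K\<^sup>2 * (e / (4 * (K\<^sup>2 + 1)))" using B(3) by (intro mult_left_mono) auto
    also have "\<dots> = e / 4 * (K\<^sup>2 / (K\<^sup>2 + 1))" by simp
    also have "\<dots> \<le> e / 4 * 1"
    proof (rule mult_left_mono)
      show "K\<^sup>2 / (K\<^sup>2 + 1) \<le> 1" by (subst divide_le_eq_1_pos) (auto simp: add_nonneg_pos)
    qed (use e in simp)
    finally have e3: "K\<^sup>2 * measure lebesgue ?D \<le> e / 4" by simp
    have be: "energy ?M b < e"
      using energy_add_le[OF e1(1) e2(1)] e1(2) e2(2) e3 d2 unfolding b_def by linarith
    have bb: "AE x in ?M. \<forall>y. \<bar>indicator A x * f y - indicator B x * t y\<bar> \<le> b x"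
      using AE_space
    proof eventually_elim
      case (elim x)
      have x: "x \<in> \<Omega>" using elim by simp
      show ?case
      proof
        fix y
        have ft: "\<bar>f y - t y\<bar> \<le> d" using t(2)[of y] by simp
        hence ty: "\<bar>t y\<bar> \<le> K + d" using K(2)[of y] by linarith
        show "\<bar>indicator A x * f y - indicator B x * t y\<bar> \<le> b x"
          using x K(2)[of y] ft ty K(1) d by (auto simp: b_def indicator_def)
      qed
    qed
    have "near_uniformly \<Omega> (\<lambda>x y. indicator A x * f y) (\<lambda>x y. indicator B x * t y) e"
      unfolding near_uniformly_def using be bb square_integrable_add[OF e1(1) e2(1)] unfolding b_def by blast
    thus "\<exists>\<psi>\<in>step_waves \<B>. near_uniformly \<Omega> (\<lambda>x y. indicator A x * f y) \<psi> e"
      using step_trig[OF t(1) B(1)] by (rule bexI)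
  qed
  have a_zero: "approx (\<lambda>x y. 0)"
    unfolding approx_def
  proof (intro allI impI)
    fix e :: real assume "e > 0"
    have "(\<lambda>x y. 0 * (indicator {} x * wave 0 0 y)) \<in> step_waves \<B>"
      by (intro step_scale step_wave \<B>ne integer_vec_0)
    hence "(\<lambda>x y. 0) \<in> step_waves \<B>" by simp
    thus "\<exists>\<psi>\<in>step_waves \<B>. near_uniformly \<Omega> (\<lambda>x y. 0) \<psi> e"
      by (rule bexI[rotated]) (rule near_uniformly_refl[OF \<open>e > 0\<close>])
  qed
  have a_sum: "approx (\<lambda>x y. \<Sum>i\<in>I. F i x y)" if "finite I" "\<And>i. i \<in> I \<Longrightarrow> approx (F i)" for I and F :: "(real^'m \<Rightarrow> real) \<Rightarrow> real^3 \<Rightarrow> real^'m \<Rightarrow> real"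
    using that by (induction I rule: finite_induct) (auto simp: a_zero a_add)
  have e4: "e/4 > 0" using e by simp
  obtain t where t: "simple_function ?M t" "t ` \<Omega> \<subseteq> C_per" "near_uniformly \<Omega> \<phi> t (e/4)"
    using Bochner_near_simple[OF \<phi> e4] by blast
  define h where "h x y = (\<Sum>f\<in>t ` space ?M. indicator (t -` {f} \<inter> space ?M) x * f y)" for x y
  have "approx h" unfolding h_def
    using simple_functionD[OF t(1)] t(2) by (intro a_sum a_base) auto
  then obtain \<psi> where \<psi>: "\<psi> \<in> step_waves \<B>" "near_uniformly \<Omega> h \<psi> (e/4)" using e4 unfolding approx_def by blast
  have th: "t x y = h x y" if "x \<in> space ?M" for x y
  proof -
    have "h x y = (\<Sum>f\<in>t ` space ?M. if f = t x then f y else 0)"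
      unfolding h_def by (rule sum.cong) (use that in \<open>auto simp: indicator_def\<close>)
    also have "\<dots> = t x y" using simple_functionD(1)[OF t(1)] that by simp
    finally show ?thesis by simp
  qed
  have "near_uniformly \<Omega> t \<psi> (e/4)"
  proof -
    obtain b where b: "square_integrable ?M b" "energy ?M b < e/4" "AE x in ?M. \<forall>y. \<bar>h x y - \<psi> x y\<bar> \<le> b x"
      using \<psi>(2) unfolding near_uniformly_def by blast
    have "AE x in ?M. \<forall>y. \<bar>t x y - \<psi> x y\<bar> \<le> b x" using b(3) AE_space by eventually_elim (simp add: th)
    with b show ?thesis unfolding near_uniformly_def by blast
  qed
  from near_uniformly_trans[OF t(3) this] \<psi>(1) show thesis using that by blast
qed

lemma step_waves_mono: "f \<in> step_waves \<A> \<Longrightarrow> \<A> \<subseteq> \<B> \<Longrightarrow> f \<in> step_waves \<B>"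
  by (induction f rule: step_waves.induct) (auto intro: step_waves.intros)

text \<open>Closure under products is what makes the square of a step function accessible to
  oscillation_average.\<close>

lemma step_mult:
  fixes f g :: "real^3 \<Rightarrow> real^'m \<Rightarrow> real"
  shows "f \<in> step_waves (sets lebesgue) \<Longrightarrow> g \<in> step_waves (sets lebesgue) \<Longrightarrow> (\<lambda>x y. f x y * g x y) \<in> step_waves (sets lebesgue)"
proof (induction f rule: step_waves.induct)
  case (step_wave A k j)
  from step_wave(3,1,2) show ?case
  proof (induction g rule: step_waves.induct)
    case (step_wave B l i)
    have "(\<lambda>x y. indicator A x * wave k j y * (indicator B x * wave l i y)) =
        (\<lambda>x y. (1/2) * (indicator (A \<inter> B) x * wave (k + l) (j + i) y) + (1/2) * (indicator (A \<inter> B) x * wave (k - l) (j - i) y))"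
    proof (intro ext)
      fix x :: "real^3" and y :: "real^'m"
      have "indicator A x * wave k j y * (indicator B x * wave l i y) = indicator (A \<inter> B) x * (wave k j y * wave l i y)"
        by (simp add: indicator_inter_arith)
      thus "indicator A x * wave k j y * (indicator B x * wave l i y) =
         (1/2) * (indicator (A \<inter> B) x * wave (k + l) (j + i) y) + (1/2) * (indicator (A \<inter> B) x * wave (k - l) (j - i) y)"
        unfolding wave_mult by (simp add: distrib_left mult.left_commute)
    qed
    moreover have "A \<inter> B \<in> sets lebesgue" using step_wave by blast
    ultimately show ?case
      using step_wave by (simp only:) (intro step_waves.intros integer_vec_add integer_vec_diff; assumption)
  next
    case (step_add f g)
    then show ?case unfolding distrib_left by (intro step_waves.step_add)
  next
    case (step_scale f c)
    then show ?case using step_waves.step_scale[of "\<lambda>x y. indicator A x * wave k j y * f x y" _ c] by (simp add: mult.left_commute)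
  qed
next
  case (step_add f1 f2)
  then show ?case unfolding distrib_right by (intro step_waves.step_add) auto
next
  case (step_scale f c)
  then show ?case using step_waves.step_scale[of "\<lambda>x y. f x y * g x y" _ c] by (simp add: mult.assoc)
qed

lemma step_waves_bounded:
  assumes "f \<in> step_waves \<A>" shows "\<exists>K. \<forall>x y. \<bar>f x y\<bar> \<le> K"
  using assms
proof (induction f rule: step_waves.induct)
  case (step_wave A k j)
  show ?case by (intro exI[of _ 1]) (auto simp: indicator_def wave_def)
next
  case (step_add f g)
  then obtain K L where "\<forall>x y. \<bar>f x y\<bar> \<le> K" "\<forall>x y. \<bar>g x y\<bar> \<le> L" by blast
  hence "\<forall>x y. \<bar>f x y + g x y\<bar> \<le> K + L" by (meson abs_triangle_ineq add_mono order_trans)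
  then show ?case by blast
next
  case (step_scale f c)
  then obtain K where "\<forall>x y. \<bar>f x y\<bar> \<le> K" by blast
  hence "\<forall>x y. \<bar>c * f x y\<bar> \<le> \<bar>c\<bar> * K" by (simp add: abs_mult mult_left_mono)
  then show ?case by blast
qed

lemma step_waves_measurable:
  assumes "f \<in> step_waves (sets lebesgue)" and q: "q \<in> measurable K lebesgue" and p: "p \<in> measurable K borel"
  shows "(\<lambda>z. f (q z) (p z)) \<in> borel_measurable K"
  using assms(1)
proof (induction f rule: step_waves.induct)
  case (step_wave A k j)
  have "(\<lambda>z. indicator A (q z) :: real) \<in> borel_measurable K"
    by (rule measurable_compose[OF q]) (use step_wave in simp)
  moreover have "(\<lambda>z. wave k j (p z)) \<in> borel_measurable K"
    by (rule measurable_compose[OF p C_per_measurable[OF trig_poly_C_per[OF trig_wave]]]) fact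
  ultimately show ?case by (rule borel_measurable_times)
qed (auto intro: borel_measurable_add borel_measurable_times)

section \<open>Two-scale compactness\<close>

text \<open>The standing assumptions on the domain, on the matrix and on the scales; they are inherited by
  subsequences of the scales.\<close>

locale two_scale =
  fixes \<Omega> :: "(real^3) set" and R :: "real^3^'m" and \<eta> :: "nat \<Rightarrow> real"
  assumes open_\<Omega>: "open \<Omega>" and bounded_\<Omega>: "bounded \<Omega>"
    and R_nonresonant: "\<And>k :: real^'m. integer_vec k \<Longrightarrow> k \<noteq> 0 \<Longrightarrow> transpose R *v k \<noteq> 0"
    and \<eta>_pos: "\<And>n. \<eta> n > 0" and \<eta>_0: "\<eta> \<longlonglongrightarrow> 0"
begin

abbreviation "M\<Omega> \<equiv> lebesgue_on \<Omega>"
abbreviation "MY \<equiv> lebesgue_on (Y_cell :: (real^'m) set)"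
abbreviation "M\<Omega>Y \<equiv> lebesgue_on (\<Omega> \<times> (Y_cell :: (real^'m) set))"

lemma \<Omega>_lmeasurable: "\<Omega> \<in> lmeasurable" using open_\<Omega> bounded_\<Omega> by (simp add: lmeasurable_open)
lemma \<Omega>_lebesgue: "\<Omega> \<in> sets lebesgue" using \<Omega>_lmeasurable by auto
lemma \<Omega>_borel: "\<Omega> \<in> sets borel" using open_\<Omega> by simp
lemma \<Omega>Y_lmeasurable: "\<Omega> \<times> (Y_cell :: (real^'m) set) \<in> lmeasurable"
  by (rule lmeasurable_Times_cell[OF open_\<Omega> bounded_\<Omega>])
lemma \<Omega>Y_lebesgue: "\<Omega> \<times> (Y_cell :: (real^'m) set) \<in> sets lebesgue" using \<Omega>Y_lmeasurable by auto
lemma AE_fst: "AE x in M\<Omega>. P x \<Longrightarrow> AE z in M\<Omega>Y. P (fst z)"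
  by (rule AE_lebesgue_on_fst[OF \<Omega>_borel Y_cell_borel])

definition fast :: "nat \<Rightarrow> real^3 \<Rightarrow> real^'m" where "fast n x = (1 / \<eta> n) *\<^sub>R (R *v x)"

lemma fast_measurable: "fast n \<in> measurable M\<Omega> borel"
proof -
  have "continuous_on UNIV (fast n)" unfolding fast_def[abs_def] by (auto intro!: continuous_intros)
  hence "fast n \<in> borel_measurable borel" by (rule borel_measurable_continuous_onI)
  thus ?thesis by (intro measurable_restrict_space1 measurable_completion) simp
qed

lemma id_measurable: "(\<lambda>x. x) \<in> measurable M\<Omega> lebesgue"
  by (intro measurable_restrict_space1 measurable_ident[unfolded id_def])

lemma fst_measurable: "fst \<in> measurable M\<Omega>Y lebesgue"
  by (intro measurable_restrict_space1 fst_lebesgue_measurable)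

lemma step_fast_measurable:
  "f \<in> step_waves (sets lebesgue) \<Longrightarrow> (\<lambda>x. f x (fast n x)) \<in> borel_measurable M\<Omega>"
  by (rule step_waves_measurable[OF _ id_measurable fast_measurable])

lemma step_pair_measurable:
  "f \<in> step_waves (sets lebesgue) \<Longrightarrow> (\<lambda>z. f (fst z) (snd z)) \<in> borel_measurable M\<Omega>Y"
  by (rule step_waves_measurable[OF _ fst_measurable snd_lebesgue_on_measurable])

lemma step_fast_integrable:
  assumes "f \<in> step_waves (sets lebesgue)"
  shows "integrable M\<Omega> (\<lambda>x. f x (fast n x))" "square_integrable M\<Omega> (\<lambda>x. f x (fast n x))"
proof -
  obtain K where K: "\<And>x y. \<bar>f x y\<bar> \<le> K" using step_waves_bounded[OF assms] by blast
  show "integrable M\<Omega> (\<lambda>x. f x (fast n x))"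
    by (rule integrable_bounded_on[OF \<Omega>_lmeasurable step_fast_measurable[OF assms] K])
  show "square_integrable M\<Omega> (\<lambda>x. f x (fast n x))"
    by (rule square_integrable_bounded_on[OF \<Omega>_lmeasurable step_fast_measurable[OF assms]]) (use K in simp)
qed

lemma step_pair_integrable:
  assumes "f \<in> step_waves (sets lebesgue)"
  shows "integrable M\<Omega>Y (\<lambda>z. f (fst z) (snd z))" "square_integrable M\<Omega>Y (\<lambda>z. f (fst z) (snd z))"
proof -
  obtain K where K: "\<And>x y. \<bar>f x y\<bar> \<le> K" using step_waves_bounded[OF assms] by blast
  show "integrable M\<Omega>Y (\<lambda>z. f (fst z) (snd z))"
    by (rule integrable_bounded_on[OF \<Omega>Y_lmeasurable step_pair_measurable[OF assms] K])
  show "square_integrable M\<Omega>Y (\<lambda>z. f (fst z) (snd z))"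
    by (rule square_integrable_bounded_on[OF \<Omega>Y_lmeasurable step_pair_measurable[OF assms]]) (use K in simp)
qed

text \<open>Fubini's theorem, after replacing the indicator of the measurable set A by a Borel function.\<close>

lemma integral_step_wave:
  assumes A: "A \<in> sets lebesgue" and k: "integer_vec k"
  shows "(\<integral>z. indicator A (fst z) * wave k j (snd z) \<partial>M\<Omega>Y) = measure lebesgue (A \<inter> \<Omega>) * (\<integral>y. wave k j y \<partial>MY)"
proof -
  have Am: "(indicator A :: real^3 \<Rightarrow> real) \<in> borel_measurable M\<Omega>" using A by (intro measurable_restrict_space1) simp
  obtain g where g[measurable]: "g \<in> borel_measurable borel" and ge: "AE x in M\<Omega>. indicator A x = (g x :: real)"
    using borel_representative[OF \<Omega>_borel Am] by blast
  have W[measurable]: "wave k j \<in> borel_measurable borel" by (rule C_per_measurable[OF trig_poly_C_per[OF trig_wave[OF k]]])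
  have f0: "(\<lambda>x y. indicator A x * wave k j y) \<in> step_waves (sets lebesgue)" by (rule step_wave[OF A k])
  have ae: "AE z in M\<Omega>Y. indicator A (fst z) * wave k j (snd z) = g (fst z) * wave k j (snd z)"
    using AE_fst[OF ge] by eventually_elim simp
  have gm: "(\<lambda>z. g (fst z) * wave k j (snd z)) \<in> borel_measurable borel"
    unfolding borel_prod[symmetric] by measurable
  have gm': "(\<lambda>z. g (fst z) * wave k j (snd z)) \<in> borel_measurable M\<Omega>Y"
    using gm by (intro measurable_restrict_space1 measurable_completion) simp
  have gi: "integrable M\<Omega>Y (\<lambda>z. g (fst z) * wave k j (snd z))"
    using step_pair_integrable(1)[OF f0] ae gm' step_pair_measurable[OF f0] by (subst (asm) integrable_cong_AE) auto
  have gM: "g \<in> borel_measurable M\<Omega>" by (intro measurable_restrict_space1 measurable_completion) simp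
  have "(\<integral>z. indicator A (fst z) * wave k j (snd z) \<partial>M\<Omega>Y) = (\<integral>z. g (fst z) * wave k j (snd z) \<partial>M\<Omega>Y)"
    by (rule integral_cong_AE[OF step_pair_measurable[OF f0] gm' ae])
  also have "\<dots> = (\<integral>x. (\<integral>y. g x * wave k j y \<partial>MY) \<partial>M\<Omega>)"
    using Fubini_lebesgue_on(1)[OF \<Omega>_borel Y_cell_borel gm gi] by simp
  also have "\<dots> = (\<integral>x. g x \<partial>M\<Omega>) * (\<integral>y. wave k j y \<partial>MY)" by simp
  also have "(\<integral>x. g x \<partial>M\<Omega>) = (\<integral>x. indicator A x \<partial>M\<Omega>)"
    by (rule integral_cong_AE[OF gM Am]) (use ge in \<open>auto elim!: eventually_mono\<close>)
  also have "(\<integral>x. indicator A x \<partial>M\<Omega>) = measure lebesgue (A \<inter> \<Omega>)"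
  proof -
    have "(\<integral>x. indicator A x \<partial>M\<Omega>) = (\<integral>x. indicator \<Omega> x * indicator A x \<partial>lebesgue :: real)"
      by (rule integral_lebesgue_on[OF \<Omega>_lebesgue])
    also have "\<dots> = (\<integral>x. indicator (A \<inter> \<Omega>) x \<partial>lebesgue)" by (simp add: indicator_inter_arith mult.commute)
    finally show ?thesis by simp
  qed
  finally show ?thesis .
qed

lemma step_waves_average:
  assumes "f \<in> step_waves (sets lebesgue)"
  shows "(\<lambda>n. \<integral>x. f x (fast n x) \<partial>M\<Omega>) \<longlonglongrightarrow> (\<integral>z. f (fst z) (snd z) \<partial>M\<Omega>Y)"
  using assms
proof (induction f rule: step_waves.induct)
  case (step_wave A k j)
  have m: "A \<inter> \<Omega> \<in> lmeasurable" using \<Omega>_lmeasurable step_wave(1) by (metis fmeasurable_Int_fmeasurable inf_commute)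
  have "(\<integral>x. indicator A x * wave k j (fast n x) \<partial>M\<Omega>) = (\<integral>x. indicator (A \<inter> \<Omega>) x * wave k j ((1 / \<eta> n) *\<^sub>R (R *v x)) \<partial>lebesgue)" for n
    by (subst integral_lebesgue_on[OF \<Omega>_lebesgue]) (simp add: fast_def indicator_inter_arith mult_ac)
  thus ?case
    using oscillation_average[OF R_nonresonant \<eta>_pos \<eta>_0 trig_wave[OF step_wave(2)] m, of j]
    by (simp add: integral_step_wave[OF step_wave])
next
  case (step_add f g)
  then show ?case using step_fast_integrable(1)[OF step_add(1)] step_fast_integrable(1)[OF step_add(2)]
      step_pair_integrable(1)[OF step_add(1)] step_pair_integrable(1)[OF step_add(2)]
      tendsto_add[OF step_add.IH] by simp
next
  case (step_scale f c)
  then show ?case using tendsto_mult_left[OF step_scale.IH, of c] by simp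
qed

lemma test_fast_measurable:
  "\<phi> \<in> L2_Bochner \<Omega> C_per sup_norm \<Longrightarrow> (\<lambda>x. \<phi> x (fast n x)) \<in> borel_measurable M\<Omega>"
  by (rule Bochner_test_eval_measurable[OF _ \<Omega>_lebesgue measurable_ident[unfolded id_def] fast_measurable])

lemma test_pair_measurable:
  "\<phi> \<in> L2_Bochner \<Omega> C_per sup_norm \<Longrightarrow> (\<lambda>z. \<phi> (fst z) (snd z)) \<in> borel_measurable M\<Omega>Y"
  by (rule Bochner_test_eval_measurable[OF _ \<Omega>Y_lebesgue fst_lebesgue_on_measurable[OF \<Omega>_borel Y_cell_borel] snd_lebesgue_on_measurable AE_fst])

text \<open>The bound does not depend on n, since closeness is uniform in y.\<close>

lemma near_uniformly_fast:
  assumes f: "(\<lambda>x. f x (fast n x)) \<in> borel_measurable M\<Omega>" and g: "(\<lambda>x. g x (fast n x)) \<in> borel_measurable M\<Omega>"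
    and near: "near_uniformly \<Omega> f g e"
  shows "square_integrable M\<Omega> (\<lambda>x. f x (fast n x) - g x (fast n x)) \<and>
    energy M\<Omega> (\<lambda>x. f x (fast n x) - g x (fast n x)) \<le> e"
proof -
  obtain b where b: "square_integrable M\<Omega> b" "energy M\<Omega> b < e" "AE x in M\<Omega>. \<forall>y. \<bar>f x y - g x y\<bar> \<le> b x"
    using near unfolding near_uniformly_def by blast
  have "AE x in M\<Omega>. norm (f x (fast n x) - g x (fast n x)) \<le> b x" using b(3) by eventually_elim simp
  from square_integrable_dominated[OF borel_measurable_diff[OF f g] b(1) this] b(2) show ?thesis by auto
qed

lemma near_uniformly_pair:
  assumes f: "(\<lambda>z. f (fst z) (snd z)) \<in> borel_measurable M\<Omega>Y" and g: "(\<lambda>z. g (fst z) (snd z)) \<in> borel_measurable M\<Omega>Y"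
    and near: "near_uniformly \<Omega> f g e"
  shows "square_integrable M\<Omega>Y (\<lambda>z. f (fst z) (snd z) - g (fst z) (snd z)) \<and>
    energy M\<Omega>Y (\<lambda>z. f (fst z) (snd z) - g (fst z) (snd z)) \<le> e"
proof -
  obtain b where b: "square_integrable M\<Omega> b" "energy M\<Omega> b < e" "AE x in M\<Omega>. \<forall>y. \<bar>f x y - g x y\<bar> \<le> b x"
    using near unfolding near_uniformly_def by blast
  have "AE z in M\<Omega>Y. norm (f (fst z) (snd z) - g (fst z) (snd z)) \<le> b (fst z)"
    using AE_fst[OF b(3)] by eventually_elim simp
  moreover note square_integrable_fst[OF \<Omega>_borel Y_cell_borel emeasure_Y_cell[where 'm='m] b(1)]
  ultimately show ?thesis using square_integrable_dominated[OF borel_measurable_diff[OF f g]] b(2)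
    by (meson less_imp_le order_trans)
qed

text \<open>The limit functional on the span is bounded by the norm of the product space: Cauchy-Schwarz
  bounds it by the mean square of the oscillating test function, and that mean square converges to
  the energy over the product. Riesz representation gives g, and a three-term estimate extends the
  convergence to all test functions.\<close>

theorem two_scale_limit_exists:
  fixes v :: "nat \<Rightarrow> real^3 \<Rightarrow> real"
  assumes \<B>: "\<And>A e. A \<in> lmeasurable \<Longrightarrow> e > 0 \<Longrightarrow>
       \<exists>B\<in>\<B>. (A - B) \<union> (B - A) \<in> lmeasurable \<and> measure lebesgue ((A - B) \<union> (B - A)) < e"
    and \<B>ne: "{} \<in> \<B>" and \<B>L: "\<B> \<subseteq> sets lebesgue"
    and v: "\<And>n. square_integrable M\<Omega> (v n)" and C: "\<And>n. energy M\<Omega> (v n) \<le> C"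
    and conv: "\<And>B k j. B \<in> \<B> \<Longrightarrow> integer_vec k \<Longrightarrow>
       convergent (\<lambda>n. \<integral>x. v n x * (indicator B x * wave k j (fast n x)) \<partial>M\<Omega>)"
  obtains g where "square_integrable M\<Omega>Y g" "weak_two_scale \<Omega> R \<eta> v (\<lambda>x y. g (x, y))"
proof -
  have C0: "0 \<le> C" using C[of 0] energy_nonneg[of M\<Omega> "v 0"] by linarith
  define V where "V = (step_waves \<B> :: (real^3 \<Rightarrow> real^'m \<Rightarrow> real) set)"
  have VW: "f \<in> V \<Longrightarrow> f \<in> step_waves (sets lebesgue)" for f
    unfolding V_def by (rule step_waves_mono[OF _ \<B>L])
  define I where "I n f = (\<integral>x. v n x * f x (fast n x) \<partial>M\<Omega>)" for n f
  have int: "f \<in> V \<Longrightarrow> integrable M\<Omega> (\<lambda>x. v n x * f x (fast n x))" for f n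
    by (rule integrable_mult[OF v step_fast_integrable(2)[OF VW]])
  have I_add: "I n (\<lambda>x y. f x y + g x y) = I n f + I n g" if "f \<in> V" "g \<in> V" for f g n
    unfolding I_def using int[OF that(1)] int[OF that(2)] by (simp add: distrib_left)
  have I_scale: "I n (\<lambda>x y. c * f x y) = c * I n f" for f n c
    unfolding I_def by (simp add: mult.left_commute)
  have Iconv: "convergent (\<lambda>n. I n f)" if "f \<in> V" for f
    using that unfolding V_def
  proof (induction f rule: step_waves.induct)
    case (step_wave A k j)
    then show ?case unfolding I_def by (rule conv)
  next
    case (step_add f g)
    then show ?case using I_add[of f g] convergent_add by (simp add: V_def)
  next
    case (step_scale f c)
    then show ?case using convergent_mult[OF convergent_const, of "\<lambda>n. I n f" c] by (simp add: I_scale)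
  qed
  define L where "L f = lim (\<lambda>n. I n f)" for f
  have Llim: "f \<in> V \<Longrightarrow> (\<lambda>n. I n f) \<longlonglongrightarrow> L f" for f
    unfolding L_def using Iconv convergent_LIMSEQ_iff by blast
  have I_CS: "(I n f)\<^sup>2 \<le> C * (\<integral>x. f x (fast n x) * f x (fast n x) \<partial>M\<Omega>)" if "f \<in> V" for f n
  proof -
    have "(I n f)\<^sup>2 \<le> energy M\<Omega> (v n) * energy M\<Omega> (\<lambda>x. f x (fast n x))"
      using Cauchy_Schwarz_integral[OF v step_fast_integrable(2)[OF VW[OF that]], of n n] by (simp add: I_def)
    also have "\<dots> \<le> C * energy M\<Omega> (\<lambda>x. f x (fast n x))" by (rule mult_right_mono[OF C]) simp
    finally show ?thesis by (simp add: energy_def power2_eq_square)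
  qed
  have L_bound: "(L f)\<^sup>2 \<le> C * energy M\<Omega>Y (\<lambda>z. f (fst z) (snd z))" if f: "f \<in> V" for f
  proof -
    have "(\<lambda>n. (I n f)\<^sup>2) \<longlonglongrightarrow> (L f)\<^sup>2" by (intro tendsto_intros Llim f)
    moreover have "(\<lambda>n. C * (\<integral>x. f x (fast n x) * f x (fast n x) \<partial>M\<Omega>)) \<longlonglongrightarrow> C * (\<integral>z. f (fst z) (snd z) * f (fst z) (snd z) \<partial>M\<Omega>Y)"
      by (intro tendsto_intros step_waves_average[OF step_mult[OF VW[OF f] VW[OF f]]])
    ultimately have "(L f)\<^sup>2 \<le> C * (\<integral>z. f (fst z) (snd z) * f (fst z) (snd z) \<partial>M\<Omega>Y)"
      by (rule LIMSEQ_le) (use I_CS[OF f] in blast)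
    thus ?thesis by (simp add: energy_def power2_eq_square)
  qed
  define V' where "V' = (\<lambda>f z. f (fst z) (snd z)) ` V"
  have V'D: "(\<lambda>x y. F (x, y)) \<in> V" if "F \<in> V'" for F using that unfolding V'_def by auto
  have V'I: "F \<in> V'" if "(\<lambda>x y. F (x, y)) \<in> V" for F
    unfolding V'_def using that by (intro image_eqI) auto
  obtain g where g: "square_integrable M\<Omega>Y g" and gL: "\<And>F. F \<in> V' \<Longrightarrow> L (\<lambda>x y. F (x, y)) = (\<integral>z. g z * F z \<partial>M\<Omega>Y)"
  proof (rule Riesz_on_subspace[of V' M\<Omega>Y "\<lambda>F. L (\<lambda>x y. F (x, y))" C])
    show "square_integrable M\<Omega>Y F" if "F \<in> V'" for F
      using that step_pair_integrable(2) VW unfolding V'_def by auto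
    have "(\<lambda>x y. indicator {} x * wave 0 0 y) \<in> V" unfolding V_def by (rule step_wave[OF \<B>ne integer_vec_0])
    thus "V' \<noteq> {}" unfolding V'_def by blast
    show "(\<lambda>z. F z + G z) \<in> V'" if "F \<in> V'" "G \<in> V'" for F G
      by (rule V'I) (use V'D[OF that(1)] V'D[OF that(2)] in \<open>simp add: V_def step_add\<close>)
    show "(\<lambda>z. c * F z) \<in> V'" if "F \<in> V'" for F c
      by (rule V'I) (use V'D[OF that] in \<open>simp add: V_def step_scale\<close>)
    show "L (\<lambda>x y. F (x, y) + G (x, y)) = L (\<lambda>x y. F (x, y)) + L (\<lambda>x y. G (x, y))" if "F \<in> V'" "G \<in> V'" for F G
    proof -
      have "(\<lambda>n. I n (\<lambda>x y. F (x, y) + G (x, y))) \<longlonglongrightarrow> L (\<lambda>x y. F (x, y)) + L (\<lambda>x y. G (x, y))"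
        unfolding I_add[OF V'D[OF that(1)] V'D[OF that(2)]] by (intro tendsto_add Llim V'D that)
      thus ?thesis unfolding L_def[of "\<lambda>x y. F (x, y) + G (x, y)"] by (rule limI)
    qed
    show "L (\<lambda>x y. c * F (x, y)) = c * L (\<lambda>x y. F (x, y))" if "F \<in> V'" for F c
    proof -
      have "(\<lambda>n. I n (\<lambda>x y. c * F (x, y))) \<longlonglongrightarrow> c * L (\<lambda>x y. F (x, y))"
        unfolding I_scale by (intro tendsto_mult_left Llim V'D that)
      thus ?thesis unfolding L_def[of "\<lambda>x y. c * F (x, y)"] by (rule limI)
    qed
    show "(L (\<lambda>x y. F (x, y)))\<^sup>2 \<le> C * energy M\<Omega>Y F" if "F \<in> V'" for F
      using L_bound[OF V'D[OF that]] by simp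
  qed blast
  have gV: "(\<lambda>n. I n f) \<longlonglongrightarrow> (\<integral>z. g z * f (fst z) (snd z) \<partial>M\<Omega>Y)" if "f \<in> V" for f
    using Llim[OF that] gL[of "\<lambda>z. f (fst z) (snd z)"] that by (simp add: V'_def)
  have main: "(\<lambda>n. I n \<phi>) \<longlonglongrightarrow> (\<integral>z. g z * \<phi> (fst z) (snd z) \<partial>M\<Omega>Y)" if \<phi>: "\<phi> \<in> L2_Bochner \<Omega> C_per sup_norm" for \<phi> :: "real^3 \<Rightarrow> real^'m \<Rightarrow> real"
  proof (rule LIMSEQ_I)
    fix e :: real assume e: "e > 0"
    let ?K = "C + energy M\<Omega>Y g + 1"
    have K: "?K > 0" using C0 energy_nonneg[of M\<Omega>Y g] by linarith
    \<comment> \<open>by Cauchy-Schwarz, energies at most K and d give a product at most e / 3\<close>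
    define d where "d = (e / 3)\<^sup>2 / ?K"
    have d: "d > 0" using e K by (simp add: d_def)
    have small: "\<bar>\<integral>z. a z * c z \<partial>N\<bar> \<le> e / 3" if "square_integrable N a" "square_integrable N c" "energy N a \<le> ?K" "energy N c \<le> d"
      for N :: "'w measure" and a c :: "'w \<Rightarrow> real"
    proof -
      have "\<bar>\<integral>z. a z * c z \<partial>N\<bar> \<le> sqrt (energy N a) * sqrt (energy N c)" by (rule Cauchy_Schwarz_integral_real[OF that(1,2)])
      also have "\<dots> \<le> sqrt ?K * sqrt d" using that(3,4) K by (intro mult_mono real_sqrt_le_mono) auto
      also have "\<dots> = sqrt (?K * d)" by (simp add: real_sqrt_mult)
      also have "?K * d = (e / 3)\<^sup>2" using K by (simp add: d_def)
      finally show ?thesis using e by simp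
    qed
    obtain \<psi> where \<psi>: "\<psi> \<in> V" "near_uniformly \<Omega> \<phi> \<psi> d"
      using Bochner_test_approx[OF open_\<Omega> bounded_\<Omega> \<B> \<B>ne \<phi> d] unfolding V_def by blast
    have nf: "square_integrable M\<Omega> (\<lambda>x. \<phi> x (fast n x) - \<psi> x (fast n x))" "energy M\<Omega> (\<lambda>x. \<phi> x (fast n x) - \<psi> x (fast n x)) \<le> d" for n
      using near_uniformly_fast[OF test_fast_measurable[OF \<phi>] step_fast_measurable[OF VW[OF \<psi>(1)]] \<psi>(2)] by auto
    have np: "square_integrable M\<Omega>Y (\<lambda>z. \<phi> (fst z) (snd z) - \<psi> (fst z) (snd z))" "energy M\<Omega>Y (\<lambda>z. \<phi> (fst z) (snd z) - \<psi> (fst z) (snd z)) \<le> d"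
      using near_uniformly_pair[OF test_pair_measurable[OF \<phi>] step_pair_measurable[OF VW[OF \<psi>(1)]] \<psi>(2)] by auto
    have d1: "\<bar>I n \<phi> - I n \<psi>\<bar> \<le> e / 3" for n
    proof -
      have "integrable M\<Omega> (\<lambda>x. v n x * (\<phi> x (fast n x) - \<psi> x (fast n x)) + v n x * \<psi> x (fast n x))"
        by (intro Bochner_Integration.integrable_add integrable_mult[OF v nf(1)] int \<psi>)
      hence "integrable M\<Omega> (\<lambda>x. v n x * \<phi> x (fast n x))" by (simp add: algebra_simps)
      hence "I n \<phi> - I n \<psi> = (\<integral>x. v n x * (\<phi> x (fast n x) - \<psi> x (fast n x)) \<partial>M\<Omega>)"
        using int[OF \<psi>(1), of n] by (simp add: I_def right_diff_distrib)
      moreover have "energy M\<Omega> (v n) \<le> ?K" using C[of n] energy_nonneg[of M\<Omega>Y g] by linarith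
      ultimately show ?thesis using small[OF v nf(1) _ nf(2)] by simp
    qed
    have ip: "integrable M\<Omega>Y (\<lambda>z. g z * \<psi> (fst z) (snd z))"
      by (rule integrable_mult[OF g step_pair_integrable(2)[OF VW[OF \<psi>(1)]]])
    have d2: "\<bar>(\<integral>z. g z * \<phi> (fst z) (snd z) \<partial>M\<Omega>Y) - (\<integral>z. g z * \<psi> (fst z) (snd z) \<partial>M\<Omega>Y)\<bar> \<le> e / 3"
    proof -
      have "integrable M\<Omega>Y (\<lambda>z. g z * (\<phi> (fst z) (snd z) - \<psi> (fst z) (snd z)) + g z * \<psi> (fst z) (snd z))"
        by (intro Bochner_Integration.integrable_add integrable_mult[OF g np(1)] ip)
      hence "integrable M\<Omega>Y (\<lambda>z. g z * \<phi> (fst z) (snd z))" by (simp add: algebra_simps)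
      hence "(\<integral>z. g z * \<phi> (fst z) (snd z) \<partial>M\<Omega>Y) - (\<integral>z. g z * \<psi> (fst z) (snd z) \<partial>M\<Omega>Y)
          = (\<integral>z. g z * (\<phi> (fst z) (snd z) - \<psi> (fst z) (snd z)) \<partial>M\<Omega>Y)"
        using ip by (simp add: right_diff_distrib)
      moreover have "energy M\<Omega>Y g \<le> ?K" using C0 by linarith
      ultimately show ?thesis using small[OF g np(1) _ np(2)] by simp
    qed
    from LIMSEQ_D[OF gV[OF \<psi>(1)], of "e/3"] e obtain no where
      no: "\<And>n. n \<ge> no \<Longrightarrow> \<bar>I n \<psi> - (\<integral>z. g z * \<psi> (fst z) (snd z) \<partial>M\<Omega>Y)\<bar> < e / 3" by auto
    show "\<exists>no. \<forall>n\<ge>no. norm (I n \<phi> - (\<integral>z. g z * \<phi> (fst z) (snd z) \<partial>M\<Omega>Y)) < e"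
    proof (intro exI[of _ no] allI impI)
      fix n assume "n \<ge> no"
      from no[OF this] d1[of n] d2
      show "norm (I n \<phi> - (\<integral>z. g z * \<phi> (fst z) (snd z) \<partial>M\<Omega>Y)) < e" unfolding real_norm_def by linarith
    qed
  qed
  have "weak_two_scale \<Omega> R \<eta> v (\<lambda>x y. g (x, y))"
    unfolding weak_two_scale_def
  proof (intro conjI allI ballI)
    show "v n \<in> L2_on \<Omega>" for n using v[of n] by (simp add: L2_on_def square_integrable_def)
    show "(\<lambda>(x, y). g (x, y)) \<in> L2_on (\<Omega> \<times> Y_cell)" using g by (simp add: L2_on_def square_integrable_def)
    show "(\<lambda>n. \<integral>x. v n x * \<phi> x ((1 / \<eta> n) *\<^sub>R (R *v x)) \<partial>M\<Omega>) \<longlonglongrightarrow> (\<integral>(x, y). g (x, y) * \<phi> x y \<partial>M\<Omega>Y)"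
      if "\<phi> \<in> L2_Bochner \<Omega> C_per sup_norm" for \<phi>
    proof -
      have "(\<integral>(x, y). g (x, y) * \<phi> x y \<partial>M\<Omega>Y) = (\<integral>z. g z * \<phi> (fst z) (snd z) \<partial>M\<Omega>Y)"
        by (rule Bochner_Integration.integral_cong) auto
      thus ?thesis using main[OF that] by (simp add: I_def fast_def)
    qed
  qed
  with g show thesis by (rule that)
qed

end

lemma two_scale_subseq:
  assumes "two_scale \<Omega> R \<eta>" "strict_mono (r :: nat \<Rightarrow> nat)"
  shows "two_scale \<Omega> R (\<eta> \<circ> r)"
proof -
  interpret two_scale \<Omega> R \<eta> by (rule assms(1))
  show ?thesis
    by unfold_locales (use open_\<Omega> bounded_\<Omega> R_nonresonant \<eta>_pos LIMSEQ_subseq_LIMSEQ[OF \<eta>_0 assms(2)] in auto)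
qed

lemma diagonal_convergent_subsequence:
  fixes a :: "'i \<Rightarrow> nat \<Rightarrow> real"
  assumes I: "countable I" and bdd: "\<And>i. i \<in> I \<Longrightarrow> bounded (range (a i))"
  obtains r :: "nat \<Rightarrow> nat" where "strict_mono r" "\<And>i. i \<in> I \<Longrightarrow> convergent (\<lambda>n. a i (r n))"
proof (cases "I = {}")
  case True
  then show thesis using that[of id] by (simp add: strict_mono_id)
next
  case False
  define P where "P n s \<longleftrightarrow> convergent (\<lambda>j. a (from_nat_into I n) (s j))" for n and s :: "nat \<Rightarrow> nat"
  interpret subseqs P
  proof
    fix n and s :: "nat \<Rightarrow> nat" assume "strict_mono s"
    have "bounded (range (a (from_nat_into I n)))" by (rule bdd[OF from_nat_into[OF False]])
    hence "bounded (range (\<lambda>j. a (from_nat_into I n) (s j)))" by (rule bounded_subset) auto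
    from bounded_imp_convergent_subsequence[OF this] obtain l r where "strict_mono r" "((\<lambda>j. a (from_nat_into I n) (s j)) \<circ> r) \<longlonglongrightarrow> l" by blast
    thus "\<exists>r'. strict_mono r' \<and> P n (s \<circ> r')" unfolding P_def convergent_def by (auto simp: o_def)
  qed
  have stable: "P n (s \<circ> r)" if "strict_mono r" "P n s" for r s n
    using that convergent_subseq_convergent[of "\<lambda>j. a (from_nat_into I n) (s j)" r] by (simp add: P_def o_def)
  have "convergent (\<lambda>n. a i (diagseq n))" if "i \<in> I" for i
  proof -
    obtain k where k: "i = from_nat_into I k" using from_nat_into_surj[OF I \<open>i \<in> I\<close>] by metis
    have "P k (diagseq \<circ> (+) (Suc k))" by (rule diagseq_holds[OF stable])
    then obtain l where "(\<lambda>j. a i (diagseq (j + Suc k))) \<longlonglongrightarrow> l" unfolding P_def convergent_def k by (auto simp: o_def add.commute)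
    hence "(\<lambda>j. a i (diagseq j)) \<longlonglongrightarrow> l" by (rule LIMSEQ_offset)
    thus ?thesis by (auto simp: convergent_def)
  qed
  with subseq_diagseq show thesis by (rule that)
qed

lemma countable_integer_vec: "countable {k :: real^'m. integer_vec k}"
proof -
  have "{k :: real^'m. integer_vec k} \<subseteq> range (\<lambda>f :: 'm \<Rightarrow> int. \<chi> i. of_int (f i))"
  proof
    fix k :: "real^'m" assume "k \<in> {k. integer_vec k}"
    hence "k = (\<chi> i. of_int \<lfloor>k $ i\<rfloor>)" by (auto simp: integer_vec_def vec_eq_iff)
    thus "k \<in> range (\<lambda>f :: 'm \<Rightarrow> int. \<chi> i. of_int (f i))"
      by (rule range_eqI[where x="\<lambda>i. \<lfloor>k $ i\<rfloor>"])
  qed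
  thus ?thesis by (rule countable_subset) simp
qed

text \<open>One diagonal subsequence serves all indices in J, all sets of the approximating family and all
  waves.\<close>

theorem two_scale_compactness:
  fixes v :: "'i \<Rightarrow> nat \<Rightarrow> real^3 \<Rightarrow> real" and R :: "real^3^'m"
  assumes "two_scale \<Omega> R \<eta>" and J: "countable J"
    and v: "\<And>i n. i \<in> J \<Longrightarrow> square_integrable (lebesgue_on \<Omega>) (v i n)" and C: "\<And>i n. i \<in> J \<Longrightarrow> energy (lebesgue_on \<Omega>) (v i n) \<le> C i"
  obtains r g where "strict_mono r"
    "\<And>i. i \<in> J \<Longrightarrow> square_integrable (lebesgue_on (\<Omega> \<times> (Y_cell :: (real^'m) set))) (g i)"
    "\<And>i. i \<in> J \<Longrightarrow> weak_two_scale \<Omega> R (\<eta> \<circ> r) (v i \<circ> r) (\<lambda>x y. g i (x, y))"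
proof -
  interpret two_scale \<Omega> R \<eta> by (rule assms(1))
  obtain \<B>' :: "(real^3) set set" where B': "countable \<B>'" "\<And>B. B \<in> \<B>' \<Longrightarrow> open B"
    "\<And>A e. A \<in> lmeasurable \<Longrightarrow> e > 0 \<Longrightarrow>
       \<exists>B\<in>\<B>'. (A - B) \<union> (B - A) \<in> lmeasurable \<and> measure lebesgue ((A - B) \<union> (B - A)) < e"
    using countable_approximating_family by blast
  define \<B> where "\<B> = insert {} \<B>'"
  have B: "countable \<B>" "{} \<in> \<B>" "\<B> \<subseteq> sets lebesgue" using B'(1,2) by (auto simp: \<B>_def)
  have B3: "\<exists>B\<in>\<B>. (A - B) \<union> (B - A) \<in> lmeasurable \<and> measure lebesgue ((A - B) \<union> (B - A)) < e" if "A \<in> lmeasurable" "e > 0" for A e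
    using B'(3)[OF that] by (auto simp: \<B>_def)
  define a where "a = (\<lambda>(i, B, k, j) n. \<integral>x. v i n x * (indicator B x * wave k j (fast n x)) \<partial>lebesgue_on \<Omega>)"
  define I where "I = J \<times> \<B> \<times> {k :: real^'m. integer_vec k} \<times> (UNIV :: int set)"
  have cI: "countable I" unfolding I_def using J B(1) countable_integer_vec by auto
  have bI: "bounded (range (a p))" if p: "p \<in> I" for p
  proof -
    obtain i B k j where pp: "p = (i, B, k, j)" "i \<in> J" "B \<in> \<B>" "integer_vec k" using p unfolding I_def by auto
    have st: "(\<lambda>x y. indicator B x * wave k j y) \<in> step_waves (sets lebesgue)"
      using pp B(3) by (intro step_wave) auto
    have "\<bar>a p n\<bar> \<le> sqrt (C i) * sqrt (measure lebesgue \<Omega>)" for n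
    proof -
      let ?w = "\<lambda>x. indicator B x * wave k j (fast n x)"
      have e1: "energy M\<Omega> ?w \<le> measure lebesgue \<Omega>"
      proof -
        have "energy M\<Omega> ?w \<le> (\<integral>x. 1 \<partial>M\<Omega>)"
          unfolding energy_def
        proof (rule integral_mono)
          show "integrable M\<Omega> (\<lambda>x. (norm (?w x))\<^sup>2)" using step_fast_integrable(2)[OF st, of n] by (simp add: square_integrable_def)
          show "integrable M\<Omega> (\<lambda>x. 1 :: real)" by (rule integrable_bounded_on[OF \<Omega>_lmeasurable, where B=1]) auto
          show "(norm (?w x))\<^sup>2 \<le> 1" for x
          proof -
            have "norm (?w x) \<le> 1" by (auto simp: indicator_def wave_def)
            thus ?thesis by (intro power_le_one norm_ge_zero)
          qed
        qed
        also have "\<dots> = measure lebesgue \<Omega>" using \<Omega>_lebesgue by (simp add: measure_restrict_space)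
        finally show ?thesis .
      qed
      have "\<bar>a p n\<bar> \<le> sqrt (energy M\<Omega> (v i n)) * sqrt (energy M\<Omega> ?w)"
        unfolding a_def pp(1) prod.case by (rule Cauchy_Schwarz_integral_real[OF v[OF pp(2)] step_fast_integrable(2)[OF st]])
      also have "\<dots> \<le> sqrt (C i) * sqrt (measure lebesgue \<Omega>)"
        using C[OF pp(2), of n] energy_nonneg[of M\<Omega> "v i n"] e1
        by (intro mult_mono real_sqrt_le_mono real_sqrt_ge_zero energy_nonneg) linarith+
      finally show ?thesis .
    qed
    thus ?thesis by (auto simp: bounded_iff)
  qed
  obtain r where r: "strict_mono r" "\<And>p. p \<in> I \<Longrightarrow> convergent (\<lambda>n. a p (r n))"
    using diagonal_convergent_subsequence[of I a, OF cI bI] by blast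
  interpret S: two_scale \<Omega> R "\<eta> \<circ> r" by (rule two_scale_subseq[OF assms(1) r(1)])
  have "\<exists>g. square_integrable M\<Omega>Y g \<and> weak_two_scale \<Omega> R (\<eta> \<circ> r) (v i \<circ> r) (\<lambda>x y. g (x, y))" if i: "i \<in> J" for i
  proof -
    have vs: "square_integrable M\<Omega> ((v i \<circ> r) n)" for n using v[OF i] by simp
    have Cs: "energy M\<Omega> ((v i \<circ> r) n) \<le> C i" for n using C[OF i] by simp
    have cs: "convergent (\<lambda>n. \<integral>x. (v i \<circ> r) n x * (indicator B x * wave k j (S.fast n x)) \<partial>M\<Omega>)" if "B \<in> \<B>" "integer_vec k" for B k j
      using r(2)[of "(i, B, k, j)"] that i by (simp add: I_def a_def fast_def S.fast_def)
    show ?thesis using S.two_scale_limit_exists[OF B3 B(2,3) vs Cs cs] by blast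
  qed
  then obtain g where "\<And>i. i \<in> J \<Longrightarrow> square_integrable M\<Omega>Y (g i) \<and> weak_two_scale \<Omega> R (\<eta> \<circ> r) (v i \<circ> r) (\<lambda>x y. g i (x, y))" by metis
  with r(1) show thesis using that by blast
qed

section \<open>Smooth functions and cutoffs\<close>

text \<open>As \<open>partial\<close>, but for functions with values in any normed space, scalar cutoffs included.\<close>

definition partial_deriv :: "'n \<Rightarrow> (real^'n::finite \<Rightarrow> 'b::real_normed_vector) \<Rightarrow> real^'n \<Rightarrow> 'b" where
  "partial_deriv i f x = frechet_derivative f (at x) (axis i 1)"

lemma partial_eq_partial_deriv: "partial = partial_deriv"
  by (intro ext) (simp add: partial_def partial_deriv_def)

lemma partial_deriv_eq: "(f has_derivative D) (at x) \<Longrightarrow> partial_deriv i f x = D (axis i 1)"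
  unfolding partial_deriv_def by (metis frechet_derivative_at)

lemma differentiable_has_derivative:
  "f differentiable (at x) \<Longrightarrow> (f has_derivative frechet_derivative f (at x)) (at x)"
  by (simp add: frechet_derivative_works)

text \<open>Unlike the definition by iterated partial derivatives, this recursion differentiates innermost
  first, so that closure properties follow by induction on n.\<close>

primrec smooth_upto :: "nat \<Rightarrow> (real^'n::finite \<Rightarrow> 'b::real_normed_vector) \<Rightarrow> bool" where
  "smooth_upto 0 f \<longleftrightarrow> True"
| "smooth_upto (Suc n) f \<longleftrightarrow> (\<forall>x. f differentiable (at x)) \<and> (\<forall>i. smooth_upto n (partial_deriv i f))"

definition smooth :: "(real^'n::finite \<Rightarrow> 'b::real_normed_vector) \<Rightarrow> bool" where
  "smooth f \<longleftrightarrow> (\<forall>n. smooth_upto n f)"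

lemma smooth_uptoD: "smooth_upto (Suc n) f \<Longrightarrow> f differentiable (at x)"
  and smooth_upto_partial_deriv: "smooth_upto (Suc n) f \<Longrightarrow> smooth_upto n (partial_deriv i f)" by auto

lemma smooth_upto_Suc_mono: "smooth_upto (Suc n) f \<Longrightarrow> smooth_upto n f"
proof (induction n arbitrary: f)
  case (Suc n)
  have "f differentiable (at x)" for x using Suc.prems by (rule smooth_uptoD)
  moreover have "smooth_upto n (partial_deriv i f)" for i by (rule Suc.IH[OF smooth_upto_partial_deriv[OF Suc.prems]])
  ultimately show ?case by simp
qed simp

lemma smooth_differentiable: "smooth f \<Longrightarrow> f differentiable (at x)"
  unfolding smooth_def using smooth_uptoD by blast

lemma smooth_partial_deriv: "smooth f \<Longrightarrow> smooth (partial_deriv i f)"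
  unfolding smooth_def using smooth_upto_partial_deriv by blast

lemma smooth_continuous: "smooth f \<Longrightarrow> continuous_on UNIV f"
  by (intro continuous_at_imp_continuous_on ballI differentiable_imp_continuous_within smooth_differentiable)

lemma smooth_upto_const: "smooth_upto n (\<lambda>x. c)"
proof (induction n arbitrary: c)
  case (Suc n)
  have "partial_deriv i (\<lambda>x. c) = (\<lambda>x. 0)" for i :: 'a by (intro ext) (simp add: partial_deriv_eq[OF has_derivative_const])
  thus ?case using Suc.IH by simp
qed simp

lemma smooth_upto_add: "smooth_upto n f \<Longrightarrow> smooth_upto n g \<Longrightarrow> smooth_upto n (\<lambda>x. f x + g x)"
proof (induction n arbitrary: f g)
  case (Suc n)
  have d: "f differentiable (at x)" "g differentiable (at x)" for x using smooth_uptoD Suc.prems by blast+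
  have "partial_deriv i (\<lambda>x. f x + g x) = (\<lambda>x. partial_deriv i f x + partial_deriv i g x)" for i
    by (intro ext) (simp add: partial_deriv_eq[OF has_derivative_add[OF differentiable_has_derivative[OF d(1)] differentiable_has_derivative[OF d(2)]]] partial_deriv_def)
  moreover have "smooth_upto n (\<lambda>x. partial_deriv i f x + partial_deriv i g x)" for i
    by (intro Suc.IH smooth_upto_partial_deriv Suc.prems)
  ultimately show ?case using d by (simp add: differentiable_add)
qed simp

lemma partial_deriv_scaleR:
  fixes f :: "real^'n::finite \<Rightarrow> real"
  assumes "f differentiable (at x)" "g differentiable (at x)"
  shows "partial_deriv i (\<lambda>x. f x *\<^sub>R g x) x = f x *\<^sub>R partial_deriv i g x + partial_deriv i f x *\<^sub>R g x"
  by (subst partial_deriv_eq[OF has_derivative_scaleR[OF differentiable_has_derivative[OF assms(1)] differentiable_has_derivative[OF assms(2)]]])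
     (simp add: partial_deriv_def)

lemma smooth_upto_scaleR:
  fixes f :: "real^'n::finite \<Rightarrow> real"
  shows "smooth_upto n f \<Longrightarrow> smooth_upto n g \<Longrightarrow> smooth_upto n (\<lambda>x. f x *\<^sub>R g x)"
proof (induction n arbitrary: f g)
  case (Suc n)
  have d: "f differentiable (at x)" "g differentiable (at x)" for x using smooth_uptoD Suc.prems by blast+
  have "partial_deriv i (\<lambda>x. f x *\<^sub>R g x) = (\<lambda>x. f x *\<^sub>R partial_deriv i g x + partial_deriv i f x *\<^sub>R g x)" for i
    by (intro ext partial_deriv_scaleR d)
  moreover have "smooth_upto n (\<lambda>x. f x *\<^sub>R partial_deriv i g x + partial_deriv i f x *\<^sub>R g x)" for i
    by (rule smooth_upto_add[OF Suc.IH[OF smooth_upto_Suc_mono[OF Suc.prems(1)] smooth_upto_partial_deriv[OF Suc.prems(2)]]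
          Suc.IH[OF smooth_upto_partial_deriv[OF Suc.prems(1)] smooth_upto_Suc_mono[OF Suc.prems(2)]]])
  moreover have "(\<lambda>x. f x *\<^sub>R g x) differentiable (at x)" for x
    by (rule differentiableI[OF has_derivative_scaleR[OF differentiable_has_derivative[OF d(1)] differentiable_has_derivative[OF d(2)]]])
  ultimately show ?case by simp
qed simp

lemma smooth_const: "smooth (\<lambda>x. c)"
  and smooth_add: "smooth f \<Longrightarrow> smooth g \<Longrightarrow> smooth (\<lambda>x. f x + g x)"
  and smooth_scaleR: "smooth (h :: _ \<Rightarrow> real) \<Longrightarrow> smooth f \<Longrightarrow> smooth (\<lambda>x. h x *\<^sub>R f x)"
  unfolding smooth_def using smooth_upto_const smooth_upto_add smooth_upto_scaleR by blast+

lemma smooth_mult: "smooth f \<Longrightarrow> smooth g \<Longrightarrow> smooth (\<lambda>x. f x * g x :: real)"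
  using smooth_scaleR[of f g] by simp

lemma smooth_prod: "finite I \<Longrightarrow> (\<And>i. i \<in> I \<Longrightarrow> smooth (f i)) \<Longrightarrow> smooth (\<lambda>x. \<Prod>i\<in>I. f i x :: real)"
  by (induction I rule: finite_induct) (auto intro: smooth_const smooth_mult)

lemma smooth_upto_sum: "finite I \<Longrightarrow> (\<And>i. i \<in> I \<Longrightarrow> smooth_upto n (f i)) \<Longrightarrow> smooth_upto n (\<lambda>x. \<Sum>i\<in>I. f i x)"
  by (induction I rule: finite_induct) (auto intro: smooth_upto_const smooth_upto_add)

lemma partial_deriv_compose_matrix:
  fixes A :: "real^'n::finite^'m::finite"
  assumes f: "f differentiable (at (A *v x))"
  shows "(\<lambda>x. f (A *v x)) differentiable (at x)"
    and "partial_deriv i (\<lambda>x. f (A *v x)) x = (\<Sum>j\<in>UNIV. A $ j $ i *\<^sub>R partial_deriv j f (A *v x))"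
proof -
  let ?D = "frechet_derivative f (at (A *v x))"
  have D: "(f has_derivative ?D) (at (A *v x))" by (rule differentiable_has_derivative[OF f])
  have L: "((\<lambda>x. A *v x) has_derivative (\<lambda>x. A *v x)) (at x)"
    by (rule bounded_linear_imp_has_derivative) (rule matrix_vector_mul_bounded_linear)
  have c: "((\<lambda>x. f (A *v x)) has_derivative (\<lambda>h. ?D (A *v h))) (at x)"
    by (rule has_derivative_compose[OF L D])
  thus "(\<lambda>x. f (A *v x)) differentiable (at x)" by (auto simp: differentiable_def)
  have lin: "linear ?D" by (rule has_derivative_linear[OF D])
  have "A *v axis i 1 = (\<Sum>j\<in>UNIV. A $ j $ i *\<^sub>R axis j 1)"
    by (simp add: vec_eq_iff matrix_vector_mult_def axis_def if_distrib cong: if_cong)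
  hence "?D (A *v axis i 1) = (\<Sum>j\<in>UNIV. A $ j $ i *\<^sub>R ?D (axis j 1))"
    by (simp add: linear_sum[OF lin] linear_scale[OF lin])
  thus "partial_deriv i (\<lambda>x. f (A *v x)) x = (\<Sum>j\<in>UNIV. A $ j $ i *\<^sub>R partial_deriv j f (A *v x))"
    by (subst partial_deriv_eq[OF c]) (simp add: partial_deriv_def)
qed

lemma smooth_upto_compose_matrix:
  fixes A :: "real^'n::finite^'m::finite"
  shows "smooth_upto n f \<Longrightarrow> smooth_upto n (\<lambda>x. f (A *v x))"
proof (induction n arbitrary: f)
  case (Suc n)
  have d: "f differentiable (at x)" for x using smooth_uptoD Suc.prems by blast
  have "partial_deriv i (\<lambda>x. f (A *v x)) = (\<lambda>x. \<Sum>j\<in>UNIV. A $ j $ i *\<^sub>R partial_deriv j f (A *v x))" for i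
    by (intro ext partial_deriv_compose_matrix(2) d)
  moreover have "smooth_upto n (\<lambda>x. \<Sum>j\<in>UNIV. A $ j $ i *\<^sub>R partial_deriv j f (A *v x))" for i
    by (intro smooth_upto_sum smooth_upto_scaleR smooth_upto_const Suc.IH smooth_upto_partial_deriv Suc.prems) simp
  moreover have "(\<lambda>x. f (A *v x)) differentiable (at x)" for x by (rule partial_deriv_compose_matrix(1)[OF d])
  ultimately show ?case by simp
qed simp

lemma smooth_compose_matrix: "smooth f \<Longrightarrow> smooth (\<lambda>x. f (A *v x))"
  unfolding smooth_def using smooth_upto_compose_matrix by blast

lemma iter_partial_snoc: "iter_partial (is @ [i]) f = iter_partial is (partial i f)"
  by (induction "is") auto

text \<open>A list of derivatives is split at its last element, which is the innermost derivative.\<close>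

lemma smooth_upto_iff_iter_partial:
  fixes f :: "real^'n::finite \<Rightarrow> real^3"
  shows "smooth_upto n f \<longleftrightarrow> (\<forall>is x. length is < n \<longrightarrow> iter_partial is f differentiable (at x))"
proof (induction n arbitrary: f)
  case (Suc n)
  show ?case
  proof
    assume L: "smooth_upto (Suc n) f"
    show "\<forall>is x. length is < Suc n \<longrightarrow> iter_partial is f differentiable (at x)"
    proof (intro allI impI)
      fix "is" :: "'n list" and x assume len: "length is < Suc n"
      show "iter_partial is f differentiable (at x)"
      proof (cases "is" rule: rev_cases)
        case Nil
        then show ?thesis using L by simp
      next
        case (snoc js i)
        have "smooth_upto n (partial_deriv i f)" using L by simp
        hence "iter_partial js (partial_deriv i f) differentiable (at x)" using Suc.IH[of "partial_deriv i f"] len snoc by simp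
        then show ?thesis unfolding snoc iter_partial_snoc partial_eq_partial_deriv .
      qed
    qed
  next
    assume R: "\<forall>is x. length is < Suc n \<longrightarrow> iter_partial is f differentiable (at x)"
    have "f differentiable (at x)" for x using R[rule_format, of "[]"] by simp
    moreover have "smooth_upto n (partial_deriv i f)" for i
    proof -
      have "iter_partial js (partial_deriv i f) differentiable (at x)" if "length js < n" for js x
        using R[rule_format, of "js @ [i]" x] that by (simp add: iter_partial_snoc partial_eq_partial_deriv)
      thus ?thesis using Suc.IH[of "partial_deriv i f"] by blast
    qed
    ultimately show "smooth_upto (Suc n) f" by simp
  qed
qed simp

lemma C_infinity_iff_smooth: "C_infinity f \<longleftrightarrow> smooth f"
  unfolding C_infinity_def smooth_def smooth_upto_iff_iter_partial by (meson lessI)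

text \<open>The factors t^(- k) make the family closed under differentiation up to linear combinations.\<close>

definition flat :: "nat \<Rightarrow> real \<Rightarrow> real" where
  "flat k t = (if t > 0 then exp (- 1 / t) / t ^ k else 0)"

text \<open>From exp (1 / t) \<ge> (1 / (m t))^m with m = k + 2. The quadratic bound gives the vanishing
  derivative at zero.\<close>

lemma flat_bound: "\<bar>flat k t\<bar> \<le> real (k + 2) ^ (k + 2) * t\<^sup>2"
proof (cases "t > 0")
  case True
  let ?m = "k + 2"
  have "1 / (real ?m * t) \<le> exp (1 / (real ?m * t))" using exp_ge_add_one_self[of "1 / (real ?m * t)"] by linarith
  hence "(1 / (real ?m * t)) ^ ?m \<le> exp (1 / (real ?m * t)) ^ ?m" using True by (intro power_mono) auto
  also have "\<dots> = exp (real ?m * (1 / (real ?m * t)))" by (rule exp_of_nat_mult[symmetric])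
  also have "real ?m * (1 / (real ?m * t)) = 1 / t" using True by simp
  finally have "1 / (real ?m * t) ^ ?m \<le> exp (1 / t)" by (simp add: power_divide)
  hence "inverse (exp (1 / t)) \<le> inverse (1 / (real ?m * t) ^ ?m)" using True by (intro le_imp_inverse_le) auto
  hence "exp (- 1 / t) \<le> (real ?m * t) ^ ?m" by (simp add: exp_minus)
  also have "\<dots> = real ?m ^ ?m * t\<^sup>2 * t ^ k" by (simp add: power_mult_distrib power_add power2_eq_square)
  finally have "exp (- 1 / t) / t ^ k \<le> real ?m ^ ?m * t\<^sup>2" using True by (simp add: divide_le_eq)
  thus ?thesis using True by (simp add: flat_def)
qed (simp add: flat_def)

lemma flat_has_derivative: "(flat k has_real_derivative (flat (k + 2) t - real k * flat (k + 1) t)) (at t)"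
proof -
  consider "t > 0" | "t < 0" | "t = 0" by linarith
  thus ?thesis
  proof cases
    case 1
    have "((\<lambda>t. exp (- 1 / t) / t ^ k) has_real_derivative (flat (k + 2) t - real k * flat (k + 1) t)) (at t)"
    proof (cases k)
      case 0
      show ?thesis unfolding 0 using 1
        by (auto intro!: derivative_eq_intros simp: flat_def power2_eq_square)
    next
      case (Suc m)
      show ?thesis unfolding Suc using 1
        by (auto intro!: derivative_eq_intros simp: flat_def power2_eq_square divide_simps) (cases m; simp add: algebra_simps)
    qed
    thus ?thesis
      by (rule has_field_derivative_transform_within_open[where S="{0<..}"]) (use 1 in \<open>auto simp: flat_def\<close>)
  next
    case 2
    have "((\<lambda>t. 0) has_real_derivative (flat (k + 2) t - real k * flat (k + 1) t)) (at t)"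
      using 2 by (simp add: flat_def)
    thus ?thesis
      by (rule has_field_derivative_transform_within_open[where S="{..<0}"]) (use 2 in \<open>auto simp: flat_def\<close>)
  next
    case 3
    let ?C = "real (k + 2) ^ (k + 2)"
    have z: "flat j 0 = 0" for j by (simp add: flat_def)
    have l: "(\<lambda>h. (flat k (0 + h) - flat k 0) / h) \<midarrow>0\<rightarrow> 0"
    proof (rule Lim_null_comparison)
      show "eventually (\<lambda>h. norm ((flat k (0 + h) - flat k 0) / h) \<le> ?C * \<bar>h\<bar>) (at 0)"
      proof (rule eventually_at_filter[THEN iffD2], rule always_eventually, intro allI impI)
        fix h :: real assume h: "h \<noteq> 0"
        have "\<bar>flat k h\<bar> / \<bar>h\<bar> \<le> (?C * h\<^sup>2) / \<bar>h\<bar>" by (rule divide_right_mono[OF flat_bound]) simp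
        also have "h\<^sup>2 = \<bar>h\<bar> * \<bar>h\<bar>" by (simp add: power2_eq_square)
        also have "?C * (\<bar>h\<bar> * \<bar>h\<bar>) / \<bar>h\<bar> = ?C * \<bar>h\<bar>" using h by (simp del: abs_mult_self_eq)
        finally show "norm ((flat k (0 + h) - flat k 0) / h) \<le> ?C * \<bar>h\<bar>" by (simp add: flat_def[of k 0])
      qed
      have "(\<lambda>h. ?C * \<bar>h\<bar>) \<midarrow>0\<rightarrow> ?C * \<bar>0\<bar>" by (intro tendsto_intros)
      thus "(\<lambda>h. ?C * \<bar>h\<bar>) \<midarrow>0\<rightarrow> 0" by simp
    qed
    hence "(flat k has_real_derivative 0) (at 0)" unfolding DERIV_def .
    thus ?thesis unfolding 3 by (simp only: z mult_zero_right diff_zero)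
  qed
qed

lemma smooth_upto_flat: "smooth_upto n (\<lambda>x :: real^'n::finite. flat k (c * x $ i + d))"
proof (induction n arbitrary: k)
  case (Suc n)
  let ?l = "\<lambda>x :: real^'n. c * x $ i + d"
  define g where "g t = flat (k + 2) t - real k * flat (k + 1) t" for t
  have D: "((\<lambda>x. flat k (?l x)) has_derivative (\<lambda>h. (c * h $ i) * g (?l x))) (at x)" for x
  proof -
    have "(?l has_derivative (\<lambda>h. c * h $ i)) (at x)"
      by (auto intro!: derivative_eq_intros bounded_linear_imp_has_derivative bounded_linear_vec_nth)
    moreover have "(flat k has_derivative (\<lambda>h. h * g (?l x))) (at (?l x))"
      using flat_has_derivative[of k "?l x"] unfolding has_field_derivative_def g_def by (simp add: mult.commute[of _ "_ - _"])
    ultimately show ?thesis by (rule has_derivative_compose)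
  qed
  have "(\<lambda>x. flat k (?l x)) differentiable (at x)" for x using D[of x] by (auto simp: differentiable_def)
  moreover have "smooth_upto n (partial_deriv j (\<lambda>x. flat k (?l x)))" for j
  proof -
    have "partial_deriv j (\<lambda>x. flat k (?l x)) = (\<lambda>x. (c * axis j 1 $ i) *\<^sub>R (flat (k + 2) (?l x) + (- real k) *\<^sub>R flat (k + 1) (?l x)))"
      by (intro ext) (simp add: partial_deriv_eq[OF D] g_def)
    moreover have "smooth_upto n (\<lambda>x. (c * axis j 1 $ i) *\<^sub>R (flat (k + 2) (?l x) + (- real k) *\<^sub>R flat (k + 1) (?l x)))"
      by (intro smooth_upto_scaleR smooth_upto_add smooth_upto_const Suc.IH)
    ultimately show ?thesis by simp
  qed
  ultimately show ?case by simp
qed simp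

text \<open>A product of functions exp (- 1 / s) with s = n (x_i - a_i) - 1 and s = n (b_i - x_i) - 1. The
  shift by 1 moves the support away from the boundary of the box by 1 / n, and as n grows the
  product tends to 1 inside the box.\<close>

definition box_bump :: "real^'n \<Rightarrow> real^'n \<Rightarrow> nat \<Rightarrow> real^'n::finite \<Rightarrow> real" where
  "box_bump a b n x = (\<Prod>i\<in>UNIV. flat 0 (real n * x $ i + (- real n * a $ i - 1)) * flat 0 (- real n * x $ i + (real n * b $ i - 1)))"

lemma flat_01: "0 \<le> flat 0 t" "flat 0 t \<le> 1"
  by (auto simp: flat_def)

lemma smooth_box_bump: "smooth (box_bump a b n)"
  unfolding box_bump_def[abs_def] 
  by (intro smooth_prod smooth_mult finite) (simp_all only: smooth_def smooth_upto_flat simp_thms)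

lemma box_bump_01: "0 \<le> box_bump a b n x" "box_bump a b n x \<le> 1"
  unfolding box_bump_def by (intro prod_nonneg prod_le_1 conjI ballI mult_nonneg_nonneg mult_le_one flat_01)+

lemma box_bump_support:
  assumes "box_bump a b n x \<noteq> 0"
  shows "n \<noteq> 0" "x \<in> cbox (a + (1 / real n) *\<^sub>R 1) (b - (1 / real n) *\<^sub>R 1)"
proof -
  have nz: "flat 0 (real n * x $ i + (- real n * a $ i - 1)) \<noteq> 0" "flat 0 (- real n * x $ i + (real n * b $ i - 1)) \<noteq> 0" for i
    using assms unfolding box_bump_def by auto
  have p: "real n * x $ i + (- real n * a $ i - 1) > 0" "- real n * x $ i + (real n * b $ i - 1) > 0" for i
    using nz[of i] by (auto simp: flat_def split: if_splits)
  show n: "n \<noteq> 0" using p(1)[of undefined] by (cases n) auto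
  show "x \<in> cbox (a + (1 / real n) *\<^sub>R 1) (b - (1 / real n) *\<^sub>R 1)"
    unfolding mem_box_cart
  proof
    fix i
    have "real n * (x $ i - a $ i) \<ge> 1" "real n * (b $ i - x $ i) \<ge> 1"
      using p[of i] unfolding right_diff_distrib by linarith+
    hence "x $ i - a $ i \<ge> 1 / real n" "b $ i - x $ i \<ge> 1 / real n"
      using n by (simp_all add: divide_le_eq mult.commute)
    thus "(a + (1 / real n) *\<^sub>R 1) $ i \<le> x $ i \<and> x $ i \<le> (b - (1 / real n) *\<^sub>R 1) $ i" by simp
  qed
qed

lemma cbox_shrink_subset: "n \<noteq> 0 \<Longrightarrow> cbox (a + (1 / real n) *\<^sub>R 1) (b - (1 / real n) *\<^sub>R 1) \<subseteq> box a (b :: real^'n::finite)"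
proof
  fix x assume n: "n \<noteq> 0" and x: "x \<in> cbox (a + (1 / real n) *\<^sub>R 1) (b - (1 / real n) *\<^sub>R 1)"
  have p: "1 / real n > 0" using n by simp
  show "x \<in> box a b" unfolding mem_box_cart
  proof
    fix i
    have "a $ i + 1 / real n \<le> x $ i \<and> x $ i \<le> b $ i - 1 / real n" using x by (simp add: mem_box_cart)
    thus "a $ i < x $ i \<and> x $ i < b $ i" using p by linarith
  qed
qed

lemma flat_scaled_tendsto:
  assumes "(s::real) > 0" shows "(\<lambda>n. flat 0 (real n * s - 1)) \<longlonglongrightarrow> 1"
proof -
  have top: "filterlim (\<lambda>n. real n * s - 1) at_top sequentially"
  proof -
    have "filterlim (\<lambda>n. real n * s) at_top sequentially"
      using filterlim_at_top_mult_tendsto_pos[OF tendsto_const assms filterlim_real_sequentially] by (simp add: mult.commute)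
    hence "filterlim (\<lambda>n. -1 + real n * s) at_top sequentially"
      by (rule filterlim_tendsto_add_at_top[OF tendsto_const])
    thus ?thesis by simp
  qed
  have "(\<lambda>n. exp (- inverse (real n * s - 1))) \<longlonglongrightarrow> exp (- 0)"
    by (intro tendsto_intros tendsto_inverse_0_at_top top)
  hence l: "(\<lambda>n. exp (- inverse (real n * s - 1))) \<longlonglongrightarrow> 1" by simp
  have "eventually (\<lambda>n. real n * s - 1 > 0) sequentially"
    using top unfolding filterlim_at_top_dense by blast
  hence "eventually (\<lambda>n. exp (- inverse (real n * s - 1)) = flat 0 (real n * s - 1)) sequentially"
    by eventually_elim (simp add: flat_def inverse_eq_divide)
  from Lim_transform_eventually[OF l this] show ?thesis .
qed

lemma box_bump_tendsto:
  assumes "x \<in> box a b" shows "(\<lambda>n. box_bump a b n x) \<longlonglongrightarrow> 1"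
proof -
  have "(\<lambda>n. flat 0 (real n * x $ i + (- real n * a $ i - 1)) * flat 0 (- real n * x $ i + (real n * b $ i - 1))) \<longlonglongrightarrow> 1 * 1" for i
  proof (rule tendsto_mult)
    have "x $ i - a $ i > 0" "b $ i - x $ i > 0" using assms by (auto simp: mem_box_cart)
    from flat_scaled_tendsto[OF this(1)] flat_scaled_tendsto[OF this(2)]
    show "(\<lambda>n. flat 0 (real n * x $ i + (- real n * a $ i - 1))) \<longlonglongrightarrow> 1"
      "(\<lambda>n. flat 0 (- real n * x $ i + (real n * b $ i - 1))) \<longlonglongrightarrow> 1"
      by (simp_all add: algebra_simps)
  qed
  hence "(\<lambda>n. box_bump a b n x) \<longlonglongrightarrow> (\<Prod>i\<in>(UNIV :: 'a set). 1 * 1)"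
    unfolding box_bump_def by (intro tendsto_prod)
  thus ?thesis by simp
qed

text \<open>An open set is a countable union of open boxes. The complement of a product of complements is a
  smooth version of the union of the first n bumps.\<close>

theorem smooth_cutoff_sequence:
  fixes U :: "(real^'n::finite) set"
  assumes U: "open U"
  obtains \<theta> :: "nat \<Rightarrow> real^'n \<Rightarrow> real" where "\<And>n. smooth (\<theta> n)" "\<And>n x. 0 \<le> \<theta> n x \<and> \<theta> n x \<le> 1"
    "\<And>n. \<exists>K. compact K \<and> K \<subseteq> U \<and> (\<forall>x. x \<notin> K \<longrightarrow> \<theta> n x = 0)"
    "\<And>x. (\<lambda>n. \<theta> n x) \<longlonglongrightarrow> indicator U x"
proof -
  obtain D where D: "countable D" "D \<subseteq> Pow U" "\<And>X. X \<in> D \<Longrightarrow> \<exists>a b. X = box a b" "\<Union>D = U"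
    using open_countable_Union_open_box[OF U] by metis
  define E where "E = insert {} D"
  have E: "countable E" "E \<noteq> {}" "\<And>X. X \<in> E \<Longrightarrow> X \<subseteq> U" "\<Union>E = U" using D by (auto simp: E_def)
  have "\<exists>a b. X = box a b" if "X \<in> E" for X
  proof (cases "X = {}")
    case True
    have "box (0 :: real^'n) 0 = {}" by simp
    with True show ?thesis by metis
  qed (use that D(3) in \<open>auto simp: E_def\<close>)
  hence "\<exists>a b. from_nat_into E j = box a b" for j using from_nat_into[OF E(2)] by blast
  then obtain a b where ab: "\<And>j. from_nat_into E j = box (a j) (b j)" by metis
  have sub: "box (a j) (b j) \<subseteq> U" for j using E(3)[OF from_nat_into[OF E(2), of j]] ab by simp
  define \<theta> where "\<theta> n x = 1 - (\<Prod>j<n. 1 - box_bump (a j) (b j) n x)" for n and x :: "real^'n"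
  define K where "K n = (\<Union>j<n. cbox (a j + (1 / real n) *\<^sub>R 1) (b j - (1 / real n) *\<^sub>R 1))" for n :: nat
  show thesis
  proof (rule that[of \<theta>])
    show "smooth (\<theta> n)" for n
    proof -
      have "\<theta> n = (\<lambda>x. 1 + (-1) * (\<Prod>j<n. 1 + (-1) * box_bump (a j) (b j) n x))" by (auto simp: \<theta>_def)
      moreover have "smooth \<dots>" by (intro smooth_add smooth_mult smooth_prod smooth_const smooth_box_bump) simp
      ultimately show ?thesis by simp
    qed
    have f01: "0 \<le> 1 - box_bump (a j) (b j) n x \<and> 1 - box_bump (a j) (b j) n x \<le> 1" for j n x
      using box_bump_01[of "a j" "b j" n x] by simp
    show "0 \<le> \<theta> n x \<and> \<theta> n x \<le> 1" for n x
      unfolding \<theta>_def using f01 by (auto intro!: prod_le_1 prod_nonneg)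
    show "\<exists>K. compact K \<and> K \<subseteq> U \<and> (\<forall>x. x \<notin> K \<longrightarrow> \<theta> n x = 0)" for n
    proof (intro exI[of _ "K n"] conjI allI impI)
      show "compact (K n)" unfolding K_def by (intro compact_UN) auto
      show "K n \<subseteq> U"
      proof (cases "n = 0")
        case False
        show ?thesis unfolding K_def using cbox_shrink_subset[OF False] sub by blast
      qed (simp add: K_def)
      fix x assume "x \<notin> K n"
      hence "box_bump (a j) (b j) n x = 0" if "j < n" for j using box_bump_support(2)[of "a j" "b j" n x] that unfolding K_def by blast
      thus "\<theta> n x = 0" by (simp add: \<theta>_def)
    qed
    show "(\<lambda>n. \<theta> n x) \<longlonglongrightarrow> indicator U x" for x
    proof (cases "x \<in> U")
      case False
      have "box_bump (a j) (b j) n x = 0" for j n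
        using box_bump_support[of "a j" "b j" n x] cbox_shrink_subset[of n "a j" "b j"] sub[of j] False by blast
      thus ?thesis using False by (simp add: \<theta>_def)
    next
      case True
      then obtain X where "X \<in> E" "x \<in> X" using E(4) by blast
      then obtain i where i: "x \<in> box (a i) (b i)" using from_nat_into_surj[OF E(1)] ab by metis
      have lower: "box_bump (a i) (b i) n x \<le> \<theta> n x" if "i < n" for n
      proof -
        have "(\<Prod>j<n. 1 - box_bump (a j) (b j) n x) = (1 - box_bump (a i) (b i) n x) * (\<Prod>j\<in>{..<n} - {i}. 1 - box_bump (a j) (b j) n x)"
          using that by (subst prod.remove[of _ i]) auto
        also have "\<dots> \<le> (1 - box_bump (a i) (b i) n x) * 1"
          by (rule mult_left_mono) (use f01 in \<open>auto intro!: prod_le_1\<close>)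
        finally show ?thesis by (simp add: \<theta>_def)
      qed
      have "(\<lambda>n. \<theta> n x) \<longlonglongrightarrow> 1"
      proof (rule tendsto_sandwich[OF _ _ box_bump_tendsto[OF i] tendsto_const])
        show "eventually (\<lambda>n. box_bump (a i) (b i) n x \<le> \<theta> n x) sequentially"
          using eventually_gt_at_top[of i] by eventually_elim (rule lower)
        show "eventually (\<lambda>n. \<theta> n x \<le> 1) sequentially"
          unfolding \<theta>_def using f01 by (auto intro!: always_eventually prod_nonneg)
      qed
      thus ?thesis using True by simp
    qed
  qed
qed

section \<open>The limit of the scaled curl\<close>

lemma norm_cross3_axis_le: "norm (cross3 (axis j 1) v) \<le> norm v"
proof -
  have "(norm (cross3 (axis j 1) v))\<^sup>2 \<le> (norm (axis j (1::real) :: real^3) * norm v)\<^sup>2"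
    using norm_cross_dot[of "axis j 1" v] zero_le_power2[of "axis j 1 \<bullet> v"] by linarith
  thus ?thesis by (simp add: norm_axis_1)
qed

lemma partial_deriv_periodic:
  fixes f :: "real^'m::finite \<Rightarrow> 'b::real_normed_vector"
  assumes per: "Y_periodic f" and d: "\<And>y. f differentiable (at y)"
  shows "Y_periodic (partial_deriv i f)"
  unfolding Y_periodic_def
proof (intro allI impI)
  fix y k :: "real^'m" assume k: "integer_vec k"
  have "((\<lambda>y. y + k) has_derivative (\<lambda>h. h)) (at y)" by (auto intro!: derivative_eq_intros)
  from has_derivative_compose[OF this differentiable_has_derivative[OF d]]
  have "((\<lambda>y. f (y + k)) has_derivative frechet_derivative f (at (y + k))) (at y)" by simp
  moreover have "(\<lambda>y. f (y + k)) = f" using per k unfolding Y_periodic_def by auto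
  ultimately have "(f has_derivative frechet_derivative f (at (y + k))) (at y)" by simp
  thus "partial_deriv i f (y + k) = partial_deriv i f y" by (simp add: partial_deriv_eq partial_deriv_def[of i f "y + k"])
qed

lemma curl_R_continuous: "smooth f \<Longrightarrow> continuous_on UNIV (curl_R R f)"
  unfolding curl_R_def[abs_def] partial_eq_partial_deriv
  by (intro continuous_on_sum continuous_on_cross continuous_on_const continuous_on_scaleR smooth_continuous smooth_partial_deriv)

lemma curl_R_periodic: "smooth f \<Longrightarrow> Y_periodic f \<Longrightarrow> Y_periodic (curl_R R f)"
  using partial_deriv_periodic[OF _ smooth_differentiable, of f] unfolding curl_R_def[abs_def] partial_eq_partial_deriv Y_periodic_def by simp

lemma component_C_per:
  fixes f :: "real^'m \<Rightarrow> real^3"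
  assumes "continuous_on UNIV f" "Y_periodic f" shows "(\<lambda>y. f y $ i) \<in> C_per"
  using assms by (auto simp: C_per_def Y_periodic_def intro!: continuous_on_component)

text \<open>Product rule and chain rule. The first term carries the fast variation, the second only
  derivatives of the cutoff.\<close>

lemma curl_product:
  fixes A :: "real^3^'m"
  assumes \<theta>: "smooth \<theta>" and \<psi>: "smooth \<psi>"
  shows "curl (\<lambda>x. \<theta> x *\<^sub>R \<psi> (A *v x)) x =
    \<theta> x *\<^sub>R curl_R A \<psi> (A *v x) + (\<Sum>j\<in>UNIV. partial_deriv j \<theta> x *\<^sub>R cross3 (axis j 1) (\<psi> (A *v x)))"
proof -
  have e: "partial_deriv j (\<lambda>x. \<theta> x *\<^sub>R \<psi> (A *v x)) x = \<theta> x *\<^sub>R (\<Sum>i\<in>UNIV. A $ i $ j *\<^sub>R partial_deriv i \<psi> (A *v x)) + partial_deriv j \<theta> x *\<^sub>R \<psi> (A *v x)" for j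
    by (simp only: partial_deriv_scaleR[OF smooth_differentiable[OF \<theta>] smooth_differentiable[OF smooth_compose_matrix[OF \<psi>]]]
        partial_deriv_compose_matrix(2)[OF smooth_differentiable[OF \<psi>]])
  show ?thesis
    unfolding curl_def curl_R_def partial_eq_partial_deriv e
    by (simp only: cross_add_right cross_mult_right sum.distrib flip: scaleR_sum_right)
qed

lemma curl_R_scale: "curl_R (c *\<^sub>R A) \<psi> y = c *\<^sub>R curl_R A \<psi> y"
  unfolding curl_R_def by (simp add: scaleR_sum_right cross_mult_right[symmetric])

lemma smooth_periodic_bounded:
  fixes f :: "real^'m \<Rightarrow> real^3"
  assumes "continuous_on UNIV f" "Y_periodic f" obtains B where "0 \<le> B" "\<And>y. norm (f y) \<le> B"
proof -
  have "(\<lambda>y. norm (f y)) \<in> C_per" using assms by (auto simp: C_per_def Y_periodic_def intro!: continuous_on_norm)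
  thus thesis using C_per_bounded that by (metis abs_norm_cancel)
qed

context two_scale
begin

text \<open>The simple functions approximating \<theta>, multiplied by f, approximate the product in the sup norm.\<close>

lemma separated_in_Bochner:
  assumes \<theta>: "\<theta> \<in> borel_measurable M\<Omega>" "\<And>x. \<bar>\<theta> x\<bar> \<le> K" and f: "f \<in> C_per"
  shows "(\<lambda>x y. \<theta> x * f y) \<in> L2_Bochner \<Omega> (C_per :: (real^'m \<Rightarrow> real) set) sup_norm"
proof -
  have sc: "(\<lambda>y. c * f y) \<in> C_per" for c using f by (auto simp: C_per_def Y_periodic_def intro!: continuous_on_mult continuous_on_const)
  obtain S where S: "\<And>i. simple_function M\<Omega> (S i)" "\<And>x. x \<in> space M\<Omega> \<Longrightarrow> (\<lambda>i. S i x) \<longlonglongrightarrow> \<theta> x"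
    using borel_measurable_implies_sequence_metric[OF \<theta>(1), of 0] by metis
  have N: "sup_norm (\<lambda>y. c * f y) = \<bar>c\<bar> * sup_norm f" for c
  proof (rule antisym)
    show "sup_norm (\<lambda>y. c * f y) \<le> \<bar>c\<bar> * sup_norm f"
      by (rule sup_norm_le) (simp add: abs_mult mult_left_mono sup_norm_bound[OF f])
    show "\<bar>c\<bar> * sup_norm f \<le> sup_norm (\<lambda>y. c * f y)"
    proof (cases "c = 0")
      case False
      have "sup_norm f \<le> sup_norm (\<lambda>y. c * f y) / \<bar>c\<bar>"
      proof (rule sup_norm_le)
        fix y
        have "\<bar>c\<bar> * \<bar>f y\<bar> \<le> sup_norm (\<lambda>y. c * f y)" using sup_norm_bound[OF sc, of c y] by (simp add: abs_mult)
        thus "\<bar>f y\<bar> \<le> sup_norm (\<lambda>y. c * f y) / \<bar>c\<bar>" using False by (simp add: le_divide_eq mult.commute)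
      qed
      thus ?thesis using False by (simp add: le_divide_eq mult.commute)
    qed (simp add: sup_norm_0)
  qed
  show ?thesis
    unfolding L2_Bochner_def
  proof (intro CollectI conjI exI[of _ "\<lambda>n x y. S n x * f y"] allI)
    show "AE x in M\<Omega>. (\<lambda>y. \<theta> x * f y) \<in> C_per" using sc by simp
    show "simple_function M\<Omega> (\<lambda>x y. S n x * f y)" for n by (rule simple_function_compose1[OF S(1)])
    show "(\<lambda>x y. S n x * f y) ` \<Omega> \<subseteq> C_per" for n using sc by auto
    show "AE x in M\<Omega>. (\<lambda>n. sup_norm (\<lambda>y. S n x * f y - \<theta> x * f y)) \<longlonglongrightarrow> 0"
    proof (rule AE_I2)
      fix x assume "x \<in> space M\<Omega>"
      from S(2)[OF this] have "(\<lambda>n. \<bar>S n x - \<theta> x\<bar> * sup_norm f) \<longlonglongrightarrow> \<bar>\<theta> x - \<theta> x\<bar> * sup_norm f" by (intro tendsto_intros)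
      moreover have "sup_norm (\<lambda>y. S n x * f y - \<theta> x * f y) = \<bar>S n x - \<theta> x\<bar> * sup_norm f" for n
        using N[of "S n x - \<theta> x"] by (simp add: left_diff_distrib)
      ultimately show "(\<lambda>n. sup_norm (\<lambda>y. S n x * f y - \<theta> x * f y)) \<longlonglongrightarrow> 0" by simp
    qed
    show "integrable M\<Omega> (\<lambda>x. (sup_norm (\<lambda>y. \<theta> x * f y))\<^sup>2)"
    proof (rule integrable_bounded_on[OF \<Omega>_lmeasurable, where B="(K * sup_norm f)\<^sup>2"])
      show "(\<lambda>x. (sup_norm (\<lambda>y. \<theta> x * f y))\<^sup>2) \<in> borel_measurable M\<Omega>" unfolding N using \<theta>(1) by measurable
      fix x
      have "\<bar>\<theta> x\<bar> * sup_norm f \<le> K * sup_norm f" by (rule mult_right_mono[OF \<theta>(2) sup_norm_nonneg[OF f]])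
      thus "\<bar>(sup_norm (\<lambda>y. \<theta> x * f y))\<^sup>2\<bar> \<le> (K * sup_norm f)\<^sup>2" unfolding N
        using power_mono[of "\<bar>\<theta> x\<bar> * sup_norm f" "K * sup_norm f" 2] sup_norm_nonneg[OF f] by simp
    qed
  qed
qed

lemma vector_test_limit:
  fixes v :: "nat \<Rightarrow> real^3 \<Rightarrow> real^3" and f :: "real^'m \<Rightarrow> real^3"
  assumes lim: "weak_two_scale_vec \<Omega> R \<eta> v v0"
    and f: "continuous_on UNIV f" "Y_periodic f" and \<theta>: "\<theta> \<in> borel_measurable M\<Omega>" "\<And>x. \<bar>\<theta> x\<bar> \<le> K"
  shows "(\<lambda>n. \<integral>x. \<theta> x * (v n x \<bullet> f (fast n x)) \<partial>M\<Omega>) \<longlonglongrightarrow> (\<integral>z. \<theta> (fst z) * (v0 (fst z) (snd z) \<bullet> f (snd z)) \<partial>M\<Omega>Y)"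
proof -
  have fc: "(\<lambda>y. f y $ i) \<in> C_per" for i by (rule component_C_per[OF f])
  have T: "(\<lambda>x y. \<theta> x * f y $ i) \<in> L2_Bochner \<Omega> C_per sup_norm" for i by (rule separated_in_Bochner[OF \<theta> fc])
  have K0: "0 \<le> K" using \<theta>(2)[of 0] by linarith
  have bd: "\<exists>B. \<forall>x y. \<bar>\<theta> x * f y $ i\<bar> \<le> B" for i
  proof -
    obtain B where "0 \<le> B" "\<And>y. \<bar>f y $ i\<bar> \<le> B" using C_per_bounded[OF fc] by blast
    hence "\<forall>x y. \<bar>\<theta> x * f y $ i\<bar> \<le> K * B" using \<theta>(2) K0 by (simp add: abs_mult mult_mono)
    thus ?thesis by blast
  qed
  have w: "weak_two_scale \<Omega> R \<eta> (\<lambda>n x. v n x $ i) (\<lambda>x y. v0 x y $ i)" for i using lim by (simp add: weak_two_scale_vec_def)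
  have vi: "square_integrable M\<Omega> (\<lambda>x. v n x $ i)" for n i using w[of i] by (simp add: weak_two_scale_def L2_on_def square_integrable_def)
  have v0i: "square_integrable M\<Omega>Y (\<lambda>z. v0 (fst z) (snd z) $ i)" for i
    using w[of i] by (simp add: weak_two_scale_def L2_on_def square_integrable_def case_prod_beta')
  have i1: "integrable M\<Omega> (\<lambda>x. v n x $ i * (\<theta> x * f (fast n x) $ i))" for n i
  proof -
    obtain B where B: "\<And>x y. \<bar>\<theta> x * f y $ i\<bar> \<le> B" using bd by blast
    show ?thesis
      by (rule integrable_mult[OF vi square_integrable_bounded_on[OF \<Omega>_lmeasurable test_fast_measurable[OF T]]]) (use B in simp)
  qed
  have i2: "integrable M\<Omega>Y (\<lambda>z. v0 (fst z) (snd z) $ i * (\<theta> (fst z) * f (snd z) $ i))" for i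
  proof -
    obtain B where B: "\<And>x y. \<bar>\<theta> x * f y $ i\<bar> \<le> B" using bd by blast
    show ?thesis
      by (rule integrable_mult[OF v0i square_integrable_bounded_on[OF \<Omega>Y_lmeasurable test_pair_measurable[OF T]]]) (use B in simp)
  qed
  have e1: "(\<integral>x. \<theta> x * (v n x \<bullet> f (fast n x)) \<partial>M\<Omega>) = (\<Sum>i\<in>UNIV. \<integral>x. v n x $ i * (\<theta> x * f (fast n x) $ i) \<partial>M\<Omega>)" for n
  proof -
    have "(\<integral>x. \<theta> x * (v n x \<bullet> f (fast n x)) \<partial>M\<Omega>) = (\<integral>x. (\<Sum>i\<in>UNIV. v n x $ i * (\<theta> x * f (fast n x) $ i)) \<partial>M\<Omega>)"
      by (simp add: inner_vec_def sum_distrib_left mult.left_commute)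
    thus ?thesis using i1 by (simp add: Bochner_Integration.integral_sum)
  qed
  have e2: "(\<integral>z. \<theta> (fst z) * (v0 (fst z) (snd z) \<bullet> f (snd z)) \<partial>M\<Omega>Y) = (\<Sum>i\<in>UNIV. \<integral>z. v0 (fst z) (snd z) $ i * (\<theta> (fst z) * f (snd z) $ i) \<partial>M\<Omega>Y)"
  proof -
    have "(\<integral>z. \<theta> (fst z) * (v0 (fst z) (snd z) \<bullet> f (snd z)) \<partial>M\<Omega>Y) = (\<integral>z. (\<Sum>i\<in>UNIV. v0 (fst z) (snd z) $ i * (\<theta> (fst z) * f (snd z) $ i)) \<partial>M\<Omega>Y)"
      by (simp add: inner_vec_def sum_distrib_left mult.left_commute)
    thus ?thesis using i2 by (simp add: Bochner_Integration.integral_sum)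
  qed
  have "(\<lambda>n. \<integral>x. v n x $ i * (\<theta> x * f (fast n x) $ i) \<partial>M\<Omega>) \<longlonglongrightarrow> (\<integral>z. v0 (fst z) (snd z) $ i * (\<theta> (fst z) * f (snd z) $ i) \<partial>M\<Omega>Y)" for i
  proof -
    have "(\<lambda>n. \<integral>x. v n x $ i * (\<theta> x * f (fast n x) $ i) \<partial>M\<Omega>) \<longlonglongrightarrow> (\<integral>(x, y). v0 x y $ i * (\<theta> x * f y $ i) \<partial>M\<Omega>Y)"
      using bspec[OF conjunct2[OF conjunct2[OF w[of i, unfolded weak_two_scale_def]]] T[of i]] by (simp add: fast_def)
    thus ?thesis by (simp add: case_prod_beta')
  qed
  thus ?thesis unfolding e1 e2 by (intro tendsto_sum)
qed

text \<open>The test field is \<open>\<theta> x *\<^sub>R \<psi> (R x / \<eta> n)\<close>. Multiplied by \<open>\<eta> n\<close>, its curl is \<open>\<theta> x *\<^sub>R curl_R R \<psi>\<close>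
  plus \<open>\<eta> n\<close> times a bounded remainder.\<close>

theorem two_scale_limit_of_curl:
  fixes u c :: "nat \<Rightarrow> real^3 \<Rightarrow> real^3"
  assumes curl: "\<And>n. has_weak_curl \<Omega> (u n) (c n)" and C: "\<And>n. energy M\<Omega> (u n) \<le> C"
    and u0: "weak_two_scale_vec \<Omega> R \<eta> u u0" and w0: "weak_two_scale_vec \<Omega> R \<eta> (\<lambda>n x. \<eta> n *\<^sub>R c n x) w0"
    and \<theta>: "smooth \<theta>" "\<And>x. \<bar>\<theta> x\<bar> \<le> 1" and K: "compact K" "K \<subseteq> \<Omega>" "\<And>x. x \<notin> K \<Longrightarrow> \<theta> x = 0"
    and \<psi>: "smooth \<psi>" "Y_periodic \<psi>"
  shows "(\<integral>z. \<theta> (fst z) * (w0 (fst z) (snd z) \<bullet> \<psi> (snd z)) \<partial>M\<Omega>Y) = (\<integral>z. \<theta> (fst z) * (u0 (fst z) (snd z) \<bullet> curl_R R \<psi> (snd z)) \<partial>M\<Omega>Y)"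
proof -
  have \<theta>m: "\<theta> \<in> borel_measurable M\<Omega>"
    by (intro measurable_restrict_space1 measurable_completion) (simp add: borel_measurable_continuous_onI[OF smooth_continuous[OF \<theta>(1)]])
  have usq: "square_integrable M\<Omega> (u n)" and csq: "square_integrable M\<Omega> (c n)" for n
    using curl[of n] by (auto simp: has_weak_curl_def L2_on_def square_integrable_def)
  define A where "A n = (1 / \<eta> n) *\<^sub>R R" for n
  have Afast: "A n *v x = fast n x" for n x by (simp add: A_def fast_def scaleR_matrix_vector_assoc)
  define H where "H n x = (\<Sum>j\<in>UNIV. partial_deriv j \<theta> x *\<^sub>R cross3 (axis j 1) (\<psi> (fast n x)))" for n x
  have \<psi>c: "continuous_on UNIV \<psi>" by (rule smooth_continuous[OF \<psi>(1)])
  have fc: "continuous_on UNIV (fast n)" for n unfolding fast_def[abs_def] by (auto intro!: continuous_intros)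
  have \<psi>fc: "continuous_on UNIV (\<lambda>x. \<psi> (fast n x))" for n
    by (rule continuous_on_compose2[OF \<psi>c fc]) simp
  have Cfc: "continuous_on UNIV (\<lambda>x. curl_R R \<psi> (fast n x))" for n
    by (rule continuous_on_compose2[OF curl_R_continuous[OF \<psi>(1)] fc]) simp
  have Hc: "continuous_on UNIV (H n)" for n unfolding H_def[abs_def]
    by (intro continuous_on_sum continuous_on_scaleR continuous_on_cross continuous_on_const \<psi>fc smooth_continuous smooth_partial_deriv \<theta>(1))
  obtain P where P: "0 \<le> P" "\<And>y. norm (\<psi> y) \<le> P" using smooth_periodic_bounded[OF \<psi>c \<psi>(2)] by blast
  have "\<exists>Q. \<forall>x\<in>\<Omega>. \<bar>partial_deriv j \<theta> x\<bar> \<le> Q" for j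
  proof -
    have "compact (partial_deriv j \<theta> ` closure \<Omega>)"
      using bounded_\<Omega> by (intro compact_continuous_image continuous_on_subset[OF smooth_continuous[OF smooth_partial_deriv[OF \<theta>(1)]]]) (auto simp: compact_closure)
    hence "bounded (partial_deriv j \<theta> ` closure \<Omega>)" by (rule compact_imp_bounded)
    then obtain Q where "\<forall>w\<in>partial_deriv j \<theta> ` closure \<Omega>. norm w \<le> Q" unfolding bounded_iff by blast
    hence "\<forall>x\<in>\<Omega>. \<bar>partial_deriv j \<theta> x\<bar> \<le> Q" using closure_subset[of \<Omega>] by auto
    thus ?thesis by blast
  qed
  then obtain Q where Q: "\<And>j x. x \<in> \<Omega> \<Longrightarrow> \<bar>partial_deriv j \<theta> x\<bar> \<le> Q j" by metis
  define B where "B = (\<Sum>j\<in>(UNIV :: 3 set). Q j * P)"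
  have HB: "norm (H n x) \<le> B" if "x \<in> \<Omega>" for n x
    unfolding H_def B_def
  proof (rule sum_norm_le)
    fix j
    have "norm (cross3 (axis j 1) (\<psi> (fast n x))) \<le> P" using norm_cross3_axis_le P(2) order_trans by blast
    thus "norm (partial_deriv j \<theta> x *\<^sub>R cross3 (axis j 1) (\<psi> (fast n x))) \<le> Q j * P"
      using Q[OF that, of j] by (simp add: mult_mono order_trans[OF abs_ge_zero Q[OF that, of j]])
  qed
  have HM: "H n \<in> borel_measurable M\<Omega>" for n
    by (intro measurable_restrict_space1 measurable_completion) (simp add: borel_measurable_continuous_onI[OF Hc])
  have iB: "integrable M\<Omega> (\<lambda>x. B\<^sup>2)" by (rule integrable_bounded_on[OF \<Omega>_lmeasurable, where B="\<bar>B\<^sup>2\<bar>"]) auto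
  have HB2: "AE x in M\<Omega>. (norm (H n x))\<^sup>2 \<le> B\<^sup>2" for n
    by (rule AE_I2) (use HB in \<open>auto intro!: power_mono\<close>)
  have Hsq: "square_integrable M\<Omega> (H n)" for n
    by (rule square_integrable_bound[OF HM iB HB2])
  define E where "E = (\<integral>x. B\<^sup>2 \<partial>M\<Omega>)"
  have HE: "energy M\<Omega> (H n) \<le> E" for n
    unfolding energy_def E_def by (rule integral_mono_AE) (use Hsq[of n] iB HB2 in \<open>auto simp: square_integrable_def\<close>)
  have sqb: "square_integrable M\<Omega> (\<lambda>x. \<theta> x *\<^sub>R g (fast n x))" if g: "continuous_on UNIV g" "Y_periodic g" for g :: "real^'m \<Rightarrow> real^3" and n
  proof -
    obtain L where L: "0 \<le> L" "\<And>y. norm (g y) \<le> L" using smooth_periodic_bounded[OF g] by blast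
    have "continuous_on UNIV (\<lambda>x. \<theta> x *\<^sub>R g (fast n x))"
      by (intro continuous_on_scaleR smooth_continuous[OF \<theta>(1)] continuous_on_compose2[OF g(1) fc]) simp
    hence m: "(\<lambda>x. \<theta> x *\<^sub>R g (fast n x)) \<in> borel_measurable M\<Omega>"
      by (intro measurable_restrict_space1 measurable_completion) (simp add: borel_measurable_continuous_onI)
    show ?thesis
    proof (rule square_integrable_bounded_on[OF \<Omega>_lmeasurable m])
      fix x show "norm (\<theta> x *\<^sub>R g (fast n x)) \<le> 1 * L"
        unfolding norm_scaleR by (rule mult_mono) (use \<theta>(2) L in auto)
    qed
  qed
  have key: "(\<integral>x. \<theta> x * ((\<eta> n *\<^sub>R c n x) \<bullet> \<psi> (fast n x)) \<partial>M\<Omega>)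
      = (\<integral>x. \<theta> x * (u n x \<bullet> curl_R R \<psi> (fast n x)) \<partial>M\<Omega>) + \<eta> n * (\<integral>x. u n x \<bullet> H n x \<partial>M\<Omega>)" for n
  proof -
    define \<phi> where "\<phi> x = \<theta> x *\<^sub>R \<psi> (A n *v x)" for x
    have "smooth \<phi>" unfolding \<phi>_def[abs_def] by (intro smooth_scaleR \<theta>(1) smooth_compose_matrix \<psi>(1))
    hence "\<phi> \<in> test_fields \<Omega>" unfolding test_fields_def C_infinity_iff_smooth using K by (auto simp: \<phi>_def)
    hence "(\<integral>x. c n x \<bullet> \<phi> x \<partial>M\<Omega>) = (\<integral>x. u n x \<bullet> curl \<phi> x \<partial>M\<Omega>)" using curl[of n] by (simp add: has_weak_curl_def)
    moreover have "curl \<phi> x = (1 / \<eta> n) *\<^sub>R (\<theta> x *\<^sub>R curl_R R \<psi> (fast n x)) + H n x" for x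
      unfolding \<phi>_def[abs_def] curl_product[OF \<theta>(1) \<psi>(1)] A_def curl_R_scale
      by (simp add: Afast[unfolded A_def] H_def mult.commute)
    ultimately have "(\<integral>x. c n x \<bullet> \<phi> x \<partial>M\<Omega>) = (\<integral>x. (1 / \<eta> n) * (u n x \<bullet> (\<theta> x *\<^sub>R curl_R R \<psi> (fast n x))) + u n x \<bullet> H n x \<partial>M\<Omega>)"
      by (simp add: inner_add_right)
    also have "\<dots> = (1 / \<eta> n) * (\<integral>x. u n x \<bullet> (\<theta> x *\<^sub>R curl_R R \<psi> (fast n x)) \<partial>M\<Omega>) + (\<integral>x. u n x \<bullet> H n x \<partial>M\<Omega>)"
      using integrable_inner[OF usq Hsq] integrable_inner[OF usq sqb[OF curl_R_continuous[OF \<psi>(1)] curl_R_periodic[OF \<psi>]]]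
      by (subst Bochner_Integration.integral_add) auto
    finally have eq: "(\<integral>x. c n x \<bullet> \<phi> x \<partial>M\<Omega>) = (1 / \<eta> n) * (\<integral>x. u n x \<bullet> (\<theta> x *\<^sub>R curl_R R \<psi> (fast n x)) \<partial>M\<Omega>) + (\<integral>x. u n x \<bullet> H n x \<partial>M\<Omega>)" .
    have "(\<integral>x. \<theta> x * ((\<eta> n *\<^sub>R c n x) \<bullet> \<psi> (fast n x)) \<partial>M\<Omega>) = (\<integral>x. \<eta> n * (c n x \<bullet> \<phi> x) \<partial>M\<Omega>)"
      by (rule Bochner_Integration.integral_cong) (simp_all add: \<phi>_def Afast)
    also have "\<dots> = \<eta> n * (\<integral>x. c n x \<bullet> \<phi> x \<partial>M\<Omega>)" by simp
    also have "\<dots> = (\<integral>x. u n x \<bullet> (\<theta> x *\<^sub>R curl_R R \<psi> (fast n x)) \<partial>M\<Omega>) + \<eta> n * (\<integral>x. u n x \<bullet> H n x \<partial>M\<Omega>)"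
      unfolding eq using \<eta>_pos[of n] by (simp add: distrib_left)
    finally show ?thesis by simp
  qed
  have "(\<lambda>n. \<eta> n * (\<integral>x. u n x \<bullet> H n x \<partial>M\<Omega>)) \<longlonglongrightarrow> 0"
  proof (rule Lim_null_comparison)
    have "\<bar>\<integral>x. u n x \<bullet> H n x \<partial>M\<Omega>\<bar> \<le> sqrt (C * E)" for n
    proof -
      have "(\<integral>x. u n x \<bullet> H n x \<partial>M\<Omega>)\<^sup>2 \<le> energy M\<Omega> (u n) * energy M\<Omega> (H n)" by (rule Cauchy_Schwarz_integral[OF usq Hsq])
      also have "\<dots> \<le> C * E" using C[of n] HE[of n] order_trans[OF energy_nonneg C[of n]] by (intro mult_mono) auto
      finally show ?thesis using real_le_rsqrt[of "\<bar>\<integral>x. u n x \<bullet> H n x \<partial>M\<Omega>\<bar>" "C * E"] by simp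
    qed
    thus "eventually (\<lambda>n. norm (\<eta> n * (\<integral>x. u n x \<bullet> H n x \<partial>M\<Omega>)) \<le> \<eta> n * sqrt (C * E)) sequentially"
      using \<eta>_pos by (auto simp: abs_mult less_imp_le intro!: always_eventually mult_left_mono)
    show "(\<lambda>n. \<eta> n * sqrt (C * E)) \<longlonglongrightarrow> 0" using tendsto_mult_left_zero[OF \<eta>_0] by simp
  qed
  from tendsto_add[OF vector_test_limit[OF u0 curl_R_continuous[OF \<psi>(1)] curl_R_periodic[OF \<psi>] \<theta>m \<theta>(2)] this]
  have "(\<lambda>n. \<integral>x. \<theta> x * ((\<eta> n *\<^sub>R c n x) \<bullet> \<psi> (fast n x)) \<partial>M\<Omega>) \<longlonglongrightarrow> (\<integral>z. \<theta> (fst z) * (u0 (fst z) (snd z) \<bullet> curl_R R \<psi> (snd z)) \<partial>M\<Omega>Y)"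
    unfolding key by simp
  with vector_test_limit[OF w0 \<psi>c \<psi>(2) \<theta>m \<theta>(2)] show ?thesis by (rule LIMSEQ_unique)
qed

text \<open>Cutoffs converging to the indicator of an open set show that the inner integral, as a function
  of x, has integral zero over every open subset of \<Omega>.\<close>

theorem curl_identity_AE:
  fixes u c :: "nat \<Rightarrow> real^3 \<Rightarrow> real^3" and U W :: "(real^3) \<times> (real^'m) \<Rightarrow> real^3"
  assumes curl: "\<And>n. has_weak_curl \<Omega> (u n) (c n)" and C: "\<And>n. energy M\<Omega> (u n) \<le> C"
    and u0: "weak_two_scale_vec \<Omega> R \<eta> u (\<lambda>x y. U (x, y))" and w0: "weak_two_scale_vec \<Omega> R \<eta> (\<lambda>n x. \<eta> n *\<^sub>R c n x) (\<lambda>x y. W (x, y))"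
    and Um: "U \<in> borel_measurable borel" and Wm: "W \<in> borel_measurable borel"
    and Usq: "square_integrable M\<Omega>Y U" and Wsq: "square_integrable M\<Omega>Y W"
    and \<psi>: "smooth \<psi>" "Y_periodic \<psi>"
  shows "AE x in M\<Omega>. (\<integral>y. W (x, y) \<bullet> \<psi> y - U (x, y) \<bullet> curl_R R \<psi> y \<partial>MY) = 0"
proof -
  have \<psi>c: "continuous_on UNIV \<psi>" by (rule smooth_continuous[OF \<psi>(1)])
  note Rc = curl_R_continuous[OF \<psi>(1), of R] and Rp = curl_R_periodic[OF \<psi>, of R]
  have snd_sq: "square_integrable M\<Omega>Y (\<lambda>z. g (snd z))" if g: "continuous_on UNIV g" "Y_periodic g" for g :: "real^'m \<Rightarrow> real^3"
  proof -
    obtain L where L: "0 \<le> L" "\<And>y. norm (g y) \<le> L" using smooth_periodic_bounded[OF g] by blast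
    show ?thesis
      by (rule square_integrable_bounded_on[OF \<Omega>Y_lmeasurable measurable_compose[OF snd_lebesgue_on_measurable borel_measurable_continuous_onI[OF g(1)]] L(2)])
  qed
  have snd_m: "(\<lambda>z. g (snd z)) \<in> borel_measurable (borel :: ((real^3) \<times> (real^'m)) measure)" if "continuous_on UNIV g" for g :: "real^'m \<Rightarrow> real^3"
    using that by (intro borel_measurable_continuous_onI continuous_on_compose2[OF that] continuous_intros) auto
  define h where "h z = W z \<bullet> \<psi> (snd z) - U z \<bullet> curl_R R \<psi> (snd z)" for z
  have hm: "h \<in> borel_measurable borel" unfolding h_def[abs_def]
    by (intro borel_measurable_diff borel_measurable_inner Um Wm snd_m \<psi>c Rc)
  have iW: "integrable M\<Omega>Y (\<lambda>z. W z \<bullet> \<psi> (snd z))" and iU: "integrable M\<Omega>Y (\<lambda>z. U z \<bullet> curl_R R \<psi> (snd z))"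
    by (intro integrable_inner Wsq Usq snd_sq \<psi>c \<psi> Rc Rp)+
  have hi: "integrable M\<Omega>Y h" unfolding h_def[abs_def] using iW iU by simp
  define F where "F x = (\<integral>y. h (x, y) \<partial>MY)" for x
  have Fi: "integrable M\<Omega> F" unfolding F_def[abs_def] by (rule Fubini_lebesgue_on(2)[OF \<Omega>_borel Y_cell_borel hm hi])
  have "AE x in M\<Omega>. F x = 0"
  proof (rule zero_on_open_imp_AE_zero[OF open_\<Omega> Fi])
    fix V assume V: "open V" "V \<subseteq> \<Omega>"
    obtain \<theta> :: "nat \<Rightarrow> real^3 \<Rightarrow> real" where \<theta>: "\<And>n. smooth (\<theta> n)" "\<And>n x. 0 \<le> \<theta> n x \<and> \<theta> n x \<le> 1"
      "\<And>n. \<exists>K. compact K \<and> K \<subseteq> V \<and> (\<forall>x. x \<notin> K \<longrightarrow> \<theta> n x = 0)" "\<And>x. (\<lambda>n. \<theta> n x) \<longlonglongrightarrow> indicator V x"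
      using smooth_cutoff_sequence[OF V(1)] by blast
    have \<theta>b: "\<bar>\<theta> n x\<bar> \<le> 1" for n x using \<theta>(2)[of n x] by simp
    have \<theta>c: "continuous_on UNIV (\<theta> n)" for n by (rule smooth_continuous[OF \<theta>(1)])
    have \<theta>m: "\<theta> n \<in> borel_measurable M\<Omega>" for n
      by (intro measurable_restrict_space1 measurable_completion) (simp add: borel_measurable_continuous_onI[OF \<theta>c])
    have fm: "(\<lambda>z. \<theta> n (fst z)) \<in> borel_measurable (borel :: ((real^3) \<times> (real^'m)) measure)" for n
      by (intro borel_measurable_continuous_onI continuous_on_compose2[OF \<theta>c] continuous_intros) auto
    have fM: "(\<lambda>z. \<theta> n (fst z)) \<in> borel_measurable M\<Omega>Y" for n
      by (intro measurable_restrict_space1 measurable_completion) (simp add: fm)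
    have mulI: "integrable M\<Omega>Y (\<lambda>z. \<theta> n (fst z) * g z)" if g: "integrable M\<Omega>Y g" for g n
    proof (rule Bochner_Integration.integrable_bound[OF g])
      show "(\<lambda>z. \<theta> n (fst z) * g z) \<in> borel_measurable M\<Omega>Y" using fM g by (intro borel_measurable_times) auto
      show "AE z in M\<Omega>Y. norm (\<theta> n (fst z) * g z) \<le> norm (g z)"
        by (rule AE_I2) (use \<theta>b in \<open>simp add: abs_mult mult_left_le_one_le\<close>)
    qed
    have zero: "(\<integral>x. \<theta> n x * F x \<partial>M\<Omega>) = 0" for n
    proof -
      obtain K where K: "compact K" "K \<subseteq> \<Omega>" "\<And>x. x \<notin> K \<Longrightarrow> \<theta> n x = 0" using \<theta>(3)[of n] V(2) by blast
      have "(\<integral>z. \<theta> n (fst z) * (W z \<bullet> \<psi> (snd z)) \<partial>M\<Omega>Y) = (\<integral>z. \<theta> n (fst z) * (U z \<bullet> curl_R R \<psi> (snd z)) \<partial>M\<Omega>Y)"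
        using two_scale_limit_of_curl[OF curl C u0 w0 \<theta>(1) \<theta>b K \<psi>] by simp
      hence "(\<integral>z. \<theta> n (fst z) * h z \<partial>M\<Omega>Y) = 0"
        unfolding h_def right_diff_distrib using mulI[OF iW] mulI[OF iU] by (subst Bochner_Integration.integral_diff) auto
      moreover have "(\<integral>z. \<theta> n (fst z) * h z \<partial>M\<Omega>Y) = (\<integral>x. (\<integral>y. \<theta> n x * h (x, y) \<partial>MY) \<partial>M\<Omega>)"
        using Fubini_lebesgue_on(1)[OF \<Omega>_borel Y_cell_borel borel_measurable_times[OF fm hm] mulI[OF hi]] by simp
      ultimately show ?thesis by (simp add: F_def)
    qed
    have VM: "(indicator V :: real^3 \<Rightarrow> real) \<in> borel_measurable M\<Omega>" using V(1) by (intro measurable_restrict_space1 borel_measurable_indicator) auto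
    have "(\<lambda>n. \<integral>x. \<theta> n x * F x \<partial>M\<Omega>) \<longlonglongrightarrow> (\<integral>x. indicator V x * F x \<partial>M\<Omega>)"
    proof (rule integral_dominated_convergence)
      show "integrable M\<Omega> (\<lambda>x. \<bar>F x\<bar>)" using Fi by simp
      show "(\<lambda>x. indicator V x * F x) \<in> borel_measurable M\<Omega>" using Fi V(1) by (intro borel_measurable_times VM) auto
      show "(\<lambda>x. \<theta> n x * F x) \<in> borel_measurable M\<Omega>" for n using Fi by (intro borel_measurable_times \<theta>m) auto
      show "AE x in M\<Omega>. (\<lambda>n. \<theta> n x * F x) \<longlonglongrightarrow> indicator V x * F x" by (intro AE_I2 tendsto_mult_right \<theta>(4))
      show "AE x in M\<Omega>. norm (\<theta> n x * F x) \<le> \<bar>F x\<bar>" for n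
        by (rule AE_I2) (use \<theta>b in \<open>simp add: abs_mult mult_left_le_one_le\<close>)
    qed
    hence "(\<lambda>n::nat. 0::real) \<longlonglongrightarrow> (\<integral>x. indicator V x * F x \<partial>M\<Omega>)" by (simp add: zero)
    thus "(\<integral>x. indicator V x * F x \<partial>M\<Omega>) = 0" by (simp add: LIMSEQ_const_iff)
  qed
  thus ?thesis unfolding F_def h_def by simp
qed

end

section \<open>Uniqueness of the periodic weak curl and the graph norm\<close>

text \<open>Differentiating a wave raises its phase by pi / 2 and multiplies it by a constant.\<close>

lemma smooth_upto_wave: "smooth_upto n (wave k j)"
proof (induction n arbitrary: j)
  case (Suc n)
  have D: "(wave k j has_derivative (\<lambda>h. (2 * pi * (k \<bullet> h)) *\<^sub>R wave k (j + 1) y)) (at y)" for y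
  proof -
    have "wave k (j + 1) y = - sin (2 * pi * (k \<bullet> y) + of_int j * (pi / 2))"
    proof -
      have "2 * pi * (k \<bullet> y) + of_int (j + 1) * (pi / 2) = (2 * pi * (k \<bullet> y) + of_int j * (pi / 2)) + pi / 2"
        by (simp add: distrib_right)
      thus ?thesis unfolding wave_def by (simp only: cos_add cos_pi_half sin_pi_half mult_zero_right mult_1_right diff_0)
    qed
    moreover have "(wave k j has_derivative (\<lambda>h. - sin (2 * pi * (k \<bullet> y) + of_int j * (pi / 2)) * (2 * pi * (k \<bullet> h)))) (at y)"
      unfolding wave_def[abs_def] by (auto intro!: derivative_eq_intros)
    ultimately show ?thesis by (simp add: mult.commute)
  qed
  have "wave k j differentiable (at y)" for y using D[of y] by (auto simp: differentiable_def)
  moreover have "partial_deriv i (wave k j) = (\<lambda>y. (2 * pi * (k $ i)) *\<^sub>R wave k (j + 1) y)" for i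
    by (intro ext) (simp add: partial_deriv_eq[OF D] inner_axis)
  moreover have "smooth_upto n (\<lambda>y. (2 * pi * (k $ i)) *\<^sub>R wave k (j + 1) y)" for i
    by (intro smooth_upto_scaleR smooth_upto_const Suc.IH)
  ultimately show ?case by simp
qed simp

lemma trig_poly_smooth: "t \<in> trig_poly \<Longrightarrow> smooth t"
proof (induction t rule: trig_poly.induct)
  case (trig_wave k j)
  then show ?case by (simp add: smooth_def smooth_upto_wave)
qed (auto intro: smooth_add smooth_mult smooth_const)

text \<open>Truncated multiples of the distance to the complement of the periodic extension of U. This
  complement is invariant under integer translations, so the distance is periodic.\<close>

lemma C_per_limit_of_open:
  fixes U :: "(real^'m) set"
  assumes U: "open U" "U \<subseteq> Y_cell"
  obtains f where "\<And>n. f n \<in> C_per" "\<And>n y. 0 \<le> f n y \<and> f n y \<le> 1" "\<And>y. y \<in> Y_cell \<Longrightarrow> (\<lambda>n. f n y) \<longlonglongrightarrow> indicator U y"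
proof -
  \<comment> \<open>the periodic extension of U\<close>
  define P where "P = (\<Union>k\<in>{k. integer_vec k}. (\<lambda>y. y + k) -` U)"
  define F where "F = - P"
  have "open ((\<lambda>y. y + k) -` U)" for k by (rule open_vimage[OF U(1)]) (intro continuous_intros)
  hence "open P" unfolding P_def by auto
  hence Fc: "closed F" unfolding F_def by (rule closed_Compl)
  have PY: "y \<in> P \<longleftrightarrow> y \<in> U" if y: "y \<in> Y_cell" for y
  proof
    assume "y \<in> P"
    then obtain k where k: "integer_vec k" "y + k \<in> U" by (auto simp: P_def)
    have "k $ i = 0" for i
    proof -
      obtain n where n: "k $ i = of_int n" using k(1) by (auto simp: integer_vec_def elim!: Ints_cases)
      have "0 < y $ i + k $ i \<and> y $ i + k $ i < 1" "0 < y $ i \<and> y $ i < 1" using k(2) U(2) y by (auto simp: Y_cell_def)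
      hence "real_of_int n < 1" "real_of_int n > - 1" using n by linarith+
      hence "n = 0" by linarith
      thus ?thesis using n by simp
    qed
    hence "k = 0" by (simp add: vec_eq_iff)
    thus "y \<in> U" using k(2) by simp
  next
    assume "y \<in> U"
    thus "y \<in> P" unfolding P_def using integer_vec_0 by (intro UN_I[of 0]) auto
  qed
  have Fshift: "y + l \<in> F" if "y \<in> F" "integer_vec l" for y l
    unfolding F_def P_def
  proof
    assume "y + l \<in> (\<Union>k\<in>{k. integer_vec k}. (\<lambda>y. y + k) -` U)"
    then obtain k where "integer_vec k" "y + (l + k) \<in> U" by (auto simp: add.assoc)
    hence "y \<in> P" unfolding P_def using integer_vec_add[OF that(2)] by blast
    thus False using that(1) by (simp add: F_def)
  qed
  have "0 \<notin> P"
  proof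
    assume "0 \<in> P"
    then obtain k where k: "integer_vec k" "k \<in> U" by (auto simp: P_def)
    have "0 < k $ undefined \<and> k $ undefined < 1" using k(2) U(2) by (auto simp: Y_cell_def)
    moreover obtain n where "k $ undefined = of_int n" using k(1) by (auto simp: integer_vec_def elim!: Ints_cases)
    ultimately have "0 < n \<and> n < 1" by simp
    thus False by linarith
  qed
  hence Fne: "F \<noteq> {}" by (auto simp: F_def)
  have le: "infdist (y + l) F \<le> infdist y F" if l: "integer_vec l" for y l
    unfolding infdist_notempty[OF Fne, of y]
  proof (rule cINF_greatest[OF Fne])
    fix a assume "a \<in> F"
    from infdist_le[OF Fshift[OF this l], of "y + l"] show "infdist (y + l) F \<le> dist y a" by (simp add: dist_norm)
  qed
  have per: "infdist (y + l) F = infdist y F" if l: "integer_vec l" for y l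
    using le[OF l, of y] le[OF integer_vec_minus[OF l], of "y + l"] by simp
  define f where "f n y = min 1 (real n * infdist y F)" for n :: nat and y
  show thesis
  proof (rule that[of f])
    show "f n \<in> C_per" for n
      unfolding C_per_def Y_periodic_def f_def using per by (auto intro!: continuous_intros)
    show "0 \<le> f n y \<and> f n y \<le> 1" for n y unfolding f_def by (simp add: infdist_nonneg)
    show "(\<lambda>n. f n y) \<longlonglongrightarrow> indicator U y" if y: "y \<in> Y_cell" for y
    proof (cases "y \<in> U")
      case True
      hence "y \<notin> F" using PY[OF y] by (simp add: F_def)
      hence pos: "infdist y F > 0" using infdist_pos_not_in_closed[OF Fc Fne] by blast
      obtain N where N: "1 / infdist y F < real N" using reals_Archimedean2 by blast
      have "f n y = 1" if "n \<ge> N" for n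
      proof -
        have "1 / infdist y F \<le> real n" using N that by (meson less_imp_le less_le_trans of_nat_le_iff)
        hence "1 \<le> real n * infdist y F" using pos by (simp add: divide_le_eq)
        thus ?thesis by (simp add: f_def)
      qed
      hence "eventually (\<lambda>n. f n y = 1) sequentially" by (auto simp: eventually_sequentially)
      thus ?thesis using True by (simp add: tendsto_eventually)
    next
      case False
      hence "y \<in> F" using PY[OF y] by (simp add: F_def)
      hence "f n y = 0" for n by (simp add: f_def)
      thus ?thesis using False by simp
    qed
  qed
qed

text \<open>Orthogonality passes to continuous periodic functions by uniform approximation, and from these
  to indicators of open subsets of the cell.\<close>

lemma trig_orthogonal_imp_zero:
  fixes h :: "real^'m \<Rightarrow> real"
  assumes h: "integrable (lebesgue_on Y_cell) h"
    and orth: "\<And>t. t \<in> trig_poly \<Longrightarrow> (\<integral>y. h y * t y \<partial>lebesgue_on Y_cell) = 0"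
  shows "AE y in lebesgue_on Y_cell. h y = 0"
proof -
  let ?M = "lebesgue_on (Y_cell :: (real^'m) set)"
  have hf: "integrable ?M (\<lambda>y. h y * f y)" if f: "f \<in> C_per" for f
  proof -
    obtain B where B: "0 \<le> B" "\<And>y. \<bar>f y\<bar> \<le> B" using C_per_bounded[OF f] by blast
    have fm: "f \<in> borel_measurable ?M" using C_per_measurable[OF f] by (intro measurable_restrict_space1 measurable_completion) simp
    show ?thesis
    proof (rule Bochner_Integration.integrable_bound[of _ "\<lambda>y. B * h y"])
      show "integrable ?M (\<lambda>y. B * h y)" using h by simp
      show "(\<lambda>y. h y * f y) \<in> borel_measurable ?M" using h fm by (intro borel_measurable_times) auto
      show "AE y in ?M. norm (h y * f y) \<le> norm (B * h y)"
        by (rule AE_I2) (use B in \<open>simp add: abs_mult mult.commute mult_right_mono\<close>)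
    qed
  qed
  have orthC: "(\<integral>y. h y * f y \<partial>?M) = 0" if f: "f \<in> C_per" for f
  proof -
    let ?H = "(\<integral>y. \<bar>h y\<bar> \<partial>?M)"
    have H0: "0 \<le> ?H" by (simp add: integral_nonneg_AE)
    have "\<bar>\<integral>y. h y * f y \<partial>?M\<bar> \<le> 0 + e" if e: "e > 0" for e
    proof -
      have d: "e / (?H + 1) > 0" using e H0 by (simp add: add_nonneg_pos)
      obtain t where t: "t \<in> trig_poly" "\<And>y. \<bar>f y - t y\<bar> < e / (?H + 1)" using C_per_uniform_trig_approx[OF f d] by blast
      have "(\<integral>y. h y * f y \<partial>?M) = (\<integral>y. h y * f y \<partial>?M) - (\<integral>y. h y * t y \<partial>?M)" using orth[OF t(1)] by simp
      also have "\<dots> = (\<integral>y. h y * (f y - t y) \<partial>?M)"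
        using hf[OF f] hf[OF trig_poly_C_per[OF t(1)]] by (simp add: right_diff_distrib)
      finally have "\<bar>\<integral>y. h y * f y \<partial>?M\<bar> \<le> (\<integral>y. \<bar>h y * (f y - t y)\<bar> \<partial>?M)" by (simp only: integral_abs_bound)
      also have "\<dots> \<le> (\<integral>y. e / (?H + 1) * \<bar>h y\<bar> \<partial>?M)"
      proof (rule integral_mono)
        show "integrable ?M (\<lambda>y. \<bar>h y * (f y - t y)\<bar>)"
          by (rule integrable_abs, rule hf[OF C_per_diff[OF f trig_poly_C_per[OF t(1)]]])
        show "integrable ?M (\<lambda>y. e / (?H + 1) * \<bar>h y\<bar>)" using h by simp
        show "\<bar>h y * (f y - t y)\<bar> \<le> e / (?H + 1) * \<bar>h y\<bar>" for y
          using mult_right_mono[OF less_imp_le[OF t(2)[of y]] abs_ge_zero[of "h y"]] by (simp add: abs_mult mult.commute)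
      qed
      also have "\<dots> = e * (?H / (?H + 1))" by simp
      also have "\<dots> \<le> e * 1"
      proof (rule mult_left_mono)
        have "0 < ?H + 1" using H0 by linarith
        thus "?H / (?H + 1) \<le> 1" by (subst divide_le_eq_1_pos) auto
      qed (use e in simp)
      finally show ?thesis by simp
    qed
    hence "\<bar>\<integral>y. h y * f y \<partial>?M\<bar> \<le> 0" by (rule field_le_epsilon)
    thus ?thesis by simp
  qed
  show ?thesis
  proof (rule zero_on_open_imp_AE_zero[OF open_Y_cell h])
    fix U :: "(real^'m) set" assume U: "open U" "U \<subseteq> Y_cell"
    obtain f where f: "\<And>n. f n \<in> C_per" "\<And>n y. 0 \<le> f n y \<and> f n y \<le> 1" "\<And>y. y \<in> Y_cell \<Longrightarrow> (\<lambda>n. f n y) \<longlonglongrightarrow> indicator U y"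
      using C_per_limit_of_open[OF U] by blast
    have "(\<lambda>n. \<integral>y. h y * f n y \<partial>?M) \<longlonglongrightarrow> (\<integral>y. h y * indicator U y \<partial>?M)"
    proof (rule integral_dominated_convergence)
      show "integrable ?M (\<lambda>y. \<bar>h y\<bar>)" using h by simp
      have "(indicator U :: real^'m \<Rightarrow> real) \<in> borel_measurable ?M" using U(1) by (intro measurable_restrict_space1 borel_measurable_indicator) auto
      thus "(\<lambda>y. h y * indicator U y) \<in> borel_measurable ?M" using h by (intro borel_measurable_times) auto
      show "(\<lambda>y. h y * f n y) \<in> borel_measurable ?M" for n using hf[OF f(1)[of n]] by auto
      show "AE y in ?M. (\<lambda>n. h y * f n y) \<longlonglongrightarrow> h y * indicator U y" by (rule AE_I2) (intro tendsto_mult_left f(3), simp)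
      show "AE y in ?M. norm (h y * f n y) \<le> \<bar>h y\<bar>" for n
        by (rule AE_I2) (use f(2) in \<open>simp add: abs_mult mult_left_le\<close>)
    qed
    hence "(\<lambda>n::nat. 0::real) \<longlonglongrightarrow> (\<integral>y. h y * indicator U y \<partial>?M)" by (simp add: orthC[OF f(1)])
    thus "(\<integral>y. indicator U y * h y \<partial>?M) = 0" by (simp add: LIMSEQ_const_iff mult.commute)
  qed
qed

lemma L2_on_iff: "f \<in> L2_on S \<longleftrightarrow> square_integrable (lebesgue_on S) f"
  by (simp add: L2_on_def square_integrable_def)

lemma L2_norm_power2: "(L2_norm S f)\<^sup>2 = energy (lebesgue_on S) f"
  by (simp add: L2_norm_def energy_def)

lemma periodic_continuous_square_integrable:
  fixes g :: "real^'m \<Rightarrow> real^3"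
  assumes "continuous_on UNIV g" "Y_periodic g"
  shows "square_integrable (lebesgue_on Y_cell) g"
proof -
  obtain L where L: "0 \<le> L" "\<And>y. norm (g y) \<le> L" using smooth_periodic_bounded[OF assms] by blast
  have m: "g \<in> borel_measurable (lebesgue_on Y_cell)"
    by (intro measurable_restrict_space1 measurable_completion) (simp add: borel_measurable_continuous_onI[OF assms(1)])
  show ?thesis by (rule square_integrable_bounded_on[OF Y_cell_lmeasurable m]) (rule L(2))
qed

lemma has_weak_curl_RD:
  assumes "has_weak_curl_R R u w"
  shows "square_integrable (lebesgue_on Y_cell) u" "square_integrable (lebesgue_on Y_cell) w" "Y_periodic u" "Y_periodic w"
    "\<And>\<psi>. smooth \<psi> \<Longrightarrow> Y_periodic \<psi> \<Longrightarrow> (\<integral>y. w y \<bullet> \<psi> y \<partial>lebesgue_on Y_cell) = (\<integral>y. u y \<bullet> curl_R R \<psi> y \<partial>lebesgue_on Y_cell)"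
  using assms by (auto simp: has_weak_curl_R_def L2_per_def L2_on_iff C_infinity_iff_smooth)

lemma has_weak_curl_RI:
  assumes "square_integrable (lebesgue_on Y_cell) u" "square_integrable (lebesgue_on Y_cell) w" "Y_periodic u" "Y_periodic w"
    "\<And>\<psi>. smooth \<psi> \<Longrightarrow> Y_periodic \<psi> \<Longrightarrow> (\<integral>y. w y \<bullet> \<psi> y \<partial>lebesgue_on Y_cell) = (\<integral>y. u y \<bullet> curl_R R \<psi> y \<partial>lebesgue_on Y_cell)"
  shows "has_weak_curl_R R u w"
  using assms by (auto simp: has_weak_curl_R_def L2_per_def L2_on_iff C_infinity_iff_smooth)

text \<open>Trigonometric polynomials times coordinate vectors are admissible test fields.\<close>

lemma weak_curl_unique:
  fixes R :: "real^3^'m"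
  assumes 1: "has_weak_curl_R R u w" and 2: "has_weak_curl_R R u w'"
  shows "AE y in lebesgue_on Y_cell. w y = w' y"
proof -
  let ?M = "lebesgue_on (Y_cell :: (real^'m) set)"
  note D1 = has_weak_curl_RD[OF 1] and D2 = has_weak_curl_RD[OF 2]
  have sq: "square_integrable ?M (\<lambda>y. w y - w' y)" by (rule square_integrable_diff[OF D1(2) D2(2)])
  have comp: "square_integrable ?M (\<lambda>y. (w y - w' y) $ i)" for i
  proof (rule square_integrable_bound)
    have "(\<lambda>y. (w y - w' y) \<bullet> axis i 1) \<in> borel_measurable ?M" using square_integrable_measurable[OF sq] by measurable
    thus "(\<lambda>y. (w y - w' y) $ i) \<in> borel_measurable ?M" by (simp add: inner_axis)
    show "integrable ?M (\<lambda>y. (norm (w y - w' y))\<^sup>2)" using sq by (simp add: square_integrable_def)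
    show "AE y in ?M. (norm ((w y - w' y) $ i))\<^sup>2 \<le> (norm (w y - w' y))\<^sup>2"
      by (intro AE_I2 power_mono) (simp_all only: real_norm_def component_le_norm_cart abs_ge_zero)
  qed
  have "AE y in ?M. (w y - w' y) $ i = 0" for i
  proof (rule trig_orthogonal_imp_zero)
    have "square_integrable ?M (\<lambda>y. 1 :: real)"
      by (rule square_integrable_bounded_on[OF Y_cell_lmeasurable, where B=1]) auto
    from integrable_mult[OF comp this] show "integrable ?M (\<lambda>y. (w y - w' y) $ i)" by simp
    fix t :: "real^'m \<Rightarrow> real" assume t: "t \<in> trig_poly"
    define \<psi> where "\<psi> y = t y *\<^sub>R (axis i 1 :: real^3)" for y
    have \<psi>: "smooth \<psi>" unfolding \<psi>_def[abs_def] by (intro smooth_scaleR smooth_const trig_poly_smooth t)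
    have \<psi>p: "Y_periodic \<psi>" using trig_poly_C_per[OF t] by (auto simp: \<psi>_def[abs_def] C_per_def Y_periodic_def)
    have \<psi>s: "square_integrable ?M \<psi>" by (rule periodic_continuous_square_integrable[OF smooth_continuous[OF \<psi>] \<psi>p])
    have "(\<integral>y. (w y - w' y) $ i * t y \<partial>?M) = (\<integral>y. w y \<bullet> \<psi> y - w' y \<bullet> \<psi> y \<partial>?M)"
      by (simp add: \<psi>_def inner_axis algebra_simps)
    also have "\<dots> = (\<integral>y. w y \<bullet> \<psi> y \<partial>?M) - (\<integral>y. w' y \<bullet> \<psi> y \<partial>?M)"
      by (rule Bochner_Integration.integral_diff) (rule integrable_inner[OF D1(2) \<psi>s] integrable_inner[OF D2(2) \<psi>s])+
    also have "\<dots> = 0" using D1(5)[OF \<psi> \<psi>p] D2(5)[OF \<psi> \<psi>p] by simp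
    finally show "(\<integral>y. (w y - w' y) $ i * t y \<partial>?M) = 0" .
  qed
  hence "AE y in ?M. \<forall>i. (w y - w' y) $ i = 0" by (simp add: AE_all_countable)
  thus ?thesis by eventually_elim (simp add: vec_eq_iff)
qed

lemma energy_Pair:
  assumes "square_integrable M u" "square_integrable M w"
  shows "square_integrable M (\<lambda>y. (u y, w y))" "energy M (\<lambda>y. (u y, w y)) = energy M u + energy M w"
proof -
  have n: "(norm (u y, w y))\<^sup>2 = (norm (u y))\<^sup>2 + (norm (w y))\<^sup>2" for y by (simp add: norm_Pair)
  have m: "(\<lambda>y. (u y, w y)) \<in> borel_measurable M"
    unfolding borel_prod[symmetric] using assms by (intro measurable_Pair) (auto simp: square_integrable_def)
  show "square_integrable M (\<lambda>y. (u y, w y))" unfolding square_integrable_def n using assms m by (auto simp: square_integrable_def)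
  show "energy M (\<lambda>y. (u y, w y)) = energy M u + energy M w"
    unfolding energy_def n using assms by (simp add: square_integrable_def)
qed

text \<open>By uniqueness the choice of the weak curl in the definition of the norm does not matter.\<close>

lemma H_curl_R_norm_eq:
  assumes uw: "has_weak_curl_R R u w"
  shows "H_curl_R_norm R u = sqrt (energy (lebesgue_on Y_cell) (\<lambda>y. (u y, w y)))"
proof -
  define w' where "w' = (SOME w. has_weak_curl_R R u w)"
  have w': "has_weak_curl_R R u w'" unfolding w'_def by (rule someI[of "has_weak_curl_R R u", OF uw])
  have "energy (lebesgue_on Y_cell) w' = energy (lebesgue_on Y_cell) w"
    unfolding energy_def
    by (rule integral_cong_AE)
       (use weak_curl_unique[OF w' uw] has_weak_curl_RD(2)[OF uw] has_weak_curl_RD(2)[OF w'] in \<open>auto simp: square_integrable_def elim!: eventually_mono\<close>)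
  thus ?thesis
    unfolding H_curl_R_norm_def L2_norm_power2 w'_def[symmetric]
    using energy_Pair(2)[OF has_weak_curl_RD(1,2)[OF uw]] by simp
qed

lemma has_weak_curl_R_diff:
  fixes R :: "real^3^'m"
  assumes 1: "has_weak_curl_R R u w" and 2: "has_weak_curl_R R u' w'"
  shows "has_weak_curl_R R (\<lambda>y. u y - u' y) (\<lambda>y. w y - w' y)"
proof (rule has_weak_curl_RI)
  note D1 = has_weak_curl_RD[OF 1] and D2 = has_weak_curl_RD[OF 2]
  show "square_integrable (lebesgue_on Y_cell) (\<lambda>y. u y - u' y)" "square_integrable (lebesgue_on Y_cell) (\<lambda>y. w y - w' y)"
    by (intro square_integrable_diff D1 D2)+
  show "Y_periodic (\<lambda>y. u y - u' y)" "Y_periodic (\<lambda>y. w y - w' y)" using D1(3,4) D2(3,4) by (auto simp: Y_periodic_def)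
  fix \<psi> :: "real^'m \<Rightarrow> real^3" assume \<psi>: "smooth \<psi>" "Y_periodic \<psi>"
  have s: "square_integrable (lebesgue_on Y_cell) \<psi>" "square_integrable (lebesgue_on Y_cell) (curl_R R \<psi>)"
    by (intro periodic_continuous_square_integrable smooth_continuous curl_R_continuous curl_R_periodic \<psi>)+
  show "(\<integral>y. (w y - w' y) \<bullet> \<psi> y \<partial>lebesgue_on Y_cell) = (\<integral>y. (u y - u' y) \<bullet> curl_R R \<psi> y \<partial>lebesgue_on Y_cell)"
    unfolding inner_diff_left
    using D1(5)[OF \<psi>] D2(5)[OF \<psi>] integrable_inner[OF D1(2) s(1)] integrable_inner[OF D2(2) s(1)]
      integrable_inner[OF D1(1) s(2)] integrable_inner[OF D2(1) s(2)] by simp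
qed

lemma has_weak_curl_R_zero: "has_weak_curl_R R (\<lambda>y. 0) (\<lambda>y. 0)"
  by (rule has_weak_curl_RI) (auto simp: square_integrable_def Y_periodic_def)

section \<open>Sections of the limit and Bochner measurability\<close>

lemma borel_representative_vec:
  fixes f :: "'a::euclidean_space \<Rightarrow> 'b::euclidean_space"
  assumes A: "A \<in> sets borel" and f: "f \<in> borel_measurable (lebesgue_on A)"
  obtains g where "g \<in> borel_measurable borel" "AE x in lebesgue_on A. f x = g x"
proof -
  have "\<exists>g. g \<in> borel_measurable borel \<and> (AE x in lebesgue_on A. f x \<bullet> b = g x)" for b
    by (rule borel_representative[OF A borel_measurable_inner[OF f borel_measurable_const]]) blast
  then obtain g where g: "\<And>b. g b \<in> borel_measurable borel" "\<And>b. AE x in lebesgue_on A. f x \<bullet> b = g b x" by metis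
  define G where "G x = (\<Sum>b\<in>Basis. g b x *\<^sub>R b)" for x
  have "G \<in> borel_measurable borel" unfolding G_def[abs_def] using g(1) by (intro borel_measurable_sum borel_measurable_scaleR) auto
  moreover have "AE x in lebesgue_on A. \<forall>b\<in>Basis. f x \<bullet> b = g b x" using g(2) by (intro AE_finite_allI) auto
  hence "AE x in lebesgue_on A. f x = G x"
  proof eventually_elim
    case (elim x)
    have "G x = (\<Sum>b\<in>Basis. (f x \<bullet> b) *\<^sub>R b)" unfolding G_def by (rule sum.cong) (use elim in auto)
    thus ?case by (simp add: euclidean_representation)
  qed
  ultimately show thesis by (rule that)
qed

lemma section_measurable:
  assumes "f \<in> borel_measurable (borel :: ('a::euclidean_space \<times> 'b::euclidean_space) measure)"
  shows "(\<lambda>y. f (x, y)) \<in> borel_measurable borel"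
  by (rule measurable_compose[OF _ assms]) (intro borel_measurable_continuous_onI continuous_intros)

lemma section_integral_measurable:
  fixes f :: "'a::euclidean_space \<times> 'b::euclidean_space \<Rightarrow> real"
  assumes B[measurable]: "B \<in> sets borel" and f: "f \<in> borel_measurable borel"
  shows "(\<lambda>x. \<integral>y. f (x, y) \<partial>lebesgue_on B) \<in> borel_measurable borel"
proof -
  have f2[measurable]: "f \<in> borel_measurable (borel \<Otimes>\<^sub>M borel)" using f by (simp add: borel_prod)
  have sec[measurable]: "(\<lambda>y. f (x, y)) \<in> borel_measurable borel" for x by (rule section_measurable[OF f])
  have "(\<integral>y. f (x, y) \<partial>lebesgue_on B) = (\<integral>y. indicator B y * f (x, y) \<partial>lborel)" for x
    by (subst integral_lebesgue_on, simp, rule integral_completion) measurable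
  moreover have "(\<lambda>x. \<integral>y. indicator B y * f (x, y) \<partial>lborel) \<in> borel_measurable borel"
  proof (rule lborel.borel_measurable_lebesgue_integral)
    have "(\<lambda>z. indicator B (snd z) * f z) \<in> borel_measurable (borel \<Otimes>\<^sub>M lborel)" by measurable
    thus "(\<lambda>(x, y). indicator B y * f (x, y)) \<in> borel_measurable (borel \<Otimes>\<^sub>M lborel)" by (simp add: case_prod_beta')
  qed
  ultimately show ?thesis by simp
qed

context two_scale
begin

lemma sections_square_integrable:
  fixes U :: "(real^3) \<times> (real^'m) \<Rightarrow> real^3"
  assumes Um: "U \<in> borel_measurable borel" and Usq: "square_integrable M\<Omega>Y U"
  shows "AE x in M\<Omega>. square_integrable MY (\<lambda>y. U (x, y))"
proof -
  have m: "(\<lambda>z. (norm (U z))\<^sup>2) \<in> borel_measurable borel" using Um by measurable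
  have i: "integrable M\<Omega>Y (\<lambda>z. (norm (U z))\<^sup>2)" using Usq by (simp add: square_integrable_def)
  have "AE x in M\<Omega>. integrable MY (\<lambda>y. (norm (U (x, y)))\<^sup>2)"
    by (rule Fubini_lebesgue_on(3)[OF \<Omega>_borel Y_cell_borel m i])
  thus ?thesis
  proof eventually_elim
    case (elim x)
    have "(\<lambda>y. U (x, y)) \<in> borel_measurable MY"
      using section_measurable[OF Um] by (intro measurable_restrict_space1 measurable_completion) simp
    thus ?case using elim by (simp add: square_integrable_def)
  qed
qed

definition curl_section :: "((real^3) \<times> (real^'m) \<Rightarrow> real^3) \<Rightarrow> ((real^3) \<times> (real^'m) \<Rightarrow> real^3) \<Rightarrow> real^3 \<Rightarrow> bool" where
  "curl_section U W x \<longleftrightarrow> square_integrable MY (\<lambda>y. U (x, y)) \<and> square_integrable MY (\<lambda>y. W (x, y)) \<and>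
     (\<forall>\<psi>. smooth \<psi> \<longrightarrow> Y_periodic \<psi> \<longrightarrow> (\<integral>y. W (x, y) \<bullet> \<psi> y \<partial>MY) = (\<integral>y. U (x, y) \<bullet> curl_R R \<psi> y \<partial>MY))"

text \<open>For x outside one null set the identity holds for countably many test fields, whose pairs (\<psi>,
  curl of \<psi>) are dense in the set of all such pairs. Both sides are continuous in this pair, so
  the identity extends.\<close>

lemma curl_section_AE:
  fixes U W :: "(real^3) \<times> (real^'m) \<Rightarrow> real^3"
  assumes Um: "U \<in> borel_measurable borel" and Wm: "W \<in> borel_measurable borel"
    and Usq: "square_integrable M\<Omega>Y U" and Wsq: "square_integrable M\<Omega>Y W"
    and id: "\<And>\<psi>. smooth \<psi> \<Longrightarrow> Y_periodic \<psi> \<Longrightarrow> AE x in M\<Omega>. (\<integral>y. W (x, y) \<bullet> \<psi> y - U (x, y) \<bullet> curl_R R \<psi> y \<partial>MY) = 0"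
  shows "AE x in M\<Omega>. curl_section U W x"
proof -
  define X where "X = {\<lambda>y :: real^'m. (\<psi> y, curl_R R \<psi> y) | \<psi>. smooth \<psi> \<and> Y_periodic \<psi>}"
  have sq\<psi>: "square_integrable MY \<psi>" "square_integrable MY (curl_R R \<psi>)" if "smooth \<psi>" "Y_periodic \<psi>" for \<psi> :: "real^'m \<Rightarrow> real^3"
    by (intro periodic_continuous_square_integrable smooth_continuous curl_R_continuous curl_R_periodic that)+
  have Xsq: "square_integrable MY f" if "f \<in> X" for f
  proof -
    obtain \<psi> where "f = (\<lambda>y. (\<psi> y, curl_R R \<psi> y))" "smooth \<psi>" "Y_periodic \<psi>" using \<open>f \<in> X\<close> unfolding X_def by blast
    thus ?thesis using energy_Pair(1)[OF sq\<psi>] by simp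
  qed
  obtain X0 where X0: "countable X0" "X0 \<subseteq> X" "\<And>f e. f \<in> X \<Longrightarrow> e > 0 \<Longrightarrow> \<exists>g\<in>X0. energy MY (\<lambda>x. f x - g x) < e"
    using L2_subset_separable[OF Y_cell_lmeasurable, of X] Xsq by blast
  \<comment> \<open>the defect of the identity is a scalar product with the pair (\<psi>, curl of \<psi>)\<close>
  have pt: "(\<integral>y. W (x, y) \<bullet> \<psi> y - U (x, y) \<bullet> curl_R R \<psi> y \<partial>MY) = (\<integral>y. (W (x, y), - U (x, y)) \<bullet> (\<psi> y, curl_R R \<psi> y) \<partial>MY)" for x \<psi>
    by simp
  have "AE x in M\<Omega>. \<forall>f\<in>X0. (\<integral>y. (W (x, y), - U (x, y)) \<bullet> f y \<partial>MY) = 0"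
    unfolding AE_ball_countable[OF X0(1)]
  proof
    fix f assume "f \<in> X0"
    then obtain \<psi> where f: "f = (\<lambda>y. (\<psi> y, curl_R R \<psi> y))" "smooth \<psi>" "Y_periodic \<psi>" using X0(2) unfolding X_def by blast
    show "AE x in M\<Omega>. (\<integral>y. (W (x, y), - U (x, y)) \<bullet> f y \<partial>MY) = 0"
      using id[OF f(2,3)] unfolding f(1) pt .
  qed
  with sections_square_integrable[OF Um Usq] sections_square_integrable[OF Wm Wsq] show ?thesis
  proof eventually_elim
    case (elim x)
    let ?Z = "\<lambda>y. (W (x, y), - U (x, y))"
    have Zsq: "square_integrable MY ?Z" by (rule energy_Pair(1)[OF elim(2) square_integrable_uminus[OF elim(1)]])
    have "(\<integral>y. W (x, y) \<bullet> \<psi> y \<partial>MY) = (\<integral>y. U (x, y) \<bullet> curl_R R \<psi> y \<partial>MY)" if \<psi>: "smooth \<psi>" "Y_periodic \<psi>" for \<psi>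
    proof -
      define f where "f y = (\<psi> y, curl_R R \<psi> y)" for y
      have fX: "f \<in> X" unfolding X_def f_def[abs_def] using \<psi> by blast
      have "(\<integral>y. ?Z y \<bullet> f y \<partial>MY)\<^sup>2 \<le> 0 + e" if e: "e > 0" for e
      proof -
        have Z1: "energy MY ?Z + 1 > 0" using energy_nonneg[of MY ?Z] by linarith
        hence "e / (energy MY ?Z + 1) > 0" using e by simp
        then obtain g where g: "g \<in> X0" "energy MY (\<lambda>y. f y - g y) < e / (energy MY ?Z + 1)" using X0(3)[OF fX] by blast
        have gsq: "square_integrable MY g" using g(1) X0(2) Xsq by blast
        have "(\<integral>y. ?Z y \<bullet> f y \<partial>MY) = (\<integral>y. ?Z y \<bullet> f y \<partial>MY) - (\<integral>y. ?Z y \<bullet> g y \<partial>MY)" using elim(3) g(1) by simp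
        also have "\<dots> = (\<integral>y. ?Z y \<bullet> (f y - g y) \<partial>MY)"
          using integrable_inner[OF Zsq Xsq[OF fX]] integrable_inner[OF Zsq gsq] by (simp only: inner_diff_right Bochner_Integration.integral_diff)
        finally have "(\<integral>y. ?Z y \<bullet> f y \<partial>MY)\<^sup>2 \<le> energy MY ?Z * energy MY (\<lambda>y. f y - g y)"
          using Cauchy_Schwarz_integral[OF Zsq square_integrable_diff[OF Xsq[OF fX] gsq]] by (simp only:)
        also have "\<dots> \<le> (energy MY ?Z + 1) * (e / (energy MY ?Z + 1))" using g(2) Z1 by (intro mult_mono) auto
        also have "\<dots> = e" using Z1 by simp
        finally show ?thesis by simp
      qed
      hence "(\<integral>y. ?Z y \<bullet> f y \<partial>MY)\<^sup>2 \<le> 0" by (rule field_le_epsilon)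
      hence "(\<integral>y. ?Z y \<bullet> f y \<partial>MY) = 0" by simp
      hence "(\<integral>y. W (x, y) \<bullet> \<psi> y - U (x, y) \<bullet> curl_R R \<psi> y \<partial>MY) = 0" by (simp add: f_def)
      thus ?thesis using integrable_inner[OF elim(2) sq\<psi>(1)[OF \<psi>]] integrable_inner[OF elim(1) sq\<psi>(2)[OF \<psi>]] by simp
    qed
    with elim show ?case unfolding curl_section_def by blast
  qed
qed

text \<open>Periodic extension in y from the cell, set to zero for the exceptional x. Every section is then
  periodic and has a weak curl, without exceptions.\<close>

definition periodic_section :: "(real^3 \<Rightarrow> bool) \<Rightarrow> ((real^3) \<times> (real^'m) \<Rightarrow> real^3) \<Rightarrow> real^3 \<Rightarrow> real^'m \<Rightarrow> real^3" where
  "periodic_section P U x y = (if P x then U (x, frac_vec y) else 0)"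

lemma periodic_section_weak_curl:
  "has_weak_curl_R R (periodic_section (curl_section U W) U x) (periodic_section (curl_section U W) W x)"
proof (cases "curl_section U W x")
  case True
  let ?u = "periodic_section (curl_section U W) U x" and ?w = "periodic_section (curl_section U W) W x"
  have eq: "U (x, y) = ?u y" "W (x, y) = ?w y" if "y \<in> space MY" for y
    using that True by (auto simp: periodic_section_def frac_vec_cell)
  show ?thesis
  proof (rule has_weak_curl_RI)
    show "square_integrable MY ?u" by (rule square_integrable_cong[OF eq(1)]) (use True in \<open>auto simp: curl_section_def\<close>)
    show "square_integrable MY ?w" by (rule square_integrable_cong[OF eq(2)]) (use True in \<open>auto simp: curl_section_def\<close>)
    show "Y_periodic ?u" "Y_periodic ?w" by (auto simp: Y_periodic_def periodic_section_def frac_vec_periodic)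
    fix \<psi> :: "real^'m \<Rightarrow> real^3" assume \<psi>: "smooth \<psi>" "Y_periodic \<psi>"
    have "(\<integral>y. ?w y \<bullet> \<psi> y \<partial>MY) = (\<integral>y. W (x, y) \<bullet> \<psi> y \<partial>MY)"
      by (rule Bochner_Integration.integral_cong) (use eq in auto)
    also have "\<dots> = (\<integral>y. U (x, y) \<bullet> curl_R R \<psi> y \<partial>MY)" using True \<psi> by (simp add: curl_section_def)
    also have "\<dots> = (\<integral>y. ?u y \<bullet> curl_R R \<psi> y \<partial>MY)"
      by (rule Bochner_Integration.integral_cong) (use eq in auto)
    finally show "(\<integral>y. ?w y \<bullet> \<psi> y \<partial>MY) = (\<integral>y. ?u y \<bullet> curl_R R \<psi> y \<partial>MY)" .
  qed
next
  case False
  hence "periodic_section (curl_section U W) U x = (\<lambda>y. 0)" "periodic_section (curl_section U W) W x = (\<lambda>y. 0)"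
    by (auto simp: periodic_section_def)
  thus ?thesis by (simp add: has_weak_curl_R_zero)
qed

lemma periodic_section_AE:
  assumes "AE x in M\<Omega>. P x"
  shows "AE z in M\<Omega>Y. periodic_section P U (fst z) (snd z) = U z"
  using AE_fst[OF assms] AE_space
proof eventually_elim
  case (elim z)
  thus ?case by (auto simp: periodic_section_def frac_vec_cell)
qed

text \<open>The pairs of a field and its weak curl form a separable subset of L2. The approximation at stage
  n takes the best among the first n + 1 members of a countable dense sequence; it has finitely
  many values, and the distances that select it are measurable in x.\<close>

theorem periodic_section_Bochner:
  fixes U W :: "(real^3) \<times> (real^'m) \<Rightarrow> real^3"
  assumes Um: "U \<in> borel_measurable borel" and Wm: "W \<in> borel_measurable borel"
    and Usq: "square_integrable M\<Omega>Y U" and Wsq: "square_integrable M\<Omega>Y W"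
    and good: "AE x in M\<Omega>. curl_section U W x"
  shows "periodic_section (curl_section U W) U \<in> L2_Bochner \<Omega> (H_curl_R R) (H_curl_R_norm R)"
proof -
  let ?u = "periodic_section (curl_section U W) U" and ?w = "periodic_section (curl_section U W) W"
  define Z where "Z z = (U z, W z)" for z
  have Zm: "Z \<in> borel_measurable borel" unfolding Z_def[abs_def]
    by (subst borel_prod[symmetric], rule measurable_Pair[OF Um Wm])
  have Zsq: "square_integrable M\<Omega>Y Z" unfolding Z_def[abs_def] by (rule energy_Pair(1)[OF Usq Wsq])
  define X where "X = {\<lambda>y :: real^'m. (u y, w y) | u w. has_weak_curl_R R u w}"
  have Xsq: "square_integrable MY f" if "f \<in> X" for f
  proof -
    obtain u w where "f = (\<lambda>y. (u y, w y))" "has_weak_curl_R R u w" using \<open>f \<in> X\<close> unfolding X_def by blast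
    thus ?thesis using energy_Pair(1)[OF has_weak_curl_RD(1,2)] by blast
  qed
  obtain X0 where X0: "countable X0" "X0 \<subseteq> X" "\<And>f e. f \<in> X \<Longrightarrow> e > 0 \<Longrightarrow> \<exists>g\<in>X0. energy MY (\<lambda>x. f x - g x) < e"
    using L2_subset_separable[OF Y_cell_lmeasurable, of X] Xsq by blast
  have "(\<lambda>y. (0, 0)) \<in> X" unfolding X_def
    by (intro CollectI exI[of _ "\<lambda>y. 0"] conjI refl has_weak_curl_R_zero)
  hence ne: "X0 \<noteq> {}" using X0(3)[of _ 1] by fastforce
  define p where "p = from_nat_into X0"
  have pX0: "p j \<in> X0" for j unfolding p_def by (rule from_nat_into[OF ne])
  have "\<forall>j. \<exists>u w. p j = (\<lambda>y. (u y, w y)) \<and> has_weak_curl_R R u w" using pX0 X0(2) unfolding X_def by blast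
  then obtain a b where ab: "\<And>j. p j = (\<lambda>y. (a j y, b j y))" "\<And>j. has_weak_curl_R R (a j) (b j)" by metis
  have ex: "\<exists>q. q \<in> borel_measurable borel \<and> (AE y in MY. p j y = q y)" for j
    by (rule borel_representative_vec[OF Y_cell_borel square_integrable_measurable[OF Xsq, of "p j"]]) (use pX0 X0(2) in blast)+
  \<comment> \<open>Borel versions, for the measurability of D below\<close>
  define q where "q j = (SOME q. q \<in> borel_measurable borel \<and> (AE y in MY. p j y = q y))" for j
  have q: "q j \<in> borel_measurable borel" "AE y in MY. p j y = q j y" for j
    unfolding q_def using someI_ex[OF ex[of j]] by (rule conjunct1, rule conjunct2)
  \<comment> \<open>squared graph distance from the section at x to p j\<close>
  define D where "D j x = (\<integral>y. (norm (Z (x, y) - q j y))\<^sup>2 \<partial>MY)" for j x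
  have Dm: "D j \<in> borel_measurable M\<Omega>" for j
  proof -
    have "(\<lambda>z :: (real^3) \<times> (real^'m). q j (snd z)) \<in> borel_measurable borel"
      by (rule measurable_compose[OF _ q(1)]) (intro borel_measurable_continuous_onI continuous_intros)
    hence "(\<lambda>z. (norm (Z z - q j (snd z)))\<^sup>2) \<in> borel_measurable borel" using Zm by measurable
    from section_integral_measurable[OF Y_cell_borel this]
    have "D j \<in> borel_measurable borel" unfolding D_def[abs_def] by simp
    thus ?thesis by (intro measurable_restrict_space1 measurable_completion) simp
  qed
  define k where "k n x = (LEAST j. j \<le> n \<and> (\<forall>i\<in>{..n}. D j x \<le> D i x))" for n x
  have kprop: "k n x \<le> n \<and> (\<forall>i\<in>{..n}. D (k n x) x \<le> D i x)" for n x
  proof -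
    have "\<exists>j\<in>{..n}. \<forall>i\<in>{..n}. D j x \<le> D i x"
      using ex_min_if_finite[of "(\<lambda>j. D j x) ` {..n}"] by (force simp: not_less)
    then obtain j where "j \<le> n \<and> (\<forall>i\<in>{..n}. D j x \<le> D i x)" by auto
    thus ?thesis unfolding k_def by (rule LeastI)
  qed
  have ksimple: "simple_function M\<Omega> (k n)" for n
  proof -
    have "(\<lambda>x. k n x) \<in> measurable M\<Omega> (count_space UNIV)"
      unfolding k_def
    proof (rule measurable_Least)
      fix j
      show "Measurable.pred M\<Omega> (\<lambda>x. j \<le> n \<and> (\<forall>i\<in>{..n}. D j x \<le> D i x))"
        using Dm by measurable
    qed
    hence "k n -` {j} \<inter> space M\<Omega> \<in> sets M\<Omega>" for j by (rule measurable_sets) simp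
    moreover have "finite (k n ` space M\<Omega>)" by (rule finite_subset[of _ "{..n}"]) (use kprop in auto)
    ultimately show ?thesis unfolding simple_function_def by blast
  qed
  define s where "s n x = a (k n x)" for n x
  have Deq: "D j x = energy MY (\<lambda>y. (?u x y, ?w x y) - p j y)" if x: "curl_section U W x" for j x
  proof -
    have "D j x = (\<integral>y. (norm ((?u x y, ?w x y) - q j y))\<^sup>2 \<partial>MY)" unfolding D_def
      by (rule Bochner_Integration.integral_cong) (use x in \<open>auto simp: Z_def periodic_section_def frac_vec_cell\<close>)
    also have "\<dots> = energy MY (\<lambda>y. (?u x y, ?w x y) - p j y)"
      unfolding energy_def
    proof (rule integral_cong_AE)
      note hw = has_weak_curl_RD(1,2)[OF periodic_section_weak_curl[of U W x]]
      have m1: "(\<lambda>y. (?u x y, ?w x y)) \<in> borel_measurable MY" by (rule square_integrable_measurable[OF energy_Pair(1)[OF hw]])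
      have m2: "q j \<in> borel_measurable MY" using q(1) by (intro measurable_restrict_space1 measurable_completion) simp
      have m3: "p j \<in> borel_measurable MY" by (rule square_integrable_measurable[OF Xsq]) (use pX0 X0(2) in blast)
      show "(\<lambda>y. (norm ((?u x y, ?w x y) - q j y))\<^sup>2) \<in> borel_measurable MY" using m1 m2 by measurable
      show "(\<lambda>y. (norm ((?u x y, ?w x y) - p j y))\<^sup>2) \<in> borel_measurable MY" using m1 m3 by measurable
      show "AE y in MY. (norm ((?u x y, ?w x y) - q j y))\<^sup>2 = (norm ((?u x y, ?w x y) - p j y))\<^sup>2"
        using q(2)[of j] by eventually_elim simp
    qed
    finally show ?thesis .
  qed
  have Neq: "H_curl_R_norm R (\<lambda>y. s n x y - ?u x y) = sqrt (D (k n x) x)" if x: "curl_section U W x" for n x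
  proof -
    have "has_weak_curl_R R (\<lambda>y. s n x y - ?u x y) (\<lambda>y. b (k n x) y - ?w x y)"
      unfolding s_def by (rule has_weak_curl_R_diff[OF ab(2) periodic_section_weak_curl])
    from H_curl_R_norm_eq[OF this] show ?thesis
      unfolding Deq[OF x] ab(1) s_def using energy_minus_commute[of MY "\<lambda>y. (?u x y, ?w x y)" "\<lambda>y. (a (k n x) y, b (k n x) y)"] by simp
  qed
  have Dlim: "(\<lambda>n. D (k n x) x) \<longlonglongrightarrow> 0" if x: "curl_section U W x" for x
  proof (rule LIMSEQ_I)
    fix e :: real assume e: "e > 0"
    have "(\<lambda>y. (?u x y, ?w x y)) \<in> X" unfolding X_def using periodic_section_weak_curl by blast
    then obtain g where g: "g \<in> X0" "energy MY (\<lambda>y. (?u x y, ?w x y) - g y) < e" using X0(3) e by blast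
    obtain j where j: "p j = g" unfolding p_def using from_nat_into_surj[OF X0(1) g(1)] by blast
    have Dj: "D j x < e" unfolding Deq[OF x] j by (rule g(2))
    show "\<exists>no. \<forall>n\<ge>no. norm (D (k n x) x - 0) < e"
    proof (intro exI[of _ j] allI impI)
      fix n assume "j \<le> n"
      hence "D (k n x) x \<le> D j x" using kprop[of n x] by auto
      moreover have "0 \<le> D (k n x) x" unfolding Deq[OF x] by simp
      ultimately show "norm (D (k n x) x - 0) < e" using Dj by simp
    qed
  qed
  show ?thesis
    unfolding L2_Bochner_def
  proof (intro CollectI conjI exI[of _ s] allI)
    show "AE x in M\<Omega>. ?u x \<in> H_curl_R R" unfolding H_curl_R_def using periodic_section_weak_curl by blast
    show "simple_function M\<Omega> (s n)" for n unfolding s_def[abs_def] by (rule simple_function_compose1[OF ksimple])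
    show "s n ` \<Omega> \<subseteq> H_curl_R R" for n unfolding s_def H_curl_R_def using ab(2) by blast
    show "AE x in M\<Omega>. (\<lambda>n. H_curl_R_norm R (\<lambda>y. s n x y - ?u x y)) \<longlonglongrightarrow> 0"
      using good
    proof eventually_elim
      case (elim x)
      have "(\<lambda>n. sqrt (D (k n x) x)) \<longlonglongrightarrow> sqrt 0" by (intro tendsto_intros Dlim elim)
      thus ?case by (simp add: Neq[OF elim])
    qed
    define E where "E x = (\<integral>y. (norm (Z (x, y)))\<^sup>2 \<partial>MY)" for x
    have Zn: "(\<lambda>z. (norm (Z z))\<^sup>2) \<in> borel_measurable borel" using Zm by measurable
    have Ei: "integrable M\<Omega> E" unfolding E_def[abs_def]
      by (rule Fubini_lebesgue_on(2)[OF \<Omega>_borel Y_cell_borel Zn]) (use Zsq in \<open>simp add: square_integrable_def\<close>)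
    have EN: "AE x in M\<Omega>. E x = (H_curl_R_norm R (?u x))\<^sup>2"
      using good
    proof eventually_elim
      case (elim x)
      have "E x = energy MY (\<lambda>y. (?u x y, ?w x y))" unfolding E_def energy_def
        by (rule Bochner_Integration.integral_cong) (use elim in \<open>auto simp: Z_def periodic_section_def frac_vec_cell\<close>)
      thus ?case using H_curl_R_norm_eq[OF periodic_section_weak_curl[of U W x]] by simp
    qed
    have Nm: "(\<lambda>x. (H_curl_R_norm R (?u x))\<^sup>2) \<in> borel_measurable M\<Omega>"
      by (rule borel_measurable_lebesgue_on_AE[OF \<Omega>_lebesgue _ EN]) (use Ei in auto)
    show "integrable M\<Omega> (\<lambda>x. (H_curl_R_norm R (?u x))\<^sup>2)"
      using Ei integrable_cong_AE[OF borel_measurable_integrable[OF Ei] Nm EN] by simp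
  qed
qed

lemma weak_two_scale_cong_AE:
  assumes w: "weak_two_scale \<Omega> R \<eta> v f" and eq: "AE z in M\<Omega>Y. f (fst z) (snd z) = g (fst z) (snd z)"
  shows "weak_two_scale \<Omega> R \<eta> v g"
proof -
  have f: "square_integrable M\<Omega>Y (\<lambda>z. f (fst z) (snd z))" using w by (simp add: weak_two_scale_def L2_on_iff case_prod_beta')
  have fm: "(\<lambda>z. f (fst z) (snd z)) \<in> borel_measurable M\<Omega>Y" using f by (simp add: square_integrable_def)
  have gm: "(\<lambda>z. g (fst z) (snd z)) \<in> borel_measurable M\<Omega>Y" by (rule borel_measurable_lebesgue_on_AE[OF \<Omega>Y_lebesgue fm eq])
  have g: "square_integrable M\<Omega>Y (\<lambda>z. g (fst z) (snd z))"
  proof (rule square_integrable_bound[OF gm])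
    show "integrable M\<Omega>Y (\<lambda>z. (norm (f (fst z) (snd z)))\<^sup>2)" using f by (simp add: square_integrable_def)
    show "AE z in M\<Omega>Y. (norm (g (fst z) (snd z)))\<^sup>2 \<le> (norm (f (fst z) (snd z)))\<^sup>2" using eq by eventually_elim simp
  qed
  have "(\<integral>(x, y). g x y * \<phi> x y \<partial>M\<Omega>Y) = (\<integral>(x, y). f x y * \<phi> x y \<partial>M\<Omega>Y)" if \<phi>: "\<phi> \<in> L2_Bochner \<Omega> C_per sup_norm" for \<phi>
    unfolding case_prod_beta'
    by (rule integral_cong_AE) (use eq in \<open>auto intro!: borel_measurable_times fm gm test_pair_measurable[OF \<phi>] elim!: eventually_mono\<close>)
  thus ?thesis using w g by (simp add: weak_two_scale_def L2_on_iff case_prod_beta')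
qed

end

section \<open>Two-scale limits of bounded fields with bounded scaled curl\<close>

theorem proposition8:
  fixes \<Omega> :: "(real^3) set"
    and R :: "real^3^'m"
    and \<eta> :: "nat \<Rightarrow> real"
    and u curl_u :: "nat \<Rightarrow> real^3 \<Rightarrow> real^3"
  assumes "open \<Omega>" and "bounded \<Omega>" and "lipschitz_boundary \<Omega>"
    and "CARD('m) > 3"
    and "\<And>k :: real^'m. integer_vec k \<Longrightarrow> k \<noteq> 0 \<Longrightarrow> transpose R *v k \<noteq> 0"
    and "\<And>n. \<eta> n > 0" and "\<eta> \<longlonglongrightarrow> 0"
    and "\<And>n. has_weak_curl \<Omega> (u n) (curl_u n)"
    and "\<exists>C. \<forall>n. L2_norm \<Omega> (u n) \<le> C"
    and "\<exists>C. \<forall>n. L2_norm \<Omega> (\<lambda>x. \<eta> n *\<^sub>R curl_u n x) \<le> C"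
  shows "\<exists>r :: nat \<Rightarrow> nat. \<exists>u0 curl_R_u0 :: real^3 \<Rightarrow> real^'m \<Rightarrow> real^3.
           strict_mono r \<and>
           u0 \<in> L2_Bochner \<Omega> (H_curl_R R) (H_curl_R_norm R) \<and>
           (AE x in lebesgue_on \<Omega>. has_weak_curl_R R (u0 x) (curl_R_u0 x)) \<and>
           weak_two_scale_vec \<Omega> R (\<eta> \<circ> r) (u \<circ> r) u0 \<and>
           weak_two_scale_vec \<Omega> R (\<eta> \<circ> r)
             (\<lambda>k x. \<eta> (r k) *\<^sub>R curl_u (r k) x) curl_R_u0"
proof -
  let ?M = "lebesgue_on \<Omega>" and ?MY = "lebesgue_on (\<Omega> \<times> (Y_cell :: (real^'m) set))"
  have ts: "two_scale \<Omega> R \<eta>" by unfold_locales (use assms in auto)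
  obtain C1 where C1: "\<And>n. L2_norm \<Omega> (u n) \<le> C1" using assms(9) by blast
  obtain C2 where C2: "\<And>n. L2_norm \<Omega> (\<lambda>x. \<eta> n *\<^sub>R curl_u n x) \<le> C2" using assms(10) by blast
  have L2pos: "0 \<le> L2_norm \<Omega> f" for f :: "real^3 \<Rightarrow> real^3" by (simp add: L2_norm_def)
  have usq: "square_integrable ?M (u n)" and csq: "square_integrable ?M (\<lambda>x. \<eta> n *\<^sub>R curl_u n x)" for n
    using assms(8)[of n] square_integrable_scaleR[of ?M "curl_u n" "\<eta> n"] by (auto simp: has_weak_curl_def L2_on_iff)
  have uC: "energy ?M (u n) \<le> C1\<^sup>2" for n
    using power_mono[OF C1 L2pos, of n 2] by (simp add: L2_norm_power2)
  have cC: "energy ?M (\<lambda>x. \<eta> n *\<^sub>R curl_u n x) \<le> C2\<^sup>2" for n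
    using power_mono[OF C2 L2pos, of n 2] by (simp add: L2_norm_power2)
  have comp: "square_integrable ?M (\<lambda>x. f x $ i) \<and> energy ?M (\<lambda>x. f x $ i) \<le> energy ?M f"
    if f: "square_integrable ?M f" for f :: "real^3 \<Rightarrow> real^3" and i
  proof -
    have "(\<lambda>x. f x \<bullet> axis i 1) \<in> borel_measurable ?M" using square_integrable_measurable[OF f] by measurable
    hence m: "(\<lambda>x. f x $ i) \<in> borel_measurable ?M" by (simp add: inner_axis)
    have le: "(norm (f x $ i))\<^sup>2 \<le> (norm (f x))\<^sup>2" for x
      by (intro power_mono) (simp_all only: real_norm_def component_le_norm_cart abs_ge_zero)
    have s: "square_integrable ?M (\<lambda>x. f x $ i)"
      by (rule square_integrable_bound[OF m, of "\<lambda>x. (norm (f x))\<^sup>2"]) (use f le in \<open>auto simp: square_integrable_def\<close>)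
    moreover have "energy ?M (\<lambda>x. f x $ i) \<le> energy ?M f"
      unfolding energy_def by (rule integral_mono) (use s f le in \<open>auto simp: square_integrable_def\<close>)
    ultimately show ?thesis by blast
  qed
  \<comment> \<open>all components of the fields and of the scaled curls, to obtain one common subsequence\<close>
  define v where "v = (\<lambda>(c :: bool, i :: 3) n x. if c then (\<eta> n *\<^sub>R curl_u n x) $ i else u n x $ i)"
  define C where "C = (\<lambda>(c :: bool, i :: 3). if c then C2\<^sup>2 else C1\<^sup>2)"
  have vsq: "square_integrable ?M (v p n)" for p n
  proof (cases p)
    case (Pair c i)
    show ?thesis using comp[OF usq[of n], of i] comp[OF csq[of n], of i] by (cases c) (simp_all add: v_def Pair)
  qed
  have vC: "energy ?M (v p n) \<le> C p" for p n
  proof (cases p)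
    case (Pair c i)
    show ?thesis using comp[OF usq[of n], of i] comp[OF csq[of n], of i] uC[of n] cC[of n]
      by (cases c) (simp_all add: v_def C_def Pair)
  qed
  have cJ: "countable (UNIV :: (bool \<times> 3) set)" by (rule countable_finite) simp
  obtain r and g :: "bool \<times> 3 \<Rightarrow> (real^3) \<times> (real^'m) \<Rightarrow> real" where r: "strict_mono r"
    and gsq: "\<And>p. square_integrable ?MY (g p)" and gw: "\<And>p. weak_two_scale \<Omega> R (\<eta> \<circ> r) (v p \<circ> r) (\<lambda>x y. g p (x, y))"
    by (rule two_scale_compactness[where v=v, OF ts cJ vsq vC]) auto
  interpret two_scale \<Omega> R "\<eta> \<circ> r" by (rule two_scale_subseq[OF ts r])
  have ex: "\<exists>G. G \<in> borel_measurable borel \<and> (AE z in ?MY. g p z = G z)" for p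
    by (rule borel_representative[OF borel_Times[OF \<Omega>_borel Y_cell_borel] square_integrable_measurable[OF gsq]]) blast
  \<comment> \<open>Borel versions, so that sections in y are measurable for every x\<close>
  define G where "G p = (SOME G. G \<in> borel_measurable borel \<and> (AE z in ?MY. g p z = G z))" for p
  have G: "G p \<in> borel_measurable borel" "AE z in ?MY. g p z = G p z" for p
    unfolding G_def using someI_ex[OF ex[of p]] by (rule conjunct1, rule conjunct2)
  define V where "V c z = (\<chi> i. G (c, i) z)" for c z
  have Vm: "V c \<in> borel_measurable borel" for c
  proof (subst borel_measurable_euclidean_space, intro ballI)
    fix e :: "real^3" assume "e \<in> Basis"
    then obtain i where "e = axis i 1" by (auto simp: Basis_vec_def)
    thus "(\<lambda>z. V c z \<bullet> e) \<in> borel_measurable borel" using G(1)[of "(c, i)"] by (simp add: V_def inner_axis)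
  qed
  have Gsq: "square_integrable ?MY (G p)" for p
  proof (rule square_integrable_bound)
    show "G p \<in> borel_measurable ?MY" using G(1) by (intro measurable_restrict_space1 measurable_completion) simp
    show "integrable ?MY (\<lambda>z. (norm (g p z))\<^sup>2)" using gsq by (simp add: square_integrable_def)
    show "AE z in ?MY. (norm (G p z))\<^sup>2 \<le> (norm (g p z))\<^sup>2" using G(2)[of p] by eventually_elim simp
  qed
  have Vsq: "square_integrable ?MY (V c)" for c
  proof -
    have "V c = (\<lambda>z. \<Sum>i\<in>UNIV. G (c, i) z *\<^sub>R axis i 1)"
      by (auto simp: V_def vec_eq_iff axis_def if_distrib cong: if_cong)
    moreover have "square_integrable ?MY \<dots>" by (intro square_integrable_sum square_integrable_scaleR_const Gsq)
    ultimately show ?thesis by simp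
  qed
  have Gw: "weak_two_scale \<Omega> R (\<eta> \<circ> r) (v p \<circ> r) (\<lambda>x y. G p (x, y))" for p
    by (rule weak_two_scale_cong_AE[OF gw]) (use G(2) in simp)
  have wu: "weak_two_scale_vec \<Omega> R (\<eta> \<circ> r) (u \<circ> r) (\<lambda>x y. V False (x, y))"
    unfolding weak_two_scale_vec_def
  proof
    fix i show "weak_two_scale \<Omega> R (\<eta> \<circ> r) (\<lambda>n x. (u \<circ> r) n x $ i) (\<lambda>x y. V False (x, y) $ i)"
      using Gw[of "(False, i)"] by (simp add: v_def V_def comp_def)
  qed
  have wc: "weak_two_scale_vec \<Omega> R (\<eta> \<circ> r) (\<lambda>k x. \<eta> (r k) *\<^sub>R curl_u (r k) x) (\<lambda>x y. V True (x, y))"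
    unfolding weak_two_scale_vec_def
  proof
    fix i show "weak_two_scale \<Omega> R (\<eta> \<circ> r) (\<lambda>n x. (\<eta> (r n) *\<^sub>R curl_u (r n) x) $ i) (\<lambda>x y. V True (x, y) $ i)"
      using Gw[of "(True, i)"] by (simp add: v_def V_def comp_def)
  qed
  have good: "AE x in ?M. curl_section (V False) (V True) x"
  proof (rule curl_section_AE[OF Vm Vm Vsq Vsq])
    fix \<psi> :: "real^'m \<Rightarrow> real^3" assume \<psi>: "smooth \<psi>" "Y_periodic \<psi>"
    show "AE x in ?M. (\<integral>y. V True (x, y) \<bullet> \<psi> y - V False (x, y) \<bullet> curl_R R \<psi> y \<partial>lebesgue_on Y_cell) = 0"
    proof (rule curl_identity_AE[where u="u \<circ> r" and c="curl_u \<circ> r" and C="C1\<^sup>2", OF _ _ wu _ Vm Vm Vsq Vsq \<psi>])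
      show "has_weak_curl \<Omega> ((u \<circ> r) n) ((curl_u \<circ> r) n)" for n using assms(8) by simp
      show "energy ?M ((u \<circ> r) n) \<le> C1\<^sup>2" for n using uC by simp
      show "weak_two_scale_vec \<Omega> R (\<eta> \<circ> r) (\<lambda>n x. (\<eta> \<circ> r) n *\<^sub>R (curl_u \<circ> r) n x) (\<lambda>x y. V True (x, y))" using wc by simp
    qed
  qed
  let ?S = "\<lambda>c. periodic_section (curl_section (V False) (V True)) (V c)"
  have sec: "AE z in ?MY. V c (fst z, snd z) $ i = ?S c (fst z) (snd z) $ i" for c i
    using periodic_section_AE[OF good, of "V c"] by eventually_elim simp
  have "?S False \<in> L2_Bochner \<Omega> (H_curl_R R) (H_curl_R_norm R)"
    by (rule periodic_section_Bochner[OF Vm Vm Vsq Vsq good])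
  moreover have "AE x in ?M. has_weak_curl_R R (?S False x) (?S True x)" using periodic_section_weak_curl by simp
  moreover have "weak_two_scale_vec \<Omega> R (\<eta> \<circ> r) (u \<circ> r) (?S False)"
    unfolding weak_two_scale_vec_def
    using weak_two_scale_cong_AE[OF _ sec] wu[unfolded weak_two_scale_vec_def] by blast
  moreover have "weak_two_scale_vec \<Omega> R (\<eta> \<circ> r) (\<lambda>k x. \<eta> (r k) *\<^sub>R curl_u (r k) x) (?S True)"
    unfolding weak_two_scale_vec_def
    using weak_two_scale_cong_AE[OF _ sec] wc[unfolded weak_two_scale_vec_def] by blast
  ultimately show ?thesis using r by blast
qed

end
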